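(* Let $(X,\mathcal{O}(X))$ be a measurable space, $\mathcal{A}$ a unital $C^*$-algebra and $\mathcal{H}$ a Hilbert space. Let $\mathcal{I}:\mathcal{O}(X)\to CP(\mathcal{A},\mathcal{B}(\mathcal{H}))$ be a UCP instrument whose POVM marginal $\mu_\mathcal{I}$ is a spectral (projection-valued) measure and whose CP marginal admits the decomposition $\phi_\mathcal{I}=\bigoplus_{i=1}^{\ell}\psi_i\otimes 1_{\mathbb{C}^{n_i}}$ (with $\mathcal{H}=\bigoplus_{i=1}^\ell\mathcal{H}_i\otimes\mathbb{C}^{n_i}$), where $\psi_i:\mathcal{A}\to\mathcal{B}(\mathcal{H}_i)$, $i=1,\dots,\ell$, are pure unital completely positive maps with $\dim\mathcal{H}_i<\infty$. Assume each $\psi_i$ admits a minimal Stinespring dilation $(\mathcal{H}_\pi,\pi,V_i)$ with respect to a fixed irreducible representation $\pi$ of $\mathcal{A}$ on $\mathcal{H}_\pi$, and that the family of subspaces $\{\mathrm{range}(V_i)\}_{i=1}^\ell$ is a nest in $\mathcal{H}_\pi$ (totally ordered by inclusion). Then $\mathcal{I}$ is $C^*$-extreme in $I_{\mathcal{H}}(X,\mathcal{A})$.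
   Context: A CP instrument is a map $\mathcal{I}$ from $\mathcal{O}(X)$ to the completely positive maps $\mathcal{A}\to\mathcal{B}(\mathcal{H})$ such that for all $a\in\mathcal{A}$, $h,k\in\mathcal{H}$, $A\mapsto\langle h,\mathcal{I}(A)(a)k\rangle$ is a countably additive complex measure. It is UCP if $\mathcal{I}(X)(1_\mathcal{A})=I_\mathcal{H}$; $I_{\mathcal{H}}(X,\mathcal{A})$ is the set of UCP instruments. Its POVM marginal is $\mu_\mathcal{I}(A)=\mathcal{I}(A)(1_\mathcal{A})$ and its CP marginal is $\phi_\mathcal{I}=\mathcal{I}(X)$. A CP map $\psi$ is pure if every CP map $\psi'$ with $\psi-\psi'$ CP is of the form $t\psi$, $t\in[0,1]$. A minimal Stinespring dilation $(\mathcal{H}_\pi,\pi,V_i)$ of $\psi_i$ means $\psi_i(a)=V_i^*\pi(a)V_i$ with $V_i:\mathcal{H}_i\to\mathcal{H}_\pi$ and $\overline{\mathrm{span}}\,\pi(\mathcal{A})V_i\mathcal{H}_i=\mathcal{H}_\pi$. $\mathcal{I}$ is $C^*$-extreme if whenever $\mathcal{I}(\cdot)=\sum_{i=1}^nT_i^*\mathcal{I}_i(\cdot)T_i$ with $\mathcal{I}_i\in I_{\mathcal{H}}(X,\mathcal{A})$ and invertible $T_i\in\mathcal{B}(\mathcal{H})$, $\sum T_i^*T_i=I_\mathcal{H}$, there are unitaries $U_i$ with $\mathcal{I}_i(\cdot)=U_i^*\mathcal{I}(\cdot)U_i$. *)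

theory Defs
  imports "HOL-Analysis.Analysis" "Jordan_Normal_Form.Matrix"
begin

class complex_vs = ab_group_add +
  fixes cscale :: "complex \<Rightarrow> 'a \<Rightarrow> 'a"
  assumes cscale_add_right: "cscale c (x + y) = cscale c x + cscale c y"
    and cscale_add_left: "cscale (b + c) x = cscale b x + cscale c x"
    and cscale_cscale: "cscale b (cscale c x) = cscale (b * c) x"
    and cscale_one: "cscale 1 x = x"

class complex_normed = complex_vs + real_normed_vector +
  assumes scaleR_cscale: "scaleR r x = cscale (complex_of_real r) x"
    and norm_cscale: "norm (cscale c x) = cmod c * norm x"

class chilbert = complex_normed + complete_space +
  fixes cinner :: "'a \<Rightarrow> 'a \<Rightarrow> complex"
  assumes cinner_cnj: "cinner x y = cnj (cinner y x)"
    and cinner_add_right: "cinner x (y + z) = cinner x y + cinner x z"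
    and cinner_cscale_right: "cinner x (cscale c y) = c * cinner x y"
    and cinner_self_norm: "cinner x x = complex_of_real ((norm x)\<^sup>2)"

class cstar_algebra = complex_normed + real_normed_algebra_1 + banach +
  fixes cstar :: "'a \<Rightarrow> 'a"
  assumes cscale_mult_left: "cscale c (x * y) = cscale c x * y"
    and cscale_mult_right: "cscale c (x * y) = x * cscale c y"
    and cstar_cstar: "cstar (cstar x) = x"
    and cstar_add: "cstar (x + y) = cstar x + cstar y"
    and cstar_cscale: "cstar (cscale c x) = cscale (cnj c) (cstar x)"
    and cstar_mult: "cstar (x * y) = cstar y * cstar x"
    and cstar_identity: "norm (cstar x * x) = (norm x)\<^sup>2"

definition cspan :: "'a::complex_vs set \<Rightarrow> 'a set" where
  "cspan S = {x. \<exists>F c. finite F \<and> F \<subseteq> S \<and> x = (\<Sum>s\<in>F. cscale (c s) s)}"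

definition closed_csubspace :: "'a::chilbert set \<Rightarrow> bool" where
  "closed_csubspace S \<longleftrightarrow> 0 \<in> S \<and> (\<forall>x\<in>S. \<forall>y\<in>S. x + y \<in> S)
     \<and> (\<forall>c. \<forall>x\<in>S. cscale c x \<in> S) \<and> closed S"

definition bounded_clinear_op :: "('p::chilbert \<Rightarrow> 'p) \<Rightarrow> bool" where
  "bounded_clinear_op T \<longleftrightarrow> (\<forall>x y. T (x + y) = T x + T y) \<and> (\<forall>c x. T (cscale c x) = cscale c (T x))
     \<and> (\<exists>K. \<forall>x. norm (T x) \<le> K * norm x)"

definition star_rep :: "('a::cstar_algebra \<Rightarrow> 'p::chilbert \<Rightarrow> 'p) \<Rightarrow> bool" where
  "star_rep \<pi> \<longleftrightarrow> (\<forall>a. bounded_clinear_op (\<pi> a))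
     \<and> (\<forall>a b. \<pi> (a + b) = (\<lambda>x. \<pi> a x + \<pi> b x))
     \<and> (\<forall>c a. \<pi> (cscale c a) = (\<lambda>x. cscale c (\<pi> a x)))
     \<and> (\<forall>a b. \<pi> (a * b) = \<pi> a \<circ> \<pi> b)
     \<and> \<pi> 1 = id
     \<and> (\<forall>a x y. cinner (\<pi> (cstar a) x) y = cinner x (\<pi> a y))"

definition irreducible_rep :: "('a::cstar_algebra \<Rightarrow> 'p::chilbert \<Rightarrow> 'p) \<Rightarrow> bool" where
  "irreducible_rep \<pi> \<longleftrightarrow> star_rep \<pi> \<and> (UNIV :: 'p set) \<noteq> {0}
     \<and> (\<forall>S. closed_csubspace S \<and> (\<forall>a. \<pi> a ` S \<subseteq> S) \<longrightarrow> S = {0} \<or> S = UNIV)"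

definition vinner :: "complex vec \<Rightarrow> complex vec \<Rightarrow> complex" where
  "vinner u v = (\<Sum>i<dim_vec v. cnj (u $ i) * v $ i)"

definition madj :: "complex mat \<Rightarrow> complex mat" where
  "madj M = mat (dim_col M) (dim_row M) (\<lambda>(i, j). cnj (M $$ (j, i)))"

definition psd_mat :: "nat \<Rightarrow> complex mat \<Rightarrow> bool" where
  "psd_mat n M \<longleftrightarrow> M \<in> carrier_mat n n \<and>
     (\<forall>v \<in> carrier_vec n. Im (vinner v (M *\<^sub>v v)) = 0 \<and> Re (vinner v (M *\<^sub>v v)) \<ge> 0)"

definition unitary_mat :: "nat \<Rightarrow> complex mat \<Rightarrow> bool" where
  "unitary_mat n U \<longleftrightarrow> U \<in> carrier_mat n n \<and> madj U * U = 1\<^sub>m n \<and> U * madj U = 1\<^sub>m n"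

definition msum :: "nat \<Rightarrow> ('i \<Rightarrow> complex mat) \<Rightarrow> 'i set \<Rightarrow> complex mat" where
  "msum n f S = mat n n (\<lambda>(r, c). \<Sum>i\<in>S. f i $$ (r, c))"

definition tensor_id :: "complex mat \<Rightarrow> nat \<Rightarrow> complex mat" where
  "tensor_id M k = mat (dim_row M * k) (dim_col M * k)
     (\<lambda>(r, c). if r mod k = c mod k then M $$ (r div k, c div k) else 0)"

text \<open>Amplification \<phi>_n applied to the positive element B*B of M_n(A).\<close>
definition amplify_pos :: "nat \<Rightarrow> ('a::cstar_algebra \<Rightarrow> complex mat) \<Rightarrow> nat \<Rightarrow> (nat \<Rightarrow> nat \<Rightarrow> 'a) \<Rightarrow> complex mat" where
  "amplify_pos d \<phi> n B = mat (n * d) (n * d)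
     (\<lambda>(r, c). \<phi> (\<Sum>l<n. cstar (B l (r div d)) * B l (c div d)) $$ (r mod d, c mod d))"

definition cp_map :: "nat \<Rightarrow> ('a::cstar_algebra \<Rightarrow> complex mat) \<Rightarrow> bool" where
  "cp_map d \<phi> \<longleftrightarrow> (\<forall>a. \<phi> a \<in> carrier_mat d d)
     \<and> (\<forall>a b. \<phi> (a + b) = \<phi> a + \<phi> b)
     \<and> (\<forall>c a. \<phi> (cscale c a) = c \<cdot>\<^sub>m \<phi> a)
     \<and> (\<forall>n B. psd_mat (n * d) (amplify_pos d \<phi> n B))"

definition ucp_map :: "nat \<Rightarrow> ('a::cstar_algebra \<Rightarrow> complex mat) \<Rightarrow> bool" where
  "ucp_map d \<phi> \<longleftrightarrow> cp_map d \<phi> \<and> \<phi> 1 = 1\<^sub>m d"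

definition pure_cp :: "nat \<Rightarrow> ('a::cstar_algebra \<Rightarrow> complex mat) \<Rightarrow> bool" where
  "pure_cp d \<psi> \<longleftrightarrow> cp_map d \<psi> \<and>
     (\<forall>\<psi>'. cp_map d \<psi>' \<and> cp_map d (\<lambda>a. \<psi> a - \<psi>' a) \<longrightarrow>
        (\<exists>t::real. 0 \<le> t \<and> t \<le> 1 \<and> \<psi>' = (\<lambda>a. complex_of_real t \<cdot>\<^sub>m \<psi> a)))"

definition cp_instrument :: "'x measure \<Rightarrow> nat \<Rightarrow> ('x set \<Rightarrow> 'a::cstar_algebra \<Rightarrow> complex mat) \<Rightarrow> bool" where
  "cp_instrument X N I \<longleftrightarrow> (\<forall>A\<in>sets X. cp_map N (I A)) \<and>
     (\<forall>a h k F. h \<in> carrier_vec N \<longrightarrow> k \<in> carrier_vec N \<longrightarrow> range F \<subseteq> sets X \<longrightarrow> disjoint_family F \<longrightarrow>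
        (\<lambda>n. vinner h (I (F n) a *\<^sub>v k)) sums vinner h (I (\<Union>n. F n) a *\<^sub>v k))"

definition ucp_instrument :: "'x measure \<Rightarrow> nat \<Rightarrow> ('x set \<Rightarrow> 'a::cstar_algebra \<Rightarrow> complex mat) \<Rightarrow> bool" where
  "ucp_instrument X N I \<longleftrightarrow> cp_instrument X N I \<and> I (space X) 1 = 1\<^sub>m N"

definition cstar_extreme :: "'x measure \<Rightarrow> nat \<Rightarrow> ('x set \<Rightarrow> 'a::cstar_algebra \<Rightarrow> complex mat) \<Rightarrow> bool" where
  "cstar_extreme X N I \<longleftrightarrow> ucp_instrument X N I \<and>
     (\<forall>(n::nat) (T :: nat \<Rightarrow> complex mat) (J :: nat \<Rightarrow> 'x set \<Rightarrow> 'a \<Rightarrow> complex mat).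
        (\<forall>i<n. ucp_instrument X N (J i) \<and> T i \<in> carrier_mat N N \<and> invertible_mat (T i))
        \<and> msum N (\<lambda>i. madj (T i) * T i) {..<n} = 1\<^sub>m N
        \<and> (\<forall>A\<in>sets X. \<forall>a. I A a = msum N (\<lambda>i. madj (T i) * J i A a * T i) {..<n})
        \<longrightarrow> (\<exists>U. \<forall>i<n. unitary_mat N (U i) \<and>
               (\<forall>A\<in>sets X. \<forall>a. J i A a = madj (U i) * I A a * U i)))"

end

theory Submission
  imports Defs "Jordan_Normal_Form.Determinant"
begin

text \<open>
  Since the POVM marginal \<open>\<mu>\<close> is projection-valued, every CP instrument \<open>\<Theta>\<close> dominated by \<open>I\<close> satisfies
  \<open>\<Theta>(A)(a) = \<mu>(A) \<Theta>(X)(a) = \<Theta>(X)(a) \<mu>(A)\<close>. The decomposition of \<open>\<phi> = I(X)\<close> identifies \<open>\<complex>\<^sup>N\<close> with the families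
  \<open>(\<xi>\<^sub>e)\<close>, \<open>\<xi>\<^sub>e \<in> R\<^sub>e\<close>, indexed by the multiplicity space, where the \<open>R\<^sub>e\<close> are ranges of the \<open>V\<^sub>i\<close>, and \<open>\<phi>(a)\<close>
  acts by compressing \<open>\<pi>(a)\<close> in every component. A CP map dominated by \<open>\<phi>\<close> has the form
  \<open>\<langle>h, \<Theta>(a) k\<rangle> = \<Sum> D\<^sub>e\<^sub>f \<langle>h\<^sub>e, \<pi>(a) k\<^sub>f\<rangle>\<close> for a positive scalar matrix \<open>D\<close>: purity of the
  smallest \<open>\<psi>\<^sub>i\<close> gives this for vectors with components in the smallest \<open>R\<^sub>i\<close>, and minimality extends it
  by density. Applied to \<open>I(A)\<close>, this shows that \<open>\<mu>\<close> acts on the multiplicity space by commuting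
  projections preserving the classes of equal \<open>R\<^sub>e\<close>, so that the index set may be chosen to
  diagonalize \<open>\<mu>\<close>. Applied to \<open>\<Theta> = T\<^sup>* J T\<close>, it gives a matrix \<open>D\<close> commuting with \<open>\<mu>\<close>; its Cholesky factor along
  the nest maps the families \<open>(\<xi>\<^sub>e)\<close> to themselves and hence defines an \<open>M\<close> on \<open>\<complex>\<^sup>N\<close> which commutes with \<open>\<mu>\<close>
  and satisfies \<open>\<Theta> = M\<^sup>* I M\<close>. Then \<open>U = M T\<^sup>-\<^sup>1\<close> is the required unitary.
\<close>

text \<open>Purity speaks about one \<open>\<psi>\<close> at a time, whereas a dominated map may
  couple summands belonging to different spaces of the nest. The way around this is to test only on
  vectors from the smallest space: it lies in every other one, so it can be placed in any component
  and along any direction of the multiplicity space, and one pure map then controls all couplings at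
  once. A positive \<open>D\<close> also has a positive square root, but that is of no use here. A
  scalar matrix \<open>S\<close> maps admissible families to admissible families only if
  \<open>S e f \<noteq> 0\<close> forces the space of \<open>f\<close> into the space of
  \<open>e\<close>. A triangular factor has this property when the pivots are eliminated from the
  largest space downwards, and the total order of the nest is what makes any two labels comparable.
  Nothing is completed or quotiented: tensors are lists, and statements about bounded operators on
  the dilation space are statements about sesquilinear forms that are bounded by the dilation norm.
  Invertibility of \<open>M\<close> is not proved separately; it comes from unitality and the finite
  dimension of \<open>H\<close> once \<open>M\<close> is composed with the inverse of
  \<open>T\<close>.\<close>

no_notation Finite_Cartesian_Product.vec.vec_nth (infixl "$" 90)

section \<open>Hilbert spaces and spans\<close>

lemma cscale_zero_right [simp]: "cscale c (0::'a::complex_vs) = 0"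
  using cscale_add_right[of c 0 0] by simp

lemma cscale_zero_left [simp]: "cscale 0 (x::'a::complex_vs) = 0"
  using cscale_add_left[of 0 0 x] by simp

lemma cscale_minus_left: "cscale (- c) (x::'a::complex_vs) = - cscale c x"
  using cscale_add_left[of c "- c" x] by (simp add: eq_neg_iff_add_eq_0 add.commute)

lemma cscale_sum_right: "cscale c (\<Sum>i\<in>F. f i) = (\<Sum>i\<in>F. cscale c (f i :: 'a::complex_vs))"
  by (induction F rule: infinite_finite_induct) (auto simp: cscale_add_right)

lemma cscale_sum_left: "cscale (\<Sum>i\<in>F. f i) (x::'a::complex_vs) = (\<Sum>i\<in>F. cscale (f i) x)"
  by (induction F rule: infinite_finite_induct) (auto simp: cscale_add_left)

lemma cinner_zero_right [simp]: "cinner x (0::'p::chilbert) = 0"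
  using cinner_add_right[of x 0 0] by simp

lemma cinner_zero_left [simp]: "cinner (0::'p::chilbert) x = 0"
  using cinner_cnj[of 0 x] by simp

lemma cinner_add_left: "cinner (x + y) (z::'p::chilbert) = cinner x z + cinner y z"
  using cinner_cnj[of "x + y" z] cinner_cnj[of x z] cinner_cnj[of y z] by (simp add: cinner_add_right)

lemma cinner_cscale_left: "cinner (cscale c x) (y::'p::chilbert) = cnj c * cinner x y"
  using cinner_cnj[of "cscale c x" y] cinner_cnj[of x y] by (simp add: cinner_cscale_right)

lemma cinner_diff_right: "cinner x (y - z::'p::chilbert) = cinner x y - cinner x z"
  using cinner_add_right[of x "y - z" z] by simp

lemma cinner_diff_left: "cinner (x - y::'p::chilbert) z = cinner x z - cinner y z"
  using cinner_add_left[of "x - y" y z] by simp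

lemma cinner_sum_right: "cinner x (\<Sum>i\<in>F. f i) = (\<Sum>i\<in>F. cinner x (f i :: 'p::chilbert))"
  by (induction F rule: infinite_finite_induct) (auto simp: cinner_add_right)

lemma cinner_sum_left: "cinner (\<Sum>i\<in>F. f i) x = (\<Sum>i\<in>F. cinner (f i :: 'p::chilbert) x)"
  by (induction F rule: infinite_finite_induct) (auto simp: cinner_add_left)

lemma cinner_sum_list_right: "cinner x (\<Sum>i\<leftarrow>F. f i) = (\<Sum>i\<leftarrow>F. cinner x (f i :: 'p::chilbert))"
  by (induction F) (auto simp: cinner_add_right)

lemma cinner_sum_list_left: "cinner (\<Sum>i\<leftarrow>F. f i) x = (\<Sum>i\<leftarrow>F. cinner (f i :: 'p::chilbert) x)"
  by (induction F) (auto simp: cinner_add_left)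

lemma sum_list_sum_swap: "(\<Sum>y\<leftarrow>ys. \<Sum>e\<in>F. f y e) = (\<Sum>e\<in>F. \<Sum>y\<leftarrow>ys. f y e :: 'b::comm_monoid_add)"
  by (induction ys) (auto simp: sum.distrib)

lemma sum_list_sum_list_sum:
  "(\<Sum>x\<leftarrow>xs. \<Sum>y\<leftarrow>ys. \<Sum>e\<in>F. f x y e) = (\<Sum>e\<in>F. \<Sum>x\<leftarrow>xs. \<Sum>y\<leftarrow>ys. f x y e :: 'b::comm_monoid_add)"
  by (simp add: sum_list_sum_swap)

lemma sum_list_cinner:
  "(\<Sum>x\<leftarrow>xs. \<Sum>y\<leftarrow>ys. cinner (f x) (g y :: 'p::chilbert)) = cinner (\<Sum>x\<leftarrow>xs. f x) (\<Sum>y\<leftarrow>ys. g y)"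
  unfolding cinner_sum_list_left by (simp only: cinner_sum_list_right)

lemma sum_cscale_swap:
  "(\<Sum>f\<in>F. cscale (b f) (\<Sum>g\<in>G. cscale (c f g) (x g))) = (\<Sum>g\<in>G. cscale (\<Sum>f\<in>F. b f * c f g) (x g :: 'p::complex_vs))"
  unfolding cscale_sum_right cscale_cscale cscale_sum_left by (rule sum.swap)

lemma cinner_double_sum:
  "cinner (\<Sum>f\<in>F. cscale (b f) (x f)) (\<Sum>g\<in>G. cscale (c g) (y g :: 'p::chilbert))
    = (\<Sum>f\<in>F. \<Sum>g\<in>G. cnj (b f) * c g * cinner (x f) (y g))"
  unfolding cinner_sum_left unfolding cinner_sum_right cinner_cscale_left cinner_cscale_right
  by (simp add: mult_ac)

lemma cscale_cancel:
  assumes "cscale b x = cscale c x" "x \<noteq> (0::'p::chilbert)"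
  shows "b = c"
proof -
  have "cscale (b - c) x = 0" using cscale_add_left[of "b - c" c x] assms(1) by simp
  then have "cmod (b - c) * norm x = 0" using norm_cscale[of "b - c" x] by simp
  with assms(2) show ?thesis by simp
qed

lemma cinner_eq_zero_iff: "cinner x x = 0 \<longleftrightarrow> x = (0::'p::chilbert)"
  by (simp add: cinner_self_norm)

text \<open>The discriminant argument shared by all Cauchy-Schwarz inequalities below. At
  \<open>c = - s * cnj z\<close> the hypothesis becomes a real polynomial in \<open>s\<close>; its
  minimum is at \<open>s = 1 / q\<close>, and for \<open>q = 0\<close> it is affine in
  \<open>s\<close>, so its slope must vanish.\<close>

lemma nonneg_quadratic_bound:
  fixes p q :: real and z :: complex
  assumes "\<And>c::complex. 0 \<le> p + 2 * Re (c * z) + (cmod c)\<^sup>2 * q" and q: "0 \<le> q"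
  shows "(cmod z)\<^sup>2 \<le> p * q"
proof -
  have key: "0 \<le> p - 2 * s * (cmod z)\<^sup>2 + s\<^sup>2 * (cmod z)\<^sup>2 * q" for s :: real
  proof -
    have zz: "cnj z * z = complex_of_real ((cmod z)\<^sup>2)"
      using complex_norm_square[of z] by (simp add: mult.commute)
    have "Re ((- complex_of_real s * cnj z) * z) = - s * (cmod z)\<^sup>2"
      unfolding mult.assoc zz by simp
    moreover have "(cmod (- complex_of_real s * cnj z))\<^sup>2 = s\<^sup>2 * (cmod z)\<^sup>2"
      by (simp add: norm_mult power_mult_distrib)
    ultimately have "0 \<le> p + 2 * (- s * (cmod z)\<^sup>2) + s\<^sup>2 * (cmod z)\<^sup>2 * q"
      using assms(1)[of "- complex_of_real s * cnj z"] by metis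
    then show ?thesis by (simp add: algebra_simps)
  qed
  show ?thesis
  proof (cases "q = 0")
    case True
    have "(cmod z)\<^sup>2 = 0"
    proof (rule ccontr)
      assume "(cmod z)\<^sup>2 \<noteq> 0"
      \<comment> \<open>With \<open>q = 0\<close> this value of \<open>s\<close> turns the
        right-hand side of \<open>key\<close> into -1.\<close>
      with key[of "(p + 1) / (2 * (cmod z)\<^sup>2)"] key[of 0] True show False by (simp add: field_simps)
    qed
    with True show ?thesis by simp
  next
    case False
    with q have "0 < q" by simp
    with key[of "1 / q"] show ?thesis by (simp add: field_simps power2_eq_square)
  qed
qed

lemma cinner_Cauchy_Schwarz: "cmod (cinner x y) \<le> norm x * norm (y::'p::chilbert)"
proof -
  have "(cmod (cinner x y))\<^sup>2 \<le> (norm x)\<^sup>2 * (norm y)\<^sup>2"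
  proof (rule nonneg_quadratic_bound)
    fix c
    have "Re (cinner (x + cscale c y) (x + cscale c y)) = (norm (x + cscale c y))\<^sup>2"
      by (simp add: cinner_self_norm)
    moreover have "cinner (x + cscale c y) (x + cscale c y)
      = cinner x x + c * cinner x y + cnj (c * cinner x y) + cnj c * c * cinner y y"
      using cinner_cnj[of y x]
      by (simp add: cinner_add_left cinner_add_right cinner_cscale_left cinner_cscale_right algebra_simps)
    moreover have "cnj c * c = complex_of_real ((cmod c)\<^sup>2)"
      using complex_norm_square[of c] by (simp add: mult.commute)
    ultimately have "(norm (x + cscale c y))\<^sup>2 = Re (complex_of_real ((norm x)\<^sup>2) + c * cinner x y
        + cnj (c * cinner x y) + complex_of_real ((cmod c)\<^sup>2) * complex_of_real ((norm y)\<^sup>2))"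
      by (simp only: cinner_self_norm)
    also have "\<dots> = (norm x)\<^sup>2 + 2 * Re (c * cinner x y) + (cmod c)\<^sup>2 * (norm y)\<^sup>2"
      by (simp del: of_real_power)
    finally show "0 \<le> (norm x)\<^sup>2 + 2 * Re (c * cinner x y) + (cmod c)\<^sup>2 * (norm y)\<^sup>2"
      using zero_le_power2[of "norm (x + cscale c y)"] by linarith
  qed simp
  then have "(cmod (cinner x y))\<^sup>2 \<le> (norm x * norm y)\<^sup>2" by (simp add: power_mult_distrib)
  then show ?thesis by (rule power2_le_imp_le) simp
qed

lemma cspan_superset: "S \<subseteq> cspan S"
proof
  fix x :: 'a assume "x \<in> S"
  then show "x \<in> cspan S"
    unfolding cspan_def by (intro CollectI exI[of _ "{x}"] exI[of _ "\<lambda>_. 1"]) (simp add: cscale_one)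
qed

lemma cspan_zero: "0 \<in> cspan S"
  unfolding cspan_def by (auto intro!: exI[of _ "{}"])

lemma cspan_cscale: "x \<in> cspan S \<Longrightarrow> cscale c x \<in> cspan S"
proof -
  assume "x \<in> cspan S"
  then obtain F b where "finite F" "F \<subseteq> S" "x = (\<Sum>s\<in>F. cscale (b s) s)" unfolding cspan_def by blast
  then show ?thesis
    unfolding cspan_def by (intro CollectI exI[of _ F] exI[of _ "\<lambda>s. c * b s"])
      (simp add: cscale_sum_right cscale_cscale)
qed

lemma cspan_add: "x \<in> cspan S \<Longrightarrow> y \<in> cspan S \<Longrightarrow> x + y \<in> cspan S"
proof -
  assume "x \<in> cspan S" "y \<in> cspan S"
  then obtain F b G c where F: "finite F" "F \<subseteq> S" "x = (\<Sum>s\<in>F. cscale (b s) s)"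
    and G: "finite G" "G \<subseteq> S" "y = (\<Sum>s\<in>G. cscale (c s) s)" unfolding cspan_def by blast
  define f where "f s = (if s \<in> F then b s else 0) + (if s \<in> G then c s else 0)" for s
  have "x = (\<Sum>s\<in>F \<union> G. cscale (if s \<in> F then b s else 0) s)"
    unfolding F(3) using F(1) G(1) by (intro sum.mono_neutral_cong_left) auto
  moreover have "y = (\<Sum>s\<in>F \<union> G. cscale (if s \<in> G then c s else 0) s)"
    unfolding G(3) using F(1) G(1) by (intro sum.mono_neutral_cong_left) auto
  ultimately have "x + y = (\<Sum>s\<in>F \<union> G. cscale (f s) s)"
    unfolding f_def cscale_add_left sum.distrib by simp
  then show ?thesis
    unfolding cspan_def using F G by (intro CollectI exI[of _ "F \<union> G"] exI[of _ f]) auto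
qed

lemma cspan_sum: "(\<And>i. i \<in> F \<Longrightarrow> f i \<in> cspan S) \<Longrightarrow> (\<Sum>i\<in>F. f i) \<in> cspan S"
  by (induction F rule: infinite_finite_induct) (auto simp: cspan_zero cspan_add)

text \<open>\<open>cspan\<close> attaches coefficients to the vectors of a set, and \<open>v\<close>
  may repeat a vector. Coefficients attached to indices are recovered by writing each vector of the
  image as a trivial combination of the family and composing.\<close>

lemma cspan_image_lessThan:
  assumes "x \<in> cspan (v ` {..<n::nat})"
  obtains c where "x = (\<Sum>j<n. cscale (c j) (v j))"
proof -
  have "v ` {..<n} \<subseteq> {x. \<exists>c. x = (\<Sum>j<n. cscale (c j) (v j))}"
  proof
    fix y assume "y \<in> v ` {..<n}"
    then obtain k where k: "k < n" "y = v k" by auto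
    have "v k = (\<Sum>j<n. cscale (if j = k then 1 else 0) (v j))"
      using k by (simp add: if_distrib[of "\<lambda>c. cscale c _"] sum.delta cscale_one cong: if_cong)
    with k show "y \<in> {x. \<exists>c. x = (\<Sum>j<n. cscale (c j) (v j))}"
      by (auto intro!: exI[of _ "\<lambda>j. if j = k then 1 else 0"])
  qed
  moreover obtain F b where F: "finite F" "F \<subseteq> v ` {..<n}" "x = (\<Sum>s\<in>F. cscale (b s) s)"
    using assms unfolding cspan_def by blast
  ultimately have "\<forall>s\<in>F. \<exists>c. s = (\<Sum>j<n. cscale (c j) (v j))" by blast
  then obtain c where c: "\<And>s. s \<in> F \<Longrightarrow> s = (\<Sum>j<n. cscale (c s j) (v j))" by metis
  have "x = (\<Sum>s\<in>F. cscale (b s) (\<Sum>j<n. cscale (c s j) (v j)))"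
    unfolding F(3) by (intro sum.cong arg_cong[of _ _ "cscale _"] c) auto
  also have "\<dots> = (\<Sum>j<n. cscale (\<Sum>s\<in>F. b s * c s j) (v j))"
    unfolding cscale_sum_right cscale_sum_left cscale_cscale by (rule sum.swap)
  finally show ?thesis by (rule that)
qed

lemma cstar_one [simp]: "cstar (1::'a::cstar_algebra) = 1"
  by (metis cstar_cstar cstar_mult mult.left_neutral mult.right_neutral)

section \<open>Vectors and matrices\<close>

lemma sum_list_concat: "sum_list (concat xss) = (\<Sum>xs\<leftarrow>xss. sum_list xs :: 'b::comm_monoid_add)"
  by (induction xss) auto

lemma sum_lessThan_add: "(\<Sum>i<m + d. f i) = (\<Sum>i<m. f i) + (\<Sum>s<d. f (m + s :: nat) :: 'b::comm_monoid_add)"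
  by (induction d) (auto simp: add.assoc)

text \<open>Row-major flattening of a double index. It serves both for amplifications and for
  \<open>tensor_id\<close>, whose entries are addressed through \<open>div\<close> and
  \<open>mod\<close>.\<close>

lemma sum_div_mod:
  fixes n d :: nat
  shows "(\<Sum>i<n * d. f (i div d) (i mod d)) = (\<Sum>r<n. \<Sum>s<d. f r s :: 'b::comm_monoid_add)"
proof (induction n)
  case (Suc n)
  have "(\<Sum>i<Suc n * d. f (i div d) (i mod d)) = (\<Sum>i<n * d + d. f (i div d) (i mod d))"
    by (simp add: add.commute)
  also have "\<dots> = (\<Sum>i<n * d. f (i div d) (i mod d)) + (\<Sum>s<d. f ((n * d + s) div d) ((n * d + s) mod d))"
    by (rule sum_lessThan_add)
  also have "(\<Sum>s<d. f ((n * d + s) div d) ((n * d + s) mod d)) = (\<Sum>s<d. f n s)"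
    by (intro sum.cong) auto
  finally show ?case using Suc by simp
qed simp

lemma vinner_add_right: "dim_vec k = dim_vec l \<Longrightarrow> vinner h (k + l) = vinner h k + vinner h l"
  unfolding vinner_def by (simp add: algebra_simps sum.distrib)

lemma vinner_add_left: "dim_vec h = dim_vec k \<Longrightarrow> dim_vec l = dim_vec k \<Longrightarrow>
    vinner (h + k) l = vinner h l + vinner k l"
  unfolding vinner_def by (simp add: algebra_simps sum.distrib)

lemma vinner_smult_right: "vinner h (c \<cdot>\<^sub>v k) = c * vinner h k"
  unfolding vinner_def by (simp add: sum_distrib_left algebra_simps)

lemma vinner_smult_left: "dim_vec h = dim_vec k \<Longrightarrow> vinner (c \<cdot>\<^sub>v h) k = cnj c * vinner h k"
  unfolding vinner_def by (simp add: sum_distrib_left algebra_simps)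

lemma vinner_cnj: "dim_vec h = dim_vec k \<Longrightarrow> vinner h k = cnj (vinner k h)"
  unfolding vinner_def by (simp add: mult.commute)

lemma vinner_mult_mat_vec:
  assumes "M \<in> carrier_mat n p" "k \<in> carrier_vec p"
  shows "vinner h (M *\<^sub>v k) = (\<Sum>i<n. \<Sum>j<p. cnj (h $ i) * M $$ (i, j) * k $ j)"
  using assms unfolding vinner_def
  by (auto simp: scalar_prod_def sum_distrib_left mult.assoc atLeast0LessThan intro!: sum.cong)

lemma madj_carrier [simp]: "M \<in> carrier_mat n p \<Longrightarrow> madj M \<in> carrier_mat p n"
  unfolding madj_def by auto

lemma vinner_madj:
  assumes "M \<in> carrier_mat n p" "h \<in> carrier_vec p" "k \<in> carrier_vec n"
  shows "vinner h (madj M *\<^sub>v k) = vinner (M *\<^sub>v h) k"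
proof -
  have "vinner h (madj M *\<^sub>v k) = (\<Sum>i<p. \<Sum>j<n. cnj (h $ i) * cnj (M $$ (j, i)) * k $ j)"
    using assms by (subst vinner_mult_mat_vec[of _ p n]) (auto simp: madj_def intro!: sum.cong)
  also have "\<dots> = (\<Sum>j<n. \<Sum>i<p. cnj (h $ i) * cnj (M $$ (j, i)) * k $ j)" by (rule sum.swap)
  also have "\<dots> = vinner (M *\<^sub>v h) k"
    using assms unfolding vinner_def
    by (auto simp: scalar_prod_def sum_distrib_right sum_distrib_left mult_ac atLeast0LessThan intro!: sum.cong)
  finally show ?thesis .
qed

lemma vinner_mult_left:
  assumes "M \<in> carrier_mat n p" "h \<in> carrier_vec p" "k \<in> carrier_vec n"
  shows "vinner (M *\<^sub>v h) k = cnj (vinner k (M *\<^sub>v h))"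
  using assms by (intro vinner_cnj) auto

lemma vinner_unit:
  assumes "k \<in> carrier_vec n" "i < n"
  shows "vinner (unit_vec n i) k = k $ i"
  using assms unfolding vinner_def
  by (simp add: unit_vec_def if_distrib[of cnj] if_distrib[of "\<lambda>x. x * _"] sum.delta cong: if_cong)

lemma vec_eq_vinnerI:
  assumes "h \<in> carrier_vec n" "k \<in> carrier_vec n" "\<And>w. w \<in> carrier_vec n \<Longrightarrow> vinner w h = vinner w k"
  shows "h = k"
proof (rule eq_vecI)
  fix i assume "i < dim_vec k"
  then show "h $ i = k $ i"
    using assms(1,2) assms(3)[of "unit_vec n i"] vinner_unit[of h n i] vinner_unit[of k n i] by simp
qed (use assms in simp)

lemma mat_eq_vinnerI:
  assumes "A \<in> carrier_mat n n" "B \<in> carrier_mat n n"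
    and "\<And>h k. h \<in> carrier_vec n \<Longrightarrow> k \<in> carrier_vec n \<Longrightarrow> vinner h (A *\<^sub>v k) = vinner h (B *\<^sub>v k)"
  shows "A = B"
proof (rule eq_matI)
  fix i j assume ij: "i < dim_row B" "j < dim_col B"
  have "C $$ (i, j) = vinner (unit_vec n i) (C *\<^sub>v unit_vec n j)" if "C \<in> carrier_mat n n" for C
    using that ij assms by (subst vinner_unit) auto
  with assms show "A $$ (i, j) = B $$ (i, j)" by simp
qed (use assms in auto)

lemma vinner_self: "Im (vinner h h) = 0" "Re (vinner h h) = (\<Sum>i<dim_vec h. (cmod (h $ i))\<^sup>2)"
proof -
  have "vinner h h = complex_of_real (\<Sum>i<dim_vec h. (cmod (h $ i))\<^sup>2)"
    unfolding vinner_def by (simp add: complex_norm_square mult.commute del: of_real_power)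
  then show "Im (vinner h h) = 0" "Re (vinner h h) = (\<Sum>i<dim_vec h. (cmod (h $ i))\<^sup>2)" by simp_all
qed

lemma vinner_self_eq_zero: "vinner h h = 0 \<Longrightarrow> h \<in> carrier_vec n \<Longrightarrow> h = 0\<^sub>v n"
proof -
  assume h: "vinner h h = 0" "h \<in> carrier_vec n"
  then have "(\<Sum>i<n. (cmod (h $ i))\<^sup>2) = 0" using vinner_self(2)[of h] by auto
  then have "\<forall>i<n. h $ i = 0" by (subst (asm) sum_nonneg_eq_0_iff) auto
  with h show ?thesis by (intro eq_vecI) auto
qed

lemma msum_carrier [simp]: "msum n f S \<in> carrier_mat n n"
  unfolding msum_def by simp

lemma vinner_msum:
  assumes "\<And>i. i \<in> S \<Longrightarrow> f i \<in> carrier_mat n n" "h \<in> carrier_vec n" "k \<in> carrier_vec n"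
  shows "vinner h (msum n f S *\<^sub>v k) = (\<Sum>i\<in>S. vinner h (f i *\<^sub>v k))"
proof -
  have "vinner h (msum n f S *\<^sub>v k) = (\<Sum>r<n. \<Sum>c<n. \<Sum>i\<in>S. cnj (h $ r) * f i $$ (r, c) * k $ c)"
    using assms by (subst vinner_mult_mat_vec[of _ n n])
      (auto simp: msum_def sum_distrib_left sum_distrib_right intro!: sum.cong)
  also have "\<dots> = (\<Sum>r<n. \<Sum>i\<in>S. \<Sum>c<n. cnj (h $ r) * f i $$ (r, c) * k $ c)"
    by (intro sum.cong refl sum.swap)
  also have "\<dots> = (\<Sum>i\<in>S. \<Sum>r<n. \<Sum>c<n. cnj (h $ r) * f i $$ (r, c) * k $ c)"
    by (rule sum.swap)
  also have "\<dots> = (\<Sum>i\<in>S. vinner h (f i *\<^sub>v k))"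
    using assms by (intro sum.cong refl, subst vinner_mult_mat_vec[of _ n n]) auto
  finally show ?thesis .
qed

lemma madj_madj [simp]: "madj (madj M) = M"
  unfolding madj_def by (intro eq_matI) auto

lemma vinner_Cauchy_Schwarz:
  assumes "h \<in> carrier_vec n" "k \<in> carrier_vec n"
  shows "(cmod (vinner h k))\<^sup>2 \<le> Re (vinner h h) * Re (vinner k k)"
proof (rule nonneg_quadratic_bound)
  fix c
  have "0 \<le> Re (vinner (h + c \<cdot>\<^sub>v k) (h + c \<cdot>\<^sub>v k))" unfolding vinner_self by (rule sum_nonneg) simp
  also have "vinner (h + c \<cdot>\<^sub>v k) (h + c \<cdot>\<^sub>v k)
      = vinner h h + c * vinner h k + cnj (c * vinner h k) + cnj c * c * vinner k k"
    using assms vinner_cnj[of k h]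
    by (simp add: vinner_add_left vinner_add_right vinner_smult_left vinner_smult_right algebra_simps)
  also have "cnj c * c = complex_of_real ((cmod c)\<^sup>2)"
    using complex_norm_square[of c] by (simp add: mult.commute)
  finally show "0 \<le> Re (vinner h h) + 2 * Re (c * vinner h k) + (cmod c)\<^sup>2 * Re (vinner k k)"
    by (simp del: of_real_power)
qed (simp add: vinner_self sum_nonneg)

lemma vinner_smult_mat:
  assumes "M \<in> carrier_mat n p" "k \<in> carrier_vec p"
  shows "vinner h ((c \<cdot>\<^sub>m M) *\<^sub>v k) = c * vinner h (M *\<^sub>v k)"
  using assms by (subst (1 2) vinner_mult_mat_vec[of _ n p]) (auto simp: sum_distrib_left mult_ac)

lemma vinner_minus_mat:
  assumes "A \<in> carrier_mat n p" "B \<in> carrier_mat n p" "k \<in> carrier_vec p"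
  shows "vinner h ((A - B) *\<^sub>v k) = vinner h (A *\<^sub>v k) - vinner h (B *\<^sub>v k)"
proof -
  have "A - B \<in> carrier_mat n p" using assms(2) by (rule minus_carrier_mat)
  then show ?thesis
    unfolding vinner_mult_mat_vec[OF \<open>A - B \<in> carrier_mat n p\<close> assms(3)] vinner_mult_mat_vec[OF assms(1,3)] vinner_mult_mat_vec[OF assms(2,3)]
    using assms by (simp add: sum_subtractf[symmetric] algebra_simps)
qed

lemma vinner_zero_mat: "k \<in> carrier_vec n \<Longrightarrow> vinner h (0\<^sub>m n n *\<^sub>v k) = 0"
  by (auto simp: vinner_def scalar_prod_def)

lemma mat_entry_vinner:
  assumes "C \<in> carrier_mat n n" "j < n" "k < n"
  shows "C $$ (j, k) = vinner (unit_vec n j) (C *\<^sub>v unit_vec n k)"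
  using assms by (subst vinner_unit) auto

lemma vinner_compress:
  assumes "M \<in> carrier_mat n n" "E \<in> carrier_mat n d" "h \<in> carrier_vec d" "k \<in> carrier_vec d"
  shows "vinner h ((madj E * M * E) *\<^sub>v k) = vinner (E *\<^sub>v h) (M *\<^sub>v (E *\<^sub>v k))"
proof -
  have "(madj E * M * E) *\<^sub>v k = madj E *\<^sub>v (M *\<^sub>v (E *\<^sub>v k))"
    using assms by (simp add: assoc_mult_mat_vec[of _ d n _ n] assoc_mult_mat_vec[of _ d n _ d]
        assoc_mult_mat[of _ d n _ n _ d])
  then show ?thesis using assms by (simp add: vinner_madj[of _ n d])
qed

section \<open>Completely positive maps\<close>

text \<open>Everything in \<open>cp_map\<close> except positivity, so that the associated form can
  be manipulated while positivity is still to be shown.\<close>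

definition mat_linear :: "nat \<Rightarrow> ('a::cstar_algebra \<Rightarrow> complex mat) \<Rightarrow> bool" where
  "mat_linear d \<phi> \<longleftrightarrow> (\<forall>a. \<phi> a \<in> carrier_mat d d) \<and> (\<forall>a b. \<phi> (a + b) = \<phi> a + \<phi> b)
     \<and> (\<forall>c a. \<phi> (cscale c a) = c \<cdot>\<^sub>m \<phi> a)"

text \<open>Elements of the algebraic tensor product of the algebra with \<open>\<complex>\<^sup>d\<close> are represented by lists
  of pairs; the form is the Stinespring semi-inner product of the map.\<close>
definition cp_form :: "('a::cstar_algebra \<Rightarrow> complex mat) \<Rightarrow> ('a \<times> complex vec) list
    \<Rightarrow> ('a \<times> complex vec) list \<Rightarrow> complex" where
  "cp_form \<phi> xs ys = (\<Sum>x\<leftarrow>xs. \<Sum>y\<leftarrow>ys. vinner (snd x) (\<phi> (cstar (fst x) * fst y) *\<^sub>v snd y))"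

abbreviation vec_list :: "nat \<Rightarrow> ('a \<times> complex vec) list \<Rightarrow> bool" where
  "vec_list n xs \<equiv> \<forall>x\<in>set xs. snd x \<in> carrier_vec n"

lemma cp_form_append_left: "cp_form \<phi> (xs @ zs) ys = cp_form \<phi> xs ys + cp_form \<phi> zs ys"
  by (simp add: cp_form_def)

lemma cp_form_append_right: "cp_form \<phi> xs (ys @ zs) = cp_form \<phi> xs ys + cp_form \<phi> xs zs"
  by (simp add: cp_form_def sum_list_addf)

lemma cp_form_single: "cp_form \<phi> [(a, h)] [(b, k)] = vinner h (\<phi> (cstar a * b) *\<^sub>v k)"
  by (simp add: cp_form_def)

lemma mat_linear_carrier: "mat_linear d \<phi> \<Longrightarrow> \<phi> a \<in> carrier_mat d d"
  by (simp add: mat_linear_def)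

lemma mat_linear_zero: "mat_linear d \<phi> \<Longrightarrow> \<phi> 0 = 0\<^sub>m d d"
proof -
  assume lin: "mat_linear d \<phi>"
  then have "\<phi> (cscale 0 0) = 0 \<cdot>\<^sub>m \<phi> 0" unfolding mat_linear_def by blast
  then have "\<phi> 0 = 0 \<cdot>\<^sub>m \<phi> 0" by simp
  also have "\<dots> = 0\<^sub>m d d" using mat_linear_carrier[OF lin, of 0] by (auto intro!: eq_matI)
  finally show ?thesis .
qed

lemma mat_linear_sum_index:
  assumes "mat_linear d \<phi>" "s < d" "t < d"
  shows "\<phi> (\<Sum>l\<in>F. f l) $$ (s, t) = (\<Sum>l\<in>F. \<phi> (f l) $$ (s, t))"
proof (induction F rule: infinite_finite_induct)
  case (insert x F)
  have "\<phi> (f x + sum f F) = \<phi> (f x) + \<phi> (sum f F)" using assms(1) unfolding mat_linear_def by blast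
  moreover have "(\<phi> (f x) + \<phi> (sum f F)) $$ (s, t) = \<phi> (f x) $$ (s, t) + \<phi> (sum f F) $$ (s, t)"
    using mat_linear_carrier[OF assms(1), of "sum f F"] assms(2,3) by (intro index_add_mat) auto
  ultimately show ?case using insert by simp
qed (use assms mat_linear_zero[OF assms(1)] in auto)

lemma cp_form_scale_right:
  assumes "mat_linear d \<phi>" "vec_list d ys"
  shows "cp_form \<phi> xs (map (apfst (cscale c)) ys) = c * cp_form \<phi> xs ys"
proof -
  have "vinner h (\<phi> (cstar a * cscale c b) *\<^sub>v k) = c * vinner h (\<phi> (cstar a * b) *\<^sub>v k)"
    if "k \<in> carrier_vec d" for a b h k
    using assms(1) that vinner_smult_mat[OF mat_linear_carrier[OF assms(1)] that]
    unfolding mat_linear_def by (metis cscale_mult_right)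
  then show ?thesis
    using assms(2) unfolding cp_form_def
    by (auto simp: sum_list_const_mult[symmetric] o_def intro!: arg_cong[of _ _ sum_list] map_cong)
qed

lemma cp_form_scale_left:
  assumes "mat_linear d \<phi>" "vec_list d ys"
  shows "cp_form \<phi> (map (apfst (cscale c)) xs) ys = cnj c * cp_form \<phi> xs ys"
proof -
  have "vinner h (\<phi> (cstar (cscale c a) * b) *\<^sub>v k) = cnj c * vinner h (\<phi> (cstar a * b) *\<^sub>v k)"
    if "k \<in> carrier_vec d" for a b h k
    using assms(1) that vinner_smult_mat[OF mat_linear_carrier[OF assms(1)] that]
    unfolding mat_linear_def by (metis cscale_mult_left cstar_cscale)
  then show ?thesis
    using assms(2) unfolding cp_form_def
    by (auto simp: sum_list_const_mult[symmetric] o_def intro!: arg_cong[of _ _ sum_list] map_cong)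
qed

text \<open>The positive element in the amplification is a sum over the rows \<open>l\<close> of the
  matrix \<open>B\<close>. Cutting \<open>v\<close> into \<open>n\<close> blocks of length
  \<open>d\<close> and pairing block \<open>r\<close> with \<open>B l r\<close> makes each row one
  list, so the quadratic form is a sum of values of \<open>cp_form\<close>.\<close>

lemma vinner_amplify_pos:
  fixes B :: "nat \<Rightarrow> nat \<Rightarrow> 'a::cstar_algebra"
  assumes lin: "mat_linear d \<phi>" and v: "v \<in> carrier_vec (n * d)"
  defines "L \<equiv> \<lambda>l. map (\<lambda>r. (B l r, vec d (\<lambda>s. v $ (r * d + s)))) [0..<n]"
  shows "vinner v (amplify_pos d \<phi> n B *\<^sub>v v) = (\<Sum>l<n. cp_form \<phi> (L l) (L l))"
proof -
  define G where "G r s c t l = cnj (v $ (r * d + s)) * \<phi> (cstar (B l r) * B l c) $$ (s, t) * v $ (c * d + t)"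
    for r s c t l
  have "vinner v (amplify_pos d \<phi> n B *\<^sub>v v)
     = (\<Sum>i<n * d. \<Sum>j<n * d. \<Sum>l<n. G (i div d) (i mod d) (j div d) (j mod d) l)"
  proof -
    have "amplify_pos d \<phi> n B $$ (i, j)
        = (\<Sum>l<n. \<phi> (cstar (B l (i div d)) * B l (j div d)) $$ (i mod d, j mod d))"
      if "i < n * d" "j < n * d" for i j
    proof -
      from that have "0 < d" by (cases d) auto
      then show ?thesis unfolding amplify_pos_def using that by (simp add: mat_linear_sum_index[OF lin])
    qed
    moreover have "amplify_pos d \<phi> n B \<in> carrier_mat (n * d) (n * d)" unfolding amplify_pos_def by simp
    ultimately show ?thesis
      using v unfolding G_def
      by (subst vinner_mult_mat_vec) (auto simp: sum_distrib_left sum_distrib_right intro!: sum.cong)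
  qed
  also have "\<dots> = (\<Sum>i<n * d. \<Sum>c<n. \<Sum>t<d. \<Sum>l<n. G (i div d) (i mod d) c t l)"
    by (intro sum.cong refl sum_div_mod)
  also have "\<dots> = (\<Sum>r<n. \<Sum>s<d. \<Sum>c<n. \<Sum>t<d. \<Sum>l<n. G r s c t l)"
    by (rule sum_div_mod)
  also have "\<dots> = (\<Sum>l<n. \<Sum>r<n. \<Sum>c<n. \<Sum>s<d. \<Sum>t<d. G r s c t l)"
  proof -
    have "(\<Sum>s<d. \<Sum>c<n. \<Sum>t<d. \<Sum>l<n. G r s c t l) = (\<Sum>l<n. \<Sum>c<n. \<Sum>s<d. \<Sum>t<d. G r s c t l)" for r
    proof -
      have "(\<Sum>s<d. \<Sum>c<n. \<Sum>t<d. \<Sum>l<n. G r s c t l) = (\<Sum>s<d. \<Sum>c<n. \<Sum>l<n. \<Sum>t<d. G r s c t l)"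
        by (rule sum.cong[OF refl], rule sum.cong[OF refl], rule sum.swap)
      also have "\<dots> = (\<Sum>s<d. \<Sum>l<n. \<Sum>c<n. \<Sum>t<d. G r s c t l)"
        by (rule sum.cong[OF refl], rule sum.swap)
      also have "\<dots> = (\<Sum>l<n. \<Sum>s<d. \<Sum>c<n. \<Sum>t<d. G r s c t l)" by (rule sum.swap)
      also have "\<dots> = (\<Sum>l<n. \<Sum>c<n. \<Sum>s<d. \<Sum>t<d. G r s c t l)"
        by (rule sum.cong[OF refl], rule sum.swap)
      finally show ?thesis .
    qed
    then have "(\<Sum>r<n. \<Sum>s<d. \<Sum>c<n. \<Sum>t<d. \<Sum>l<n. G r s c t l) = (\<Sum>r<n. \<Sum>l<n. \<Sum>c<n. \<Sum>s<d. \<Sum>t<d. G r s c t l)"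
      by (simp only:)
    also have "\<dots> = (\<Sum>l<n. \<Sum>r<n. \<Sum>c<n. \<Sum>s<d. \<Sum>t<d. G r s c t l)" by (rule sum.swap)
    finally show ?thesis .
  qed
  also have "\<dots> = (\<Sum>l<n. cp_form \<phi> (L l) (L l))"
  proof (rule sum.cong[OF refl])
    fix l
    have "(\<Sum>s<d. \<Sum>t<d. G r s c t l) = vinner (vec d (\<lambda>s. v $ (r * d + s)))
        (\<phi> (cstar (B l r) * B l c) *\<^sub>v vec d (\<lambda>s. v $ (c * d + s)))" for r c
      unfolding G_def by (subst vinner_mult_mat_vec[OF mat_linear_carrier[OF lin]]) auto
    then show "(\<Sum>r<n. \<Sum>c<n. \<Sum>s<d. \<Sum>t<d. G r s c t l) = cp_form \<phi> (L l) (L l)"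
      unfolding cp_form_def L_def
      by (simp add: o_def interv_sum_list_conv_sum_set_nat atLeast0LessThan)
  qed
  finally show ?thesis .
qed

lemma cp_map_linear: "cp_map d \<phi> \<Longrightarrow> mat_linear d \<phi>"
  by (simp add: cp_map_def mat_linear_def)

text \<open>A list becomes the row 0 of a matrix \<open>B\<close> whose other rows vanish, and its
  vectors are concatenated to \<open>v\<close>. Only \<open>l = 0\<close> then contributes to the
  amplified form.\<close>

lemma cp_form_nonneg:
  assumes cp: "cp_map d \<phi>" and xs: "vec_list d xs"
  shows "Im (cp_form \<phi> xs xs) = 0" "0 \<le> Re (cp_form \<phi> xs xs)"
proof -
  have "Im (cp_form \<phi> xs xs) = 0 \<and> 0 \<le> Re (cp_form \<phi> xs xs)"
  proof (cases "xs = []")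
    case False
    define n where "n = length xs"
    define B where "B l r = (if l = (0::nat) then fst (xs ! r) else 0)" for l r
    define v where "v = vec (n * d) (\<lambda>i. snd (xs ! (i div d)) $ (i mod d))"
    define L where "L l = map (\<lambda>r. (B l r, vec d (\<lambda>s. v $ (r * d + s)))) [0..<n]" for l
    have L0: "L 0 = xs"
    proof (rule nth_equalityI)
      fix r assume "r < length (L 0)"
      then have r: "r < n" by (simp add: L_def)
      have "vec d (\<lambda>s. v $ (r * d + s)) = snd (xs ! r)"
      proof (rule eq_vecI)
        fix s assume "s < dim_vec (snd (xs ! r))"
        then have s: "s < d" using xs r unfolding n_def by (metis carrier_vecD nth_mem)
        have "r * d + s < n * d"
          using r s mult_le_mono1[of "Suc r" n d] by simp
        with s show "vec d (\<lambda>s. v $ (r * d + s)) $ s = snd (xs ! r) $ s" by (simp add: v_def)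
      qed (use xs r n_def in \<open>metis carrier_vecD dim_vec nth_mem\<close>)
      with r show "L 0 ! r = xs ! r" by (simp add: L_def B_def)
    qed (simp add: L_def n_def)
    have L: "cp_form \<phi> (L l) (L l) = 0" if "l \<noteq> 0" for l
      using that mat_linear_zero[OF cp_map_linear[OF cp]]
      unfolding L_def cp_form_def B_def by (auto simp: o_def vinner_def intro!: sum_list_0)
    have "psd_mat (n * d) (amplify_pos d \<phi> n B)" using cp unfolding cp_map_def by blast
    moreover have "v \<in> carrier_vec (n * d)" by (simp add: v_def)
    moreover have "vinner v (amplify_pos d \<phi> n B *\<^sub>v v) = (\<Sum>l<n. cp_form \<phi> (L l) (L l))"
      unfolding L_def by (rule vinner_amplify_pos[OF cp_map_linear[OF cp]]) (simp add: v_def)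
    moreover have "(\<Sum>l<n. cp_form \<phi> (L l) (L l)) = (\<Sum>l<n. if l = 0 then cp_form \<phi> xs xs else 0)"
      using L L0 by (intro sum.cong) auto
    moreover have "\<dots> = cp_form \<phi> xs xs" using False by (simp add: n_def)
    ultimately show ?thesis unfolding psd_mat_def by (metis (no_types, lifting))
  qed (simp add: cp_form_def)
  then show "Im (cp_form \<phi> xs xs) = 0" "0 \<le> Re (cp_form \<phi> xs xs)" by auto
qed

text \<open>By \<open>vinner_amplify_pos\<close> every amplified form is a sum of values of
  \<open>cp_form\<close>. With \<open>cp_form_nonneg\<close> this replaces complete positivity by
  positivity on lists, and block matrices disappear from the later arguments.\<close>

lemma cp_mapI:
  assumes lin: "mat_linear d \<phi>"
    and pos: "\<And>xs. vec_list d xs \<Longrightarrow> Im (cp_form \<phi> xs xs) = 0 \<and> 0 \<le> Re (cp_form \<phi> xs xs)"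
  shows "cp_map d \<phi>"
proof -
  have "psd_mat (n * d) (amplify_pos d \<phi> n B)" for n B
    unfolding psd_mat_def
  proof (intro conjI ballI)
    fix v :: "complex vec" assume v: "v \<in> carrier_vec (n * d)"
    show "Im (vinner v (amplify_pos d \<phi> n B *\<^sub>v v)) = 0"
      unfolding vinner_amplify_pos[OF lin v] Im_sum by (intro sum.neutral ballI pos[THEN conjunct1]) auto
    show "0 \<le> Re (vinner v (amplify_pos d \<phi> n B *\<^sub>v v))"
      unfolding vinner_amplify_pos[OF lin v] Re_sum by (intro sum_nonneg pos[THEN conjunct2]) auto
  qed (simp add: amplify_pos_def)
  with lin show ?thesis unfolding cp_map_def mat_linear_def by blast
qed

text \<open>Compatibility with adjoints is a consequence of positivity: the form on
  \<open>xs + c * ys\<close> is real for every \<open>c\<close>, and \<open>c = 1\<close> and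
  \<open>c = \<i>\<close> separate the real and imaginary parts.\<close>

lemma cp_form_cnj:
  assumes cp: "cp_map d \<phi>" and xs: "vec_list d xs" and ys: "vec_list d ys"
  shows "cp_form \<phi> ys xs = cnj (cp_form \<phi> xs ys)"
proof -
  note lin = cp_map_linear[OF cp]
  have "Im (c * cp_form \<phi> xs ys + cnj c * cp_form \<phi> ys xs) = 0" for c
  proof -
    let ?y = "map (apfst (cscale c)) ys"
    have ys': "vec_list d ?y" using ys by auto
    have "Im (cp_form \<phi> (xs @ ?y) (xs @ ?y)) = 0" using xs ys' by (intro cp_form_nonneg[OF cp]) auto
    moreover have "Im (cp_form \<phi> ?y ?y) = 0" "Im (cp_form \<phi> xs xs) = 0"
      by (rule cp_form_nonneg[OF cp ys'], rule cp_form_nonneg[OF cp xs])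
    moreover have "cp_form \<phi> xs ?y = c * cp_form \<phi> xs ys" by (rule cp_form_scale_right[OF lin ys])
    moreover have "cp_form \<phi> ?y xs = cnj c * cp_form \<phi> ys xs" by (rule cp_form_scale_left[OF lin xs])
    ultimately show ?thesis by (simp add: cp_form_append_left cp_form_append_right)
  qed
  from this[of 1] this[of \<i>] show ?thesis by (auto simp: complex_eq_iff)
qed

lemma cp_form_Cauchy_Schwarz:
  assumes cp: "cp_map d \<phi>" and xs: "vec_list d xs" and ys: "vec_list d ys"
  shows "(cmod (cp_form \<phi> xs ys))\<^sup>2 \<le> Re (cp_form \<phi> xs xs) * Re (cp_form \<phi> ys ys)"
proof (rule nonneg_quadratic_bound)
  fix c
  note lin = cp_map_linear[OF cp]
  let ?y = "map (apfst (cscale c)) ys"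
  have ys': "vec_list d ?y" using ys by auto
  have "0 \<le> Re (cp_form \<phi> (xs @ ?y) (xs @ ?y))" using xs ys' by (intro cp_form_nonneg[OF cp]) auto
  also have "cp_form \<phi> (xs @ ?y) (xs @ ?y) = cp_form \<phi> xs xs + c * cp_form \<phi> xs ys
      + cnj (c * cp_form \<phi> xs ys) + (cnj c * c) * cp_form \<phi> ys ys"
    by (simp add: cp_form_append_left cp_form_append_right cp_form_scale_right[OF lin ys]
        cp_form_scale_left[OF lin xs] cp_form_scale_left[OF lin ys] cp_form_cnj[OF cp xs ys])
  also have "cnj c * c = complex_of_real ((cmod c)\<^sup>2)"
    using complex_norm_square[of c] by (simp add: mult.commute)
  finally show "0 \<le> Re (cp_form \<phi> xs xs) + 2 * Re (c * cp_form \<phi> xs ys) + (cmod c)\<^sup>2 * Re (cp_form \<phi> ys ys)"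
    by (simp del: of_real_power)
qed (rule cp_form_nonneg[OF cp ys])

lemma cp_form_compress:
  assumes "mat_linear n \<phi>" "E \<in> carrier_mat n d" "vec_list d xs" "vec_list d ys"
  shows "cp_form (\<lambda>a. madj E * \<phi> a * E) xs ys = cp_form \<phi> (map (apsnd ((*\<^sub>v) E)) xs) (map (apsnd ((*\<^sub>v) E)) ys)"
proof -
  have "vinner (snd x) ((madj E * \<phi> (cstar (fst x) * fst y) * E) *\<^sub>v snd y)
      = vinner (E *\<^sub>v snd x) (\<phi> (cstar (fst x) * fst y) *\<^sub>v (E *\<^sub>v snd y))"
    if "x \<in> set xs" "y \<in> set ys" for x y
    using that assms(3,4) by (intro vinner_compress[OF mat_linear_carrier[OF assms(1)] assms(2)]) auto
  then show ?thesis
    unfolding cp_form_def by (simp add: o_def cong: map_cong)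
qed

lemma mat_linear_compress:
  assumes "mat_linear n \<phi>" "E \<in> carrier_mat n d"
  shows "mat_linear d (\<lambda>a. madj E * \<phi> a * E)"
proof -
  note c = mat_linear_carrier[OF assms(1)] madj_carrier[OF assms(2)] assms(2)
  have "madj E * (\<phi> a + \<phi> b) * E = madj E * \<phi> a * E + madj E * \<phi> b * E" for a b
    using c(1)[of a] c(1)[of b] c(2,3) 
    by (simp add: mult_add_distrib_mat[OF c(2) c(1) c(1)]
        add_mult_distrib_mat[OF mult_carrier_mat[OF c(2) c(1)] mult_carrier_mat[OF c(2) c(1)] c(3)])
  moreover have "madj E * (x \<cdot>\<^sub>m \<phi> a) * E = x \<cdot>\<^sub>m (madj E * \<phi> a * E)" for x a
    by (simp add: mult_smult_distrib[OF c(2) c(1)] mult_smult_assoc_mat[OF mult_carrier_mat[OF c(2) c(1)] c(3)])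
  moreover have "madj E * \<phi> a * E \<in> carrier_mat d d" for a
    by (rule mult_carrier_mat[OF mult_carrier_mat[OF c(2) c(1)] c(3)])
  ultimately show ?thesis using assms(1) unfolding mat_linear_def by auto
qed

lemma cp_map_compress:
  assumes cp: "cp_map n \<phi>" and E: "E \<in> carrier_mat n d"
  shows "cp_map d (\<lambda>a. madj E * \<phi> a * E)"
proof (rule cp_mapI)
  fix xs :: "('a \<times> complex vec) list" assume xs: "vec_list d xs"
  then have "\<forall>x\<in>set (map (apsnd ((*\<^sub>v) E)) xs). snd x \<in> carrier_vec n" using E by auto
  with cp_form_nonneg[OF cp this] cp_form_compress[OF cp_map_linear[OF cp] E xs xs]
  show "Im (cp_form (\<lambda>a. madj E * \<phi> a * E) xs xs) = 0 \<and> 0 \<le> Re (cp_form (\<lambda>a. madj E * \<phi> a * E) xs xs)" by simp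
qed (rule mat_linear_compress[OF cp_map_linear[OF cp] E])

text \<open>Translates an inequality between forms into the complete positivity of a difference,
  which is the order in which purity is formulated.\<close>

lemma cp_map_diffI:
  assumes cp1: "cp_map d \<phi>" and cp2: "cp_map d \<theta>"
    and le: "\<And>xs. vec_list d xs \<Longrightarrow> Re (cp_form \<theta> xs xs) \<le> Re (cp_form \<phi> xs xs)"
  shows "cp_map d (\<lambda>a. \<phi> a - \<theta> a)"
proof (rule cp_mapI)
  note l1 = cp_map_linear[OF cp1] and l2 = cp_map_linear[OF cp2]
  note c1 = mat_linear_carrier[OF l1] and c2 = mat_linear_carrier[OF l2]
  have "\<phi> a + \<phi> b - (\<theta> a + \<theta> b) = (\<phi> a - \<theta> a) + (\<phi> b - \<theta> b)" for a b
    using c1[of a] c1[of b] c2[of a] c2[of b] by (intro eq_matI) auto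
  moreover have "x \<cdot>\<^sub>m \<phi> a - x \<cdot>\<^sub>m \<theta> a = x \<cdot>\<^sub>m (\<phi> a - \<theta> a)" for x a
    using c1[of a] c2[of a] by (intro eq_matI) (auto simp: algebra_simps)
  ultimately show "mat_linear d (\<lambda>a. \<phi> a - \<theta> a)"
    using l1 l2 unfolding mat_linear_def by (auto intro: minus_carrier_mat)
  fix xs :: "('a \<times> complex vec) list" assume xs: "vec_list d xs"
  have "cp_form (\<lambda>a. \<phi> a - \<theta> a) xs xs = cp_form \<phi> xs xs - cp_form \<theta> xs xs"
    using xs unfolding cp_form_def
    by (simp add: vinner_minus_mat[OF c1 c2] sum_list_subtractf[symmetric] cong: map_cong)
  with cp_form_nonneg[OF cp1 xs] cp_form_nonneg[OF cp2 xs] le[OF xs]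
  show "Im (cp_form (\<lambda>a. \<phi> a - \<theta> a) xs xs) = 0 \<and> 0 \<le> Re (cp_form (\<lambda>a. \<phi> a - \<theta> a) xs xs)" by simp
qed

section \<open>Positive semidefinite scalar matrices\<close>

text \<open>Labels come from an arbitrary set: their type changes when the projections are
  diagonalized, and they are ordered by the nest instead of by a numbering.\<close>

definition psd_form :: "'l set \<Rightarrow> ('l \<Rightarrow> 'l \<Rightarrow> complex) \<Rightarrow> bool" where
  "psd_form Z D \<longleftrightarrow> (\<forall>x. Im (\<Sum>e\<in>Z. \<Sum>f\<in>Z. cnj (x e) * x f * D e f) = 0
      \<and> 0 \<le> Re (\<Sum>e\<in>Z. \<Sum>f\<in>Z. cnj (x e) * x f * D e f))"

lemma double_sum_two:
  fixes F :: "'l \<Rightarrow> 'l \<Rightarrow> complex"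
  assumes "finite Z" "e \<in> Z" "f \<in> Z" "e \<noteq> f" "\<And>g. g \<in> Z \<Longrightarrow> g \<noteq> e \<Longrightarrow> g \<noteq> f \<Longrightarrow> x g = 0"
  shows "(\<Sum>g\<in>Z. \<Sum>h\<in>Z. cnj (x g) * x h * F g h)
    = cnj (x e) * x e * F e e + cnj (x e) * x f * F e f + cnj (x f) * x e * F f e + cnj (x f) * x f * F f f"
proof -
  have two: "(\<Sum>g\<in>Z. G g) = G e + G f" if "\<And>g. g \<in> Z \<Longrightarrow> g \<noteq> e \<Longrightarrow> g \<noteq> f \<Longrightarrow> G g = 0" for G :: "'l \<Rightarrow> complex"
  proof -
    have "(\<Sum>g\<in>Z. G g) = (\<Sum>g\<in>{e, f}. G g)" using assms that by (intro sum.mono_neutral_right) auto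
    then show ?thesis using assms(4) by simp
  qed
  have "(\<Sum>h\<in>Z. cnj (x g) * x h * F g h) = cnj (x g) * x e * F g e + cnj (x g) * x f * F g f" for g
    using assms(5) by (intro two) auto
  then have "(\<Sum>g\<in>Z. \<Sum>h\<in>Z. cnj (x g) * x h * F g h)
      = (\<Sum>g\<in>Z. cnj (x g) * x e * F g e + cnj (x g) * x f * F g f)" by simp
  also have "\<dots> = (cnj (x e) * x e * F e e + cnj (x e) * x f * F e f) + (cnj (x f) * x e * F f e + cnj (x f) * x f * F f f)"
    using assms(5) by (intro two) auto
  finally show ?thesis by simp
qed

lemma double_sum_one:
  fixes F :: "'l \<Rightarrow> 'l \<Rightarrow> complex"
  assumes "finite Z" "e \<in> Z"
  shows "(\<Sum>g\<in>Z. \<Sum>h\<in>Z. cnj (if g = e then c else 0) * (if h = e then c else 0) * F g h) = cnj c * c * F e e"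
  using assms by (simp add: if_distrib[of cnj] if_distrib[of "\<lambda>x. x * _"] if_distrib[of "\<lambda>x. _ * x"] sum.delta cong: if_cong)

text \<open>Complex polarization, with no symmetry assumed of \<open>F\<close>: after the diagonal
  is known to vanish, test vectors with entries 1 and \<open>c\<close> in two places, for
  \<open>c = 1\<close> and \<open>c = \<i>\<close>, separate \<open>F e f\<close> from
  \<open>F f e\<close>.\<close>

lemma polarization_zero:
  fixes F :: "'l \<Rightarrow> 'l \<Rightarrow> complex"
  assumes fin: "finite Z" and zero: "\<And>x. (\<Sum>e\<in>Z. \<Sum>f\<in>Z. cnj (x e) * x f * F e f) = 0"
    and ef: "e \<in> Z" "f \<in> Z"
  shows "F e f = 0"
proof -
  have diag: "F g g = 0" if "g \<in> Z" for g
    using zero[of "\<lambda>h. if h = g then 1 else 0"] double_sum_one[OF fin that, of 1 F] by simp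
  show ?thesis
  proof (cases "e = f")
    case False
    have "c * F e f + cnj c * F f e = 0" for c
      using zero[of "\<lambda>h. if h = e then 1 else if h = f then c else 0"] False ef diag
        double_sum_two[OF fin ef False, of "\<lambda>h. if h = e then 1 else if h = f then c else 0" F] by simp
    from this[of 1] this[of \<i>] show ?thesis by (simp add: complex_eq_iff)
  qed (use diag ef in simp)
qed

lemma psd_form_hermitian:
  assumes fin: "finite Z" and psd: "psd_form Z D" and ef: "e \<in> Z" "f \<in> Z"
  shows "D f e = cnj (D e f)"
proof -
  have diag: "Im (D g g) = 0" if "g \<in> Z" for g
    using psd[unfolded psd_form_def, rule_format, of "\<lambda>h. if h = g then 1 else 0"] double_sum_one[OF fin that, of 1 D] by simp
  show ?thesis
  proof (cases "e = f")
    case False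
    have "Im (c * D e f + cnj c * D f e) = 0" for c
    proof -
      have "Im (D e e + c * D e f + cnj c * D f e + cnj c * c * D f f) = 0"
        using psd[unfolded psd_form_def, rule_format, of "\<lambda>h. if h = e then 1 else if h = f then c else 0"] False
          double_sum_two[OF fin ef False, of "\<lambda>h. if h = e then 1 else if h = f then c else 0" D] by simp
      then show ?thesis using diag[OF ef(1)] diag[OF ef(2)] by simp
    qed
    from this[of 1] this[of \<i>] show ?thesis by (auto simp: complex_eq_iff)
  qed (use diag ef in \<open>simp add: complex_eq_iff\<close>)
qed

lemma psd_form_diag:
  assumes "finite Z" "psd_form Z D" "e \<in> Z"
  shows "0 \<le> Re (D e e)" "D e e = complex_of_real (Re (D e e))"
  using assms(2)[unfolded psd_form_def, rule_format, of "\<lambda>h. if h = e then 1 else 0"]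
    double_sum_one[OF assms(1,3), of 1 D] by (auto simp: complex_eq_iff)

text \<open>Nonnegativity of the 2 by 2 minors. Its main use is the degenerate pivot: a zero on the
  diagonal forces the whole row to vanish.\<close>

lemma psd_form_bound:
  assumes fin: "finite Z" and psd: "psd_form Z D" and ef: "e \<in> Z" "f \<in> Z"
  shows "(cmod (D e f))\<^sup>2 \<le> Re (D e e) * Re (D f f)"
proof (cases "e = f")
  case True
  then show ?thesis using psd_form_diag[OF fin psd ef(1)]
    by (metis norm_of_real order_refl power2_abs power2_eq_square)
next
  case False
  show ?thesis
  proof (rule nonneg_quadratic_bound)
    fix c
    have "0 \<le> Re (D e e + c * D e f + cnj c * D f e + cnj c * c * D f f)"
      using psd[unfolded psd_form_def, rule_format, of "\<lambda>h. if h = e then 1 else if h = f then c else 0"] False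
        double_sum_two[OF fin ef False, of "\<lambda>h. if h = e then 1 else if h = f then c else 0" D] by simp
    also have "cnj c * c * D f f = complex_of_real ((cmod c)\<^sup>2 * Re (D f f))"
      by (subst psd_form_diag(2)[OF fin psd ef(2)]) (simp add: complex_norm_square mult.commute flip: of_real_power)
    also have "cnj c * D f e = cnj (c * D e f)" using psd_form_hermitian[OF fin psd ef] by simp
    finally show "0 \<le> Re (D e e) + 2 * Re (c * D e f) + (cmod c)\<^sup>2 * Re (D f f)" by simp
  qed (rule psd_form_diag(1)[OF fin psd ef(2)])
qed

text \<open>One elimination step. \<open>s\<close> is row \<open>g\<close> divided by the root of
  the pivot, and the remainder stays positive because completing the square in the
  \<open>g\<close>-th coordinate removes exactly the rank one part given by \<open>s\<close>. The
  second property lets any block structure of \<open>D\<close> pass to \<open>s\<close>.\<close>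

lemma psd_form_schur_complement:
  assumes fin: "finite Z" and psd: "psd_form Z D" and g: "g \<in> Z"
  obtains s where "\<And>f. f \<in> Z \<Longrightarrow> D g f = cnj (s g) * s f" "\<And>f. f \<in> Z \<Longrightarrow> s f \<noteq> 0 \<Longrightarrow> D g f \<noteq> 0"
    "psd_form (Z - {g}) (\<lambda>e f. D e f - cnj (s e) * s f)"
proof -
  define \<delta> where "\<delta> = Re (D g g)"
  have \<delta>: "0 \<le> \<delta>" "D g g = complex_of_real \<delta>" unfolding \<delta>_def using psd_form_diag[OF fin psd g] by auto
  \<comment> \<open>For a zero pivot the division yields \<open>s = 0\<close>, which agrees with the
    vanishing of row \<open>g\<close>.\<close>
  define s where "s f = D g f / complex_of_real (sqrt \<delta>)" for f
  have sg: "s g = complex_of_real (sqrt \<delta>)" unfolding s_def \<delta>(2)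
    using \<delta>(1) by (simp add: real_div_sqrt flip: of_real_divide)
  have 1: "D g f = cnj (s g) * s f" if "f \<in> Z" for f
  proof (cases "\<delta> = 0")
    case True
    then have "D g f = 0" using psd_form_bound[OF fin psd g that] by (simp add: \<delta>_def)
    then show ?thesis by (simp add: s_def)
  next
    case False
    then show ?thesis unfolding sg by (simp add: s_def)
  qed
  have 2: "D g f \<noteq> 0" if "s f \<noteq> 0" for f using that by (auto simp: s_def)
  let ?M = "Z - {g}"
  have "psd_form ?M (\<lambda>e f. D e f - cnj (s e) * s f)"
    unfolding psd_form_def
  proof
    fix x :: "'a \<Rightarrow> complex"
    define w where "w = (\<Sum>f\<in>?M. s f * x f)"
    \<comment> \<open>The coordinate at \<open>g\<close> that minimizes the quadratic form when the
      remaining coordinates are those of \<open>x\<close>.\<close>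
    define c where "c = (if \<delta> = 0 then 0 else - w / s g)"
    define y where "y e = (if e = g then c else x e)" for e
    have split: "(\<Sum>e\<in>Z. G e) = G g + (\<Sum>e\<in>?M. G e)" for G :: "'a \<Rightarrow> complex"
      by (rule sum.remove[OF fin g])
    have c: "cnj c * c * D g g + cnj c * (\<Sum>f\<in>?M. D g f * x f) + c * (\<Sum>e\<in>?M. cnj (x e) * D e g) = - (cnj w * w)"
    proof -
      have a: "(\<Sum>f\<in>?M. D g f * x f) = cnj (s g) * w"
        unfolding w_def sum_distrib_left using 1 by (intro sum.cong) auto
      have "D e g = cnj (s e) * s g" if "e \<in> ?M" for e
        using psd_form_hermitian[OF fin psd g, of e] 1[of e] that by auto
      then have b: "(\<Sum>e\<in>?M. cnj (x e) * D e g) = s g * cnj w"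
        unfolding w_def cnj_sum sum_distrib_left by (intro sum.cong) auto
      show ?thesis
      proof (cases "\<delta> = 0")
        case True
        then have "s f = 0" if "f \<in> ?M" for f by (simp add: s_def)
        then have "w = 0" unfolding w_def by (intro sum.neutral) auto
        with True show ?thesis by (simp add: c_def)
      next
        case False
        then have "s g \<noteq> 0" using \<delta> by (simp add: sg)
        then show ?thesis unfolding a b 1[OF g] c_def using False by (simp add: field_simps)
      qed
    qed
    have ww: "(\<Sum>e\<in>?M. \<Sum>f\<in>?M. cnj (x e) * x f * (cnj (s e) * s f)) = cnj w * w"
      unfolding w_def cnj_sum sum_product by (intro sum.cong refl) (simp add: mult_ac)
    have "(\<Sum>e\<in>Z. \<Sum>f\<in>Z. cnj (y e) * y f * D e f)
       = cnj c * c * D g g + cnj c * (\<Sum>f\<in>?M. D g f * x f) + c * (\<Sum>e\<in>?M. cnj (x e) * D e g)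
         + (\<Sum>e\<in>?M. \<Sum>f\<in>?M. cnj (x e) * x f * D e f)"
    proof -
      have inner: "(\<Sum>f\<in>Z. cnj z * y f * D e f) = cnj z * c * D e g + (\<Sum>f\<in>?M. cnj z * x f * D e f)" for z e
        unfolding split by (auto simp: y_def intro!: sum.cong)
      have "(\<Sum>e\<in>Z. \<Sum>f\<in>Z. cnj (y e) * y f * D e f) = cnj c * c * D g g + (\<Sum>f\<in>?M. cnj c * x f * D g f)
          + (\<Sum>e\<in>?M. cnj (x e) * c * D e g + (\<Sum>f\<in>?M. cnj (x e) * x f * D e f))"
        unfolding inner split by (auto simp: y_def intro!: sum.cong)
      then show ?thesis by (simp add: sum.distrib sum_distrib_left mult_ac)
    qed
    also have "\<dots> = (\<Sum>e\<in>?M. \<Sum>f\<in>?M. cnj (x e) * x f * (D e f - cnj (s e) * s f))"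
      unfolding c right_diff_distrib sum_subtractf ww by simp
    finally show "Im (\<Sum>e\<in>?M. \<Sum>f\<in>?M. cnj (x e) * x f * (D e f - cnj (s e) * s f)) = 0
        \<and> 0 \<le> Re (\<Sum>e\<in>?M. \<Sum>f\<in>?M. cnj (x e) * x f * (D e f - cnj (s e) * s f))"
      using psd[unfolded psd_form_def, rule_format, of y] by simp
  qed
  from 1 2 this show thesis by (rule that)
qed

text \<open>Eliminating a label that is maximal for \<open>\<rho>\<close> leaves its row
  unrestricted, since all labels lie below it, and later rows have a zero in its column; this gives
  the triangular support even when \<open>\<rho>\<close> takes equal values. Blocks of
  \<open>\<alpha>\<close> survive because the correction \<open>cnj (s e) * s f\<close> is nonzero
  only if \<open>e\<close> and \<open>f\<close> both lie in the block of \<open>g\<close>.\<close>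

lemma cholesky:
  fixes \<rho> :: "'l \<Rightarrow> 'o::order" and \<alpha> :: "'l \<Rightarrow> 'b"
  assumes "finite Z" and "psd_form Z D"
    and "\<And>e f. e \<in> Z \<Longrightarrow> f \<in> Z \<Longrightarrow> \<rho> e \<le> \<rho> f \<or> \<rho> f \<le> \<rho> e"
    and "\<And>e f. e \<in> Z \<Longrightarrow> f \<in> Z \<Longrightarrow> D e f \<noteq> 0 \<Longrightarrow> \<alpha> e = \<alpha> f"
  shows "\<exists>S. (\<forall>e\<in>Z. \<forall>f\<in>Z. S e f \<noteq> 0 \<longrightarrow> \<rho> f \<le> \<rho> e \<and> \<alpha> e = \<alpha> f)
    \<and> (\<forall>f\<in>Z. \<forall>g\<in>Z. D f g = (\<Sum>e\<in>Z. cnj (S e f) * S e g))"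
  using assms
proof (induction Z arbitrary: D rule: finite_psubset_induct)
  case (psubset Z)
  show ?case
  proof (cases "Z = {}")
    case False
    then have "finite (\<rho> ` Z)" "\<rho> ` Z \<noteq> {}" using psubset.hyps by auto
    from finite_has_maximal[OF this] obtain g where g: "g \<in> Z" "\<forall>b\<in>\<rho> ` Z. \<rho> g \<le> b \<longrightarrow> \<rho> g = b" by blast
    have top: "\<rho> f \<le> \<rho> g" if "f \<in> Z" for f using g psubset.prems(2)[OF g(1) that] that by force
    obtain s where s: "\<And>f. f \<in> Z \<Longrightarrow> D g f = cnj (s g) * s f" "\<And>f. f \<in> Z \<Longrightarrow> s f \<noteq> 0 \<Longrightarrow> D g f \<noteq> 0"
      and psd': "psd_form (Z - {g}) (\<lambda>e f. D e f - cnj (s e) * s f)"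
      by (rule psd_form_schur_complement[OF psubset.hyps psubset.prems(1) g(1)]) (rule that)
    let ?M = "Z - {g}"
    have at_s: "\<alpha> g = \<alpha> f" if "f \<in> Z" "s f \<noteq> 0" for f using psubset.prems(3)[OF g(1) that(1)] s(2)[OF that] by simp
    have D': "\<alpha> e = \<alpha> f" if ef: "e \<in> ?M" "f \<in> ?M" and ne: "D e f - cnj (s e) * s f \<noteq> 0" for e f
    proof (cases "D e f = 0")
      case True
      with ne have "s e \<noteq> 0" "s f \<noteq> 0" by auto
      with at_s[of e] at_s[of f] ef show ?thesis by auto
    qed (use psubset.prems(3) ef in auto)
    have "?M \<subset> Z" using g(1) by auto
    then have "\<exists>S. (\<forall>e\<in>?M. \<forall>f\<in>?M. S e f \<noteq> 0 \<longrightarrow> \<rho> f \<le> \<rho> e \<and> \<alpha> e = \<alpha> f)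
        \<and> (\<forall>e\<in>?M. \<forall>f\<in>?M. D e f - cnj (s e) * s f = (\<Sum>h\<in>?M. cnj (S h e) * S h f))"
    proof (rule psubset.IH[OF _ psd'])
      fix e f assume "e \<in> ?M" "f \<in> ?M"
      then show "\<rho> e \<le> \<rho> f \<or> \<rho> f \<le> \<rho> e" using psubset.prems(2) by blast
    qed (rule D')
    then obtain S' where S1: "\<forall>e\<in>?M. \<forall>f\<in>?M. S' e f \<noteq> 0 \<longrightarrow> \<rho> f \<le> \<rho> e \<and> \<alpha> e = \<alpha> f"
      and S2: "\<forall>e\<in>?M. \<forall>f\<in>?M. D e f - cnj (s e) * s f = (\<Sum>h\<in>?M. cnj (S' h e) * S' h f)"
      by (elim exE conjE) (rule that)
    define S where "S e f = (if e = g then s f else if f = g then 0 else S' e f)" for e f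
    have "\<rho> f \<le> \<rho> e \<and> \<alpha> e = \<alpha> f" if "e \<in> Z" "f \<in> Z" "S e f \<noteq> 0" for e f
    proof (cases "e = g")
      case True
      with that have "s f \<noteq> 0" by (simp add: S_def)
      with at_s[OF that(2)] top[OF that(2)] True show ?thesis by simp
    next
      case False
      with that have "f \<noteq> g" "S' e f \<noteq> 0" by (auto simp: S_def split: if_splits)
      with S1 that False show ?thesis by blast
    qed
    moreover have "D f h = (\<Sum>e\<in>Z. cnj (S e f) * S e h)" if fh: "f \<in> Z" "h \<in> Z" for f h
    proof -
      have "(\<Sum>e\<in>Z. cnj (S e f) * S e h) = cnj (s f) * s h + (\<Sum>e\<in>?M. cnj (S e f) * S e h)"
        by (subst sum.remove[OF psubset.hyps g(1)]) (simp add: S_def)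
      also have "(\<Sum>e\<in>?M. cnj (S e f) * S e h) = (if f = g \<or> h = g then 0 else (\<Sum>e\<in>?M. cnj (S' e f) * S' e h))"
        by (auto simp: S_def intro!: sum.neutral sum.cong)
      also have "cnj (s f) * s h + \<dots> = D f h"
      proof (cases "f = g \<or> h = g")
        case True
        then show ?thesis
          using s(1)[OF fh(1)] s(1)[OF fh(2)] psd_form_hermitian[OF psubset.hyps psubset.prems(1) g(1) fh(1)]
          by (auto simp: mult.commute)
      qed (use S2[rule_format, of f h] fh in \<open>auto simp: diff_eq_eq add.commute\<close>)
      finally show ?thesis by simp
    qed
    ultimately show ?thesis by (intro exI[of _ S] conjI ballI impI) (assumption | blast)+
  qed simp
qed

text \<open>In matrix form: \<open>P = B^* B\<close> and \<open>B B^* = 1\<close> give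
  \<open>B P = B B^* B = B\<close>.\<close>

lemma factor_absorb:
  fixes B P :: "'l \<Rightarrow> 'l \<Rightarrow> complex"
  assumes "finite G" and P: "\<forall>f\<in>Z. \<forall>g\<in>Z. P f g = (\<Sum>e\<in>G. cnj (B e f) * B e g)"
    and orth: "\<forall>e\<in>G. \<forall>g\<in>G. (\<Sum>f\<in>Z. B e f * cnj (B g f)) = (if e = g then 1 else 0)"
    and "e \<in> G" "f \<in> Z"
  shows "(\<Sum>h\<in>Z. B e h * P h f) = B e f"
proof -
  have "(\<Sum>h\<in>Z. B e h * P h f) = (\<Sum>h\<in>Z. \<Sum>k\<in>G. B e h * cnj (B k h) * B k f)"
    using assms by (intro sum.cong refl) (simp add: sum_distrib_left mult.assoc)
  also have "\<dots> = (\<Sum>k\<in>G. \<Sum>h\<in>Z. B e h * cnj (B k h) * B k f)" by (rule sum.swap)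
  also have "\<dots> = (\<Sum>k\<in>G. (if e = k then 1 else 0) * B k f)"
    using assms by (intro sum.cong refl) (simp add: sum_distrib_right[symmetric])
  also have "\<dots> = B e f" using assms by (simp add: if_distrib[of "\<lambda>z. z * _"] cong: if_cong)
  finally show ?thesis .
qed

text \<open>The conjugated rows of \<open>B\<close> form an orthonormal basis of the range of
  \<open>P\<close>. What matters is the labelling: each basis vector is named by an index of
  \<open>Z\<close> whose class is that of its support, so it can later inherit the space of that
  index. Elimination works because the normalized row \<open>s\<close> is a unit vector fixed by
  \<open>P\<close>; hence \<open>P' = P - s^* s\<close> is again a projection, and it has no entries
  in row and column \<open>g\<close>.\<close>

lemma projection_factorization:
  fixes c :: "'l \<Rightarrow> 'b" and P :: "'l \<Rightarrow> 'l \<Rightarrow> complex"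
  assumes "finite Z" and "\<And>e f. e \<in> Z \<Longrightarrow> f \<in> Z \<Longrightarrow> P f e = cnj (P e f)"
    and "\<And>e f. e \<in> Z \<Longrightarrow> f \<in> Z \<Longrightarrow> (\<Sum>g\<in>Z. P e g * P g f) = P e f"
    and "\<And>e f. e \<in> Z \<Longrightarrow> f \<in> Z \<Longrightarrow> P e f \<noteq> 0 \<Longrightarrow> c e = c f"
  shows "\<exists>G B. G \<subseteq> Z \<and> (\<forall>e\<in>G. \<forall>f\<in>Z. B e f \<noteq> 0 \<longrightarrow> c e = c f)
    \<and> (\<forall>f\<in>Z. \<forall>g\<in>Z. P f g = (\<Sum>e\<in>G. cnj (B e f) * B e g))
    \<and> (\<forall>e\<in>G. \<forall>g\<in>G. (\<Sum>f\<in>Z. B e f * cnj (B g f)) = (if e = g then 1 else 0))"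
  using assms
proof (induction Z arbitrary: P rule: finite_psubset_induct)
  case (psubset Z)
  note fin = psubset.hyps and herm = psubset.prems(1) and idem = psubset.prems(2)
  show ?case
  proof (cases "Z = {}")
    case True
    then show ?thesis by (intro exI[of _ "{}"]) auto
  next
    case False
    then obtain g where g: "g \<in> Z" by blast
    let ?M = "Z - {g}"
    \<comment> \<open>The squared norm of row \<open>g\<close>; idempotency identifies it with the
      diagonal entry \<open>P g g\<close>.\<close>
    define \<delta> where "\<delta> = (\<Sum>f\<in>Z. (cmod (P g f))\<^sup>2)"
    have Pgg: "P g g = complex_of_real \<delta>"
    proof -
      have "P g g = (\<Sum>f\<in>Z. P g f * P f g)" using idem[OF g g] by simp
      also have "\<dots> = (\<Sum>f\<in>Z. complex_of_real ((cmod (P g f))\<^sup>2))"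
        unfolding complex_norm_square using herm[OF g] by (intro sum.cong) auto
      finally show ?thesis unfolding \<delta>_def by simp
    qed
    have \<delta>0: "0 \<le> \<delta>" unfolding \<delta>_def by (rule sum_nonneg) simp
    define s where "s f = P g f / complex_of_real (sqrt \<delta>)" for f
    have zero: "P g f = 0" if "\<delta> = 0" "f \<in> Z" for f
      using that fin unfolding \<delta>_def by (subst (asm) sum_nonneg_eq_0_iff) auto
    have sq: "complex_of_real (sqrt \<delta>) * complex_of_real (sqrt \<delta>) = complex_of_real \<delta>"
      using \<delta>0 by (simp flip: of_real_mult)
    have sg: "s g = complex_of_real (sqrt \<delta>)" unfolding s_def Pgg
      using \<delta>0 by (simp add: real_div_sqrt flip: of_real_divide)
    have Pg: "P g f = cnj (s g) * s f" if "f \<in> Z" for f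
      unfolding sg using zero[OF _ that] by (cases "\<delta> = 0") (auto simp: s_def)
    have cs: "cnj (s f) = P f g / complex_of_real (sqrt \<delta>)" if "f \<in> Z" for f
      using herm[OF g that] by (simp add: s_def)
    have Ps: "(\<Sum>f\<in>Z. P e f * cnj (s f)) = cnj (s e)" if "e \<in> Z" for e
      using idem[OF that g] cs that by (simp add: sum_divide_distrib[symmetric] cong: sum.cong)
    have sP: "(\<Sum>f\<in>Z. s f * P f e) = s e" if "e \<in> Z" for e
      using idem[OF g that] by (simp add: s_def sum_divide_distrib[symmetric])
    have ss: "(\<Sum>f\<in>Z. s f * cnj (s f)) = (if \<delta> = 0 then 0 else 1)"
    proof -
      have "(\<Sum>f\<in>Z. s f * cnj (s f)) = (\<Sum>f\<in>Z. P g f * P f g / complex_of_real \<delta>)"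
      proof (rule sum.cong[OF refl])
        fix f assume "f \<in> Z"
        then have "s f * cnj (s f) = s f * (P f g / complex_of_real (sqrt \<delta>))" by (simp only: cs)
        then show "s f * cnj (s f) = P g f * P f g / complex_of_real \<delta>" by (simp add: s_def sq)
      qed
      also have "\<dots> = P g g / complex_of_real \<delta>" using idem[OF g g] by (simp add: sum_divide_distrib[symmetric])
      finally show ?thesis by (simp add: Pgg)
    qed
    define P' where "P' e f = P e f - cnj (s e) * s f" for e f
    have P'g: "P' g f = 0" "P' f g = 0" if "f \<in> Z" for f
      unfolding P'_def using Pg[OF that] herm[OF g that] by (auto simp: mult.commute)
    have s0: "s f = 0" if "\<delta> = 0" for f using that by (simp add: s_def)
    have P'idem: "(\<Sum>h\<in>Z. P' e h * P' h f) = P' e f" if "e \<in> Z" "f \<in> Z" for e f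
    proof -
      have "(\<Sum>h\<in>Z. P' e h * P' h f) = (\<Sum>h\<in>Z. P e h * P h f) - (\<Sum>h\<in>Z. P e h * cnj (s h)) * s f
          - cnj (s e) * (\<Sum>h\<in>Z. s h * P h f) + cnj (s e) * (\<Sum>h\<in>Z. s h * cnj (s h)) * s f"
        unfolding P'_def by (simp add: algebra_simps sum.distrib sum_subtractf sum_distrib_left sum_distrib_right)
      then show ?thesis using that by (auto simp: idem Ps sP ss P'_def s0)
    qed
    have P's: "(\<Sum>f\<in>?M. P' e f * cnj (s f)) = 0" if "e \<in> Z" for e
    proof -
      have "(\<Sum>f\<in>Z. P' e f * cnj (s f)) = (\<Sum>f\<in>Z. P e f * cnj (s f)) - cnj (s e) * (\<Sum>f\<in>Z. s f * cnj (s f))"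
        unfolding P'_def by (simp add: algebra_simps sum_subtractf sum_distrib_left)
      also have "\<dots> = 0" using Ps[OF that] ss s0 by auto
      finally show ?thesis using P'g(2)[OF that] by (subst (asm) sum.remove[OF fin g]) simp
    qed
    have c_s: "c g = c f" if "f \<in> Z" "s f \<noteq> 0" for f using psubset.prems(3)[OF g that(1)] that(2) by (auto simp: s_def)
    have c': "c e = c f" if ef: "e \<in> ?M" "f \<in> ?M" and ne: "P' e f \<noteq> 0" for e f
    proof (cases "P e f = 0")
      case True
      with ne have "s e \<noteq> 0" "s f \<noteq> 0" by (auto simp: P'_def)
      with c_s[of e] c_s[of f] ef show ?thesis by auto
    qed (use psubset.prems(3) ef in auto)
    have "\<exists>G B. G \<subseteq> ?M \<and> (\<forall>e\<in>G. \<forall>f\<in>?M. B e f \<noteq> 0 \<longrightarrow> c e = c f)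
      \<and> (\<forall>f\<in>?M. \<forall>g\<in>?M. P' f g = (\<Sum>e\<in>G. cnj (B e f) * B e g))
      \<and> (\<forall>e\<in>G. \<forall>g\<in>G. (\<Sum>f\<in>?M. B e f * cnj (B g f)) = (if e = g then 1 else 0))"
    proof (rule psubset.IH)
      fix e f assume ef: "e \<in> ?M" "f \<in> ?M"
      show "P' f e = cnj (P' e f)" using herm[of e f] ef by (simp add: P'_def)
      show "(\<Sum>h\<in>?M. P' e h * P' h f) = P' e f"
        using P'idem[of e f] ef P'g(2)[of e] sum.remove[OF fin g, of "\<lambda>h. P' e h * P' h f"] by simp
    qed (use g c' in auto)
    then obtain G B where G: "G \<subseteq> ?M" and B1: "\<forall>e\<in>G. \<forall>f\<in>?M. B e f \<noteq> 0 \<longrightarrow> c e = c f"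
      and B2: "\<forall>f\<in>?M. \<forall>g\<in>?M. P' f g = (\<Sum>e\<in>G. cnj (B e f) * B e g)"
      and B3: "\<forall>e\<in>G. \<forall>g\<in>G. (\<Sum>f\<in>?M. B e f * cnj (B g f)) = (if e = g then 1 else 0)"
      by (elim exE conjE) (rule that)
    have finG: "finite G" using G fin finite_subset by blast
    \<comment> \<open>The old rows are orthogonal to the new one: \<open>B = B P'\<close> by
      \<open>factor_absorb\<close>, and \<open>P'\<close> annihilates the conjugate of
      \<open>s\<close>.\<close>
    have Bs: "(\<Sum>f\<in>?M. B e f * cnj (s f)) = 0" if e: "e \<in> G" for e
    proof -
      have "B e f = (\<Sum>h\<in>?M. B e h * P' h f)" if f: "f \<in> ?M" for f
        by (rule factor_absorb[OF finG B2 B3 e f, symmetric])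
      then have "(\<Sum>f\<in>?M. B e f * cnj (s f)) = (\<Sum>f\<in>?M. \<Sum>h\<in>?M. B e h * (P' h f * cnj (s f)))"
        by (intro sum.cong refl) (simp add: sum_distrib_right mult.assoc)
      also have "\<dots> = (\<Sum>h\<in>?M. \<Sum>f\<in>?M. B e h * (P' h f * cnj (s f)))" by (rule sum.swap)
      also have "\<dots> = 0" using P's by (simp add: sum_distrib_left[symmetric])
      finally show ?thesis .
    qed
    define B' where "B' e f = (if e = g then s f else if f = g then 0 else B e f)" for e f
    \<comment> \<open>If row \<open>g\<close> vanishes, it contributes no basis vector and the label
      \<open>g\<close> is dropped.\<close>
    define G' where "G' = (if \<delta> = 0 then G else insert g G)"
    have gG: "g \<notin> G" using G by auto
    have "G' \<subseteq> Z" using G g by (auto simp: G'_def)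
    moreover have "c e = c f" if "e \<in> G'" "f \<in> Z" "B' e f \<noteq> 0" for e f
    proof (cases "e = g")
      case True
      with that have "s f \<noteq> 0" by (simp add: B'_def)
      with c_s[OF that(2)] True show ?thesis by simp
    next
      case False
      with that have "f \<noteq> g" "B e f \<noteq> 0" "e \<in> G" by (auto simp: B'_def G'_def split: if_splits)
      with B1 that show ?thesis by blast
    qed
    moreover have "P f h = (\<Sum>e\<in>G'. cnj (B' e f) * B' e h)" if fh: "f \<in> Z" "h \<in> Z" for f h
    proof -
      have "(\<Sum>e\<in>G'. cnj (B' e f) * B' e h) = cnj (s f) * s h + (\<Sum>e\<in>G. cnj (B' e f) * B' e h)"
        using finG gG s0 by (auto simp: G'_def B'_def)
      also have "(\<Sum>e\<in>G. cnj (B' e f) * B' e h) = P' f h"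
      proof (cases "f = g \<or> h = g")
        case True
        then have "(\<Sum>e\<in>G. cnj (B' e f) * B' e h) = 0" using gG by (intro sum.neutral) (auto simp: B'_def)
        then show ?thesis using True P'g fh by auto
      next
        case False
        then have "(\<Sum>e\<in>G. cnj (B' e f) * B' e h) = (\<Sum>e\<in>G. cnj (B e f) * B e h)"
          using gG by (intro sum.cong) (auto simp: B'_def)
        then show ?thesis using B2 False fh by auto
      qed
      finally show ?thesis by (simp add: P'_def)
    qed
    moreover have "(\<Sum>f\<in>Z. B' e f * cnj (B' h f)) = (if e = h then 1 else 0)" if eh: "e \<in> G'" "h \<in> G'" for e h
    proof -
      have sp: "(\<Sum>f\<in>Z. B' e f * cnj (B' h f)) = B' e g * cnj (B' h g) + (\<Sum>f\<in>?M. B' e f * cnj (B' h f))"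
        by (rule sum.remove[OF fin g])
      consider "e \<in> G" "h \<in> G" | "e = g" "h \<in> G" | "e \<in> G" "h = g" | "e = g" "h = g" "\<delta> \<noteq> 0"
        using eh by (auto simp: G'_def split: if_splits)
      then show ?thesis
      proof cases
        case 1
        then have "(\<Sum>f\<in>?M. B' e f * cnj (B' h f)) = (\<Sum>f\<in>?M. B e f * cnj (B h f))"
          using gG by (intro sum.cong) (auto simp: B'_def)
        moreover have "B' e g = 0" using 1 gG by (auto simp: B'_def)
        ultimately show ?thesis using sp B3 1 by simp
      next
        case 2
        then have "(\<Sum>f\<in>?M. B' e f * cnj (B' h f)) = (\<Sum>f\<in>?M. cnj (B h f * cnj (s f)))"
          using gG by (intro sum.cong) (auto simp: B'_def)
        also have "\<dots> = 0" using Bs[OF 2(2)] by (metis cnj_sum complex_cnj_zero)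
        moreover have "B' h g = 0" using 2 gG by (auto simp: B'_def)
        ultimately show ?thesis using sp 2 gG by auto
      next
        case 3
        then have "(\<Sum>f\<in>?M. B' e f * cnj (B' h f)) = (\<Sum>f\<in>?M. B e f * cnj (s f))"
          using gG by (intro sum.cong) (auto simp: B'_def)
        moreover have "B' e g = 0" using 3 gG by (auto simp: B'_def)
        ultimately show ?thesis using sp 3 gG Bs by auto
      next
        case 4
        then show ?thesis using ss by (simp add: B'_def)
      qed
    qed
    ultimately show ?thesis by (intro exI[of _ G'] exI[of _ B'] conjI ballI impI) auto
  qed
qed

text \<open>Pinching: the value of the truncated form at \<open>x\<close> is the sum of the values
  of \<open>D\<close> at the restrictions of \<open>x\<close> to the blocks of
  \<open>\<alpha>\<close>.\<close>

lemma psd_form_block_diagonal: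
  assumes fin: "finite Z" and psd: "psd_form Z D"
  shows "psd_form Z (\<lambda>e f. if \<alpha> e = \<alpha> f then D e f else 0)"
  unfolding psd_form_def
proof
  fix x :: "'a \<Rightarrow> complex"
  define y where "y A e = (if \<alpha> e = A then x e else 0)" for A e
  have "(\<Sum>e\<in>Z. \<Sum>f\<in>Z. cnj (x e) * x f * (if \<alpha> e = \<alpha> f then D e f else 0))
      = (\<Sum>e\<in>Z. \<Sum>f\<in>Z. \<Sum>A\<in>\<alpha> ` Z. cnj (y A e) * y A f * D e f)"
  proof (intro sum.cong refl)
    fix e f assume ef: "e \<in> Z" "f \<in> Z"
    have "(\<Sum>A\<in>\<alpha> ` Z. cnj (y A e) * y A f * D e f)
        = (\<Sum>A\<in>\<alpha> ` Z. if A = \<alpha> e then cnj (x e) * x f * (if \<alpha> e = \<alpha> f then D e f else 0) else 0)"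
      by (intro sum.cong refl) (auto simp: y_def)
    also have "\<dots> = cnj (x e) * x f * (if \<alpha> e = \<alpha> f then D e f else 0)" using fin ef by simp
    finally show "cnj (x e) * x f * (if \<alpha> e = \<alpha> f then D e f else 0) = (\<Sum>A\<in>\<alpha> ` Z. cnj (y A e) * y A f * D e f)" by simp
  qed
  also have "\<dots> = (\<Sum>e\<in>Z. \<Sum>A\<in>\<alpha> ` Z. \<Sum>f\<in>Z. cnj (y A e) * y A f * D e f)"
    by (rule sum.cong[OF refl], rule sum.swap)
  also have "\<dots> = (\<Sum>A\<in>\<alpha> ` Z. \<Sum>e\<in>Z. \<Sum>f\<in>Z. cnj (y A e) * y A f * D e f)" by (rule sum.swap)
  finally show "Im (\<Sum>e\<in>Z. \<Sum>f\<in>Z. cnj (x e) * x f * (if \<alpha> e = \<alpha> f then D e f else 0)) = 0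
      \<and> 0 \<le> Re (\<Sum>e\<in>Z. \<Sum>f\<in>Z. cnj (x e) * x f * (if \<alpha> e = \<alpha> f then D e f else 0))"
    using psd unfolding psd_form_def by (simp add: sum_nonneg)
qed

section \<open>The Radon-Nikodym theorem for nests of pure maps\<close>

text \<open>\<open>v i j\<close> is the image under \<open>V_i\<close> of the \<open>j\<close>-th
  standard basis vector of \<open>H_i\<close>, so \<open>V_i\<close> is given by its columns and its
  range is their span. The locale gathers the hypotheses in which the instrument does not
  occur.\<close>

locale stinespring_nest =
  fixes L :: nat and d :: "nat \<Rightarrow> nat" and \<psi> :: "nat \<Rightarrow> 'a::cstar_algebra \<Rightarrow> complex mat"
    and \<pi> :: "'a \<Rightarrow> 'p::chilbert \<Rightarrow> 'p" and v :: "nat \<Rightarrow> nat \<Rightarrow> 'p"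
  assumes pure: "\<forall>i<L. ucp_map (d i) (\<psi> i) \<and> pure_cp (d i) (\<psi> i)"
    and irr: "irreducible_rep \<pi>"
    and stinespring: "\<forall>i<L. \<forall>a. \<psi> i a = mat (d i) (d i) (\<lambda>(j, k). cinner (v i j) (\<pi> a (v i k)))"
    and minimal: "\<forall>i<L. closure (cspan {\<pi> a (v i k) | a k. k < d i}) = UNIV"
    and nest: "\<forall>i<L. \<forall>j<L. cspan (v i ` {..<d i}) \<subseteq> cspan (v j ` {..<d j})
                              \<or> cspan (v j ` {..<d j}) \<subseteq> cspan (v i ` {..<d i})"
begin

definition R :: "nat \<Rightarrow> 'p set" where "R i = cspan (v i ` {..<d i})"

lemma R_zero: "0 \<in> R i" and R_add: "x \<in> R i \<Longrightarrow> y \<in> R i \<Longrightarrow> x + y \<in> R i"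
  and R_cscale: "x \<in> R i \<Longrightarrow> cscale c x \<in> R i"
  and R_sum: "(\<And>e. e \<in> F \<Longrightarrow> f e \<in> R i) \<Longrightarrow> sum f F \<in> R i"
  and R_v: "j < d i \<Longrightarrow> v i j \<in> R i"
  unfolding R_def using cspan_superset[of "v i ` {..<d i}"]
  by (auto intro: cspan_zero cspan_add cspan_cscale cspan_sum)

lemma R_linear: "i < L \<Longrightarrow> j < L \<Longrightarrow> R i \<subseteq> R j \<or> R j \<subseteq> R i"
  unfolding R_def using nest by blast

lemma rep: "star_rep \<pi>" using irr unfolding irreducible_rep_def by blast

lemma rep_add: "\<pi> a (x + y) = \<pi> a x + \<pi> a y"
  and rep_cscale: "\<pi> a (cscale c x) = cscale c (\<pi> a x)"
  and rep_scale: "\<pi> (cscale c a) x = cscale c (\<pi> a x)"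
  and rep_mult: "\<pi> (a * b) x = \<pi> a (\<pi> b x)"
  and rep_one [simp]: "\<pi> 1 x = x"
  and rep_adj: "cinner (\<pi> (cstar a) x) y = cinner x (\<pi> a y)"
  using rep unfolding star_rep_def bounded_clinear_op_def by auto

lemma rep_zero [simp]: "\<pi> a 0 = 0"
  using rep_cscale[of a 0 0] by simp

lemma rep_sum: "\<pi> a (\<Sum>i\<in>F. f i) = (\<Sum>i\<in>F. \<pi> a (f i))"
  by (induction F rule: infinite_finite_induct) (auto simp: rep_add)

lemma rep_adj': "cinner (\<pi> a x) y = cinner x (\<pi> (cstar a) y)"
  using rep_adj[of "cstar a" x y] by (simp add: cstar_cstar)

lemma rep_minus: "\<pi> (cscale (-1) a) x = - \<pi> a x"
  using cscale_minus_left[of 1 "\<pi> a x"] by (simp add: rep_scale cscale_one)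

text \<open>Minimality with \<open>d i = 0\<close> would make the representation space trivial. The
  lemma supplies the vector \<open>v i 0\<close>, a unit vector used for testing throughout.\<close>

lemma d_pos: "i < L \<Longrightarrow> 0 < d i"
proof (rule ccontr)
  assume "i < L" "\<not> 0 < d i"
  then have "closure (cspan ({} :: 'p set)) = UNIV" using minimal by auto
  moreover have "cspan ({} :: 'p set) = {0}" unfolding cspan_def by auto
  ultimately have "(UNIV :: 'p set) = {0}" by simp
  then show False using irr unfolding irreducible_rep_def by blast
qed

lemma v_inner: "i < L \<Longrightarrow> j < d i \<Longrightarrow> k < d i \<Longrightarrow> cinner (v i j) (v i k) = (if j = k then 1 else 0)"
proof -
  assume i: "i < L" "j < d i" "k < d i"
  have "\<psi> i 1 $$ (j, k) = cinner (v i j) (v i k)" using stinespring i by simp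
  moreover have "\<psi> i 1 = 1\<^sub>m (d i)" using pure i unfolding ucp_map_def by blast
  ultimately show ?thesis using i by simp
qed

text \<open>Scalar coefficients are absorbed into the algebra elements and the summands are kept in
  a list, so that approximants convert directly into arguments of \<open>cp_form\<close>.\<close>

lemma minimal_approx:
  assumes "i < L" "0 < \<epsilon>"
  obtains ps where "\<forall>p\<in>set ps. snd p < d i" "norm (x - (\<Sum>p\<leftarrow>ps. \<pi> (fst p) (v i (snd p)))) < \<epsilon>"
proof -
  have "x \<in> closure (cspan {\<pi> a (v i k) | a k. k < d i})" using minimal assms(1) by auto
  then obtain y where y: "y \<in> cspan {\<pi> a (v i k) | a k. k < d i}" "dist y x < \<epsilon>"
    using assms(2) unfolding closure_approachable by blast
  then obtain F c where F: "finite F" "F \<subseteq> {\<pi> a (v i k) | a k. k < d i}" "y = (\<Sum>s\<in>F. cscale (c s) s)"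
    unfolding cspan_def by blast
  from F(2) have "\<forall>s\<in>F. \<exists>a k. k < d i \<and> s = \<pi> a (v i k)" by blast
  then obtain A K where AK: "\<And>s. s \<in> F \<Longrightarrow> K s < d i \<and> s = \<pi> (A s) (v i (K s))" by metis
  obtain fs where fs: "set fs = F" "distinct fs" using finite_distinct_list[OF F(1)] by blast
  define ps where "ps = map (\<lambda>s. (cscale (c s) (A s), K s)) fs"
  have "(\<Sum>p\<leftarrow>ps. \<pi> (fst p) (v i (snd p))) = (\<Sum>s\<leftarrow>fs. cscale (c s) (\<pi> (A s) (v i (K s))))"
    unfolding ps_def by (simp add: o_def rep_scale)
  also have "\<dots> = (\<Sum>s\<leftarrow>fs. cscale (c s) s)"
    using AK fs by (intro arg_cong[of _ _ sum_list] map_cong refl) (metis)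
  also have "\<dots> = y" unfolding F(3) fs(1)[symmetric] by (rule sum_list_distinct_conv_sum_set[OF fs(2)])
  finally have "norm (x - (\<Sum>p\<leftarrow>ps. \<pi> (fst p) (v i (snd p)))) < \<epsilon>"
    using y(2) by (simp add: dist_norm norm_minus_commute)
  moreover have "\<forall>p\<in>set ps. snd p < d i" unfolding ps_def using AK fs by auto
  ultimately show thesis using that by blast
qed

text \<open>A vector orthogonal to a total set vanishes. This is how identities in the
  representation space are obtained from inner products.\<close>

lemma minimal_zero:
  assumes i: "i < L" and orth: "\<And>a j. j < d i \<Longrightarrow> cinner (\<pi> a (v i j)) z = 0"
  shows "z = 0"
proof -
  have bound: "(norm z)\<^sup>2 \<le> \<epsilon> * norm z" if \<epsilon>: "0 < \<epsilon>" for \<epsilon>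
  proof -
    obtain ps where ps: "\<forall>p\<in>set ps. snd p < d i" "norm (z - (\<Sum>p\<leftarrow>ps. \<pi> (fst p) (v i (snd p)))) < \<epsilon>"
      by (rule minimal_approx[OF i \<epsilon>])
    let ?y = "\<Sum>p\<leftarrow>ps. \<pi> (fst p) (v i (snd p))"
    have "cinner ?y z = (\<Sum>p\<leftarrow>ps. 0)" unfolding cinner_sum_list_left
      using ps(1) orth by (intro arg_cong[of _ _ sum_list] map_cong) auto
    then have "cinner (z - ?y) z = complex_of_real ((norm z)\<^sup>2)"
      by (simp add: cinner_diff_left cinner_self_norm)
    then have "(norm z)\<^sup>2 = cmod (cinner (z - ?y) z)" by (simp add: norm_power)
    also have "\<dots> \<le> norm (z - ?y) * norm z" by (rule cinner_Cauchy_Schwarz)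
    also have "\<dots> \<le> \<epsilon> * norm z" using ps(2) by (intro mult_right_mono) auto
    finally show ?thesis .
  qed
  show ?thesis
  proof (rule ccontr)
    assume "z \<noteq> 0"
    then show False using bound[of "norm z / 2"] by (simp add: power2_eq_square)
  qed
qed

end

text \<open>A concrete form of the minimal Stinespring dilation of \<open>\<phi>\<close>: the maps \<open>V e\<close> identify \<open>\<complex>\<^sup>N\<close>
  with the families \<open>\<xi>\<close> such that \<open>\<xi> e \<in> R (\<kappa> e)\<close>, and \<open>\<phi>\<close> becomes a direct sum of compressions of \<open>\<pi>\<close>.\<close>
locale nest_system = stinespring_nest L d \<psi> \<pi> v
  for L d and \<psi> :: "nat \<Rightarrow> 'a::cstar_algebra \<Rightarrow> complex mat" and \<pi> :: "'a \<Rightarrow> 'p::chilbert \<Rightarrow> 'p" and v +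
  fixes N :: nat and \<phi> :: "'a \<Rightarrow> complex mat" and Z :: "'l set" and \<kappa> :: "'l \<Rightarrow> nat"
    and V :: "'l \<Rightarrow> complex vec \<Rightarrow> 'p"
  assumes cp: "cp_map N \<phi>" and unital: "\<phi> 1 = 1\<^sub>m N"
    and fin: "finite Z" and idx: "e \<in> Z \<Longrightarrow> \<kappa> e < L"
    and V_range: "e \<in> Z \<Longrightarrow> h \<in> carrier_vec N \<Longrightarrow> V e h \<in> R (\<kappa> e)"
    and V_add: "e \<in> Z \<Longrightarrow> h \<in> carrier_vec N \<Longrightarrow> k \<in> carrier_vec N \<Longrightarrow> V e (h + k) = V e h + V e k"
    and V_smult: "e \<in> Z \<Longrightarrow> h \<in> carrier_vec N \<Longrightarrow> V e (c \<cdot>\<^sub>v h) = cscale c (V e h)"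
    and V_dilation: "h \<in> carrier_vec N \<Longrightarrow> k \<in> carrier_vec N \<Longrightarrow>
        vinner h (\<phi> a *\<^sub>v k) = (\<Sum>e\<in>Z. cinner (V e h) (\<pi> a (V e k)))"
    and V_surj: "(\<And>e. e \<in> Z \<Longrightarrow> \<xi> e \<in> R (\<kappa> e)) \<Longrightarrow> \<exists>h\<in>carrier_vec N. \<forall>e\<in>Z. V e h = \<xi> e"
begin

lemma V_inner: "h \<in> carrier_vec N \<Longrightarrow> k \<in> carrier_vec N \<Longrightarrow> vinner h k = (\<Sum>e\<in>Z. cinner (V e h) (V e k))"
  using V_dilation[of h k 1] by (simp add: unital)

lemma V_inj:
  assumes "h \<in> carrier_vec N" "k \<in> carrier_vec N" "\<And>e. e \<in> Z \<Longrightarrow> V e h = V e k"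
  shows "h = k"
  using assms by (intro vec_eq_vinnerI[of _ N]) (auto simp: V_inner)

text \<open>Inverts the passage from \<open>h\<close> to the family of its components; on admissible
  families the choice is unique by \<open>V_inj\<close>. Nothing is known of the value at a family
  with some \<open>\<xi> e\<close> outside \<open>R (\<kappa> e)\<close>.\<close>

definition Vinv :: "('l \<Rightarrow> 'p) \<Rightarrow> complex vec" where
  "Vinv \<xi> = (SOME h. h \<in> carrier_vec N \<and> (\<forall>e\<in>Z. V e h = \<xi> e))"

abbreviation dl :: "'l \<Rightarrow> 'p \<Rightarrow> 'l \<Rightarrow> 'p" where
  "dl e x \<equiv> (\<lambda>f. if f = e then x else 0)"

lemma Vinv:
  assumes "\<And>e. e \<in> Z \<Longrightarrow> \<xi> e \<in> R (\<kappa> e)"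
  shows "Vinv \<xi> \<in> carrier_vec N" "e \<in> Z \<Longrightarrow> V e (Vinv \<xi>) = \<xi> e"
proof -
  have "\<exists>h. h \<in> carrier_vec N \<and> (\<forall>e\<in>Z. V e h = \<xi> e)" using V_surj[of \<xi>] assms by blast
  from someI_ex[OF this] show "Vinv \<xi> \<in> carrier_vec N" "e \<in> Z \<Longrightarrow> V e (Vinv \<xi>) = \<xi> e"
    unfolding Vinv_def by blast+
qed

lemma Vinv_dl:
  assumes "x \<in> R (\<kappa> e)"
  shows "Vinv (dl e x) \<in> carrier_vec N" "f \<in> Z \<Longrightarrow> V f (Vinv (dl e x)) = (if f = e then x else 0)"
  using assms R_zero Vinv[of "dl e x"] by auto

text \<open>Once \<open>M\<close> is moved to the other side, the family occurs only in the linear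
  slots of inner products. Linear dependence on \<open>\<xi>\<close> can then be read off without
  proving that \<open>Vinv\<close> is linear.\<close>

lemma vinner_Vinv:
  assumes M: "M \<in> carrier_mat N N" and h: "h \<in> carrier_vec N" and \<xi>: "\<And>e. e \<in> Z \<Longrightarrow> \<xi> e \<in> R (\<kappa> e)"
  shows "vinner h (M *\<^sub>v Vinv \<xi>) = (\<Sum>e\<in>Z. cinner (V e (madj M *\<^sub>v h)) (\<xi> e))"
proof -
  have "vinner h (M *\<^sub>v Vinv \<xi>) = vinner (madj M *\<^sub>v h) (Vinv \<xi>)"
    using vinner_madj[OF madj_carrier[OF M] h Vinv(1)[OF \<xi>]] by simp
  also have "\<dots> = (\<Sum>e\<in>Z. cinner (V e (madj M *\<^sub>v h)) (V e (Vinv \<xi>)))"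
    by (intro V_inner Vinv(1)[OF \<xi>] mult_mat_vec_carrier[OF madj_carrier[OF M] h])
  finally show ?thesis using Vinv(2)[OF \<xi>] by (simp cong: sum.cong)
qed

lemma vinner_Vinv_dl:
  assumes M: "M \<in> carrier_mat N N" and h: "h \<in> carrier_vec N" and e: "e \<in> Z" "x \<in> R (\<kappa> e)"
  shows "vinner h (M *\<^sub>v Vinv (dl e x)) = cinner (V e (madj M *\<^sub>v h)) x"
proof -
  have "vinner h (M *\<^sub>v Vinv (dl e x)) = (\<Sum>f\<in>Z. cinner (V f (madj M *\<^sub>v h)) (dl e x f))"
    using e R_zero by (intro vinner_Vinv[OF M h]) auto
  also have "\<dots> = cinner (V e (madj M *\<^sub>v h)) x"
    using e fin by (simp add: if_distrib[of "cinner _"] cong: if_cong)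
  finally show ?thesis .
qed

lemma vinner_mat_cnj:
  assumes "M \<in> carrier_mat N N" "h \<in> carrier_vec N" "k \<in> carrier_vec N"
  shows "vinner h (M *\<^sub>v k) = cnj (vinner k (madj M *\<^sub>v h))"
  using assms vinner_madj[of M N N k h] vinner_mult_left[of M N N k h] by simp

text \<open>\<open>x\<close> and \<open>y\<close> are taken from the intersection of all the spaces
  because only then are they admissible in every component and with every coefficient. The left slot
  is expanded by conjugating to the right one.\<close>

lemma vinner_Vinv_expand:
  assumes M: "M \<in> carrier_mat N N" and x: "x \<in> \<Inter>(R ` \<kappa> ` Z)" and y: "y \<in> \<Inter>(R ` \<kappa> ` Z)"
  shows "vinner (Vinv (\<lambda>e. cscale (s e) x)) (M *\<^sub>v Vinv (\<lambda>e. cscale (t e) y))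
    = (\<Sum>e\<in>Z. \<Sum>f\<in>Z. cnj (s e) * t f * vinner (Vinv (dl e x)) (M *\<^sub>v Vinv (dl f y)))"
proof -
  have ok: "cscale (c e) z \<in> R (\<kappa> e)" "z \<in> R (\<kappa> e)" if "z \<in> \<Inter>(R ` \<kappa> ` Z)" "e \<in> Z" for c z e
    using that by (auto intro: R_cscale)
  have right: "vinner h (M' *\<^sub>v Vinv (\<lambda>e. cscale (c e) z)) = (\<Sum>f\<in>Z. c f * vinner h (M' *\<^sub>v Vinv (dl f z)))"
    if "h \<in> carrier_vec N" "z \<in> \<Inter>(R ` \<kappa> ` Z)" "M' \<in> carrier_mat N N" for h z c M'
    using that ok by (simp add: vinner_Vinv vinner_Vinv_dl cinner_cscale_right cong: sum.cong)
  have c: "Vinv (\<lambda>e. cscale (u e) z) \<in> carrier_vec N" "e \<in> Z \<Longrightarrow> Vinv (dl e z) \<in> carrier_vec N"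
    if "z \<in> \<Inter>(R ` \<kappa> ` Z)" for u z e
    using ok[OF that] by (auto intro!: Vinv(1) Vinv_dl(1))
  have "vinner (Vinv (\<lambda>e. cscale (s e) x)) (M *\<^sub>v Vinv (\<lambda>e. cscale (t e) y))
      = (\<Sum>f\<in>Z. t f * vinner (Vinv (\<lambda>e. cscale (s e) x)) (M *\<^sub>v Vinv (dl f y)))"
    using M y c x by (intro right) auto
  also have "\<dots> = (\<Sum>f\<in>Z. \<Sum>e\<in>Z. cnj (s e) * t f * vinner (Vinv (dl e x)) (M *\<^sub>v Vinv (dl f y)))"
  proof (rule sum.cong[OF refl])
    fix f assume f: "f \<in> Z"
    have "vinner (Vinv (\<lambda>e. cscale (s e) x)) (M *\<^sub>v Vinv (dl f y))
        = cnj (vinner (Vinv (dl f y)) (madj M *\<^sub>v Vinv (\<lambda>e. cscale (s e) x)))"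
      by (rule vinner_mat_cnj[OF M c(1)[OF x] c(2)[OF y f]])
    also have "\<dots> = (\<Sum>e\<in>Z. cnj (s e) * cnj (vinner (Vinv (dl f y)) (madj M *\<^sub>v Vinv (dl e x))))"
      by (subst right[OF c(2)[OF y f] x madj_carrier[OF M]]) simp
    also have "\<dots> = (\<Sum>e\<in>Z. cnj (s e) * vinner (Vinv (dl e x)) (M *\<^sub>v Vinv (dl f y)))"
      by (intro sum.cong refl arg_cong[of _ _ "\<lambda>z. _ * z"] vinner_mat_cnj[symmetric] M c x y f)
    finally show "t f * vinner (Vinv (\<lambda>e. cscale (s e) x)) (M *\<^sub>v Vinv (dl f y))
        = (\<Sum>e\<in>Z. cnj (s e) * t f * vinner (Vinv (dl e x)) (M *\<^sub>v Vinv (dl f y)))"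
      by (simp add: sum_distrib_left mult_ac)
  qed
  also have "\<dots> = (\<Sum>e\<in>Z. \<Sum>f\<in>Z. cnj (s e) * t f * vinner (Vinv (dl e x)) (M *\<^sub>v Vinv (dl f y)))"
    by (rule sum.swap)
  finally show ?thesis .
qed

lemma smallest_range:
  assumes "Z \<noteq> {}"
  obtains \<gamma> where "\<gamma> < L" "\<And>e. e \<in> Z \<Longrightarrow> R \<gamma> \<subseteq> R (\<kappa> e)"
proof -
  have "finite (R ` \<kappa> ` Z)" "R ` \<kappa> ` Z \<noteq> {}" using fin assms by auto
  from finite_has_minimal[OF this] obtain m where m: "m \<in> R ` \<kappa> ` Z" "\<forall>b\<in>R ` \<kappa> ` Z. b \<subseteq> m \<longrightarrow> m = b" by blast
  then obtain g where g: "g \<in> Z" "m = R (\<kappa> g)" by blast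
  have "R (\<kappa> g) \<subseteq> R (\<kappa> e)" if "e \<in> Z" for e
    using m g that R_linear[OF idx[OF g(1)] idx[OF that]] by blast
  then show thesis using that idx[OF g(1)] by blast
qed

text \<open>The component \<open>e\<close>, in the dilation space, of the tensor represented by the
  list.\<close>

definition VL :: "'l \<Rightarrow> ('a \<times> complex vec) list \<Rightarrow> 'p" where
  "VL e xs = (\<Sum>x\<leftarrow>xs. \<pi> (fst x) (V e (snd x)))"

lemma VL_append: "VL e (xs @ ys) = VL e xs + VL e ys"
  by (simp add: VL_def)

lemma VL_neg: "VL e (map (apfst (cscale (-1))) xs) = - VL e xs"
  by (induction xs) (auto simp: VL_def rep_minus)

lemma cp_form_dilation:
  assumes "vec_list N xs" "vec_list N ys"
  shows "cp_form \<phi> xs ys = (\<Sum>e\<in>Z. cinner (VL e xs) (VL e ys))"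
proof -
  have "cp_form \<phi> xs ys = (\<Sum>x\<leftarrow>xs. \<Sum>y\<leftarrow>ys. \<Sum>e\<in>Z. cinner (\<pi> (fst x) (V e (snd x))) (\<pi> (fst y) (V e (snd y))))"
    unfolding cp_form_def using assms
    by (intro arg_cong[of _ _ sum_list] map_cong refl) (simp add: V_dilation rep_mult rep_adj')
  also have "\<dots> = (\<Sum>e\<in>Z. cinner (VL e xs) (VL e ys))"
    unfolding sum_list_sum_list_sum VL_def sum_list_cinner ..
  finally show ?thesis .
qed

end

section \<open>Compression to the smallest space and extension by density\<close>

context nest_system
begin

text \<open>For a unit vector \<open>x\<close> of the multiplicity space, sending \<open>w\<close>
  in \<open>R \<gamma>\<close> to the family \<open>x e * w\<close> is isometric and makes sense
  because \<open>R \<gamma>\<close> lies in every \<open>R (\<kappa> e)\<close>. Compressing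
  \<open>\<phi>\<close> along it returns \<open>\<psi> \<gamma>\<close>, so purity makes the
  compression of \<open>\<Theta>\<close> a multiple of \<open>\<psi> \<gamma>\<close>. The factor
  \<open>t\<close> depends on \<open>x\<close>.\<close>

lemma pure_compression_normalized:
  assumes cpT: "cp_map N \<Theta>"
    and le: "\<And>xs. vec_list N xs \<Longrightarrow> Re (cp_form \<Theta> xs xs) \<le> Re (cp_form \<phi> xs xs)"
    and \<gamma>: "\<gamma> < L" "\<And>e. e \<in> Z \<Longrightarrow> R \<gamma> \<subseteq> R (\<kappa> e)"
    and x: "(\<Sum>e\<in>Z. (cmod (x e))\<^sup>2) = 1"
  shows "\<exists>t. \<forall>a. \<forall>j<d \<gamma>. \<forall>k<d \<gamma>. vinner (Vinv (\<lambda>e. cscale (x e) (v \<gamma> j))) (\<Theta> a *\<^sub>v Vinv (\<lambda>e. cscale (x e) (v \<gamma> k)))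
     = t * cinner (v \<gamma> j) (\<pi> a (v \<gamma> k))"
proof -
  define u where "u j = Vinv (\<lambda>e. cscale (x e) (v \<gamma> j))" for j
  \<comment> \<open>The matrix of that isometry: its columns are the embedded vectors
    \<open>v \<gamma> j\<close>.\<close>
  define E where "E = mat N (d \<gamma>) (\<lambda>(r, j). u j $ r)"
  have E: "E \<in> carrier_mat N (d \<gamma>)" by (simp add: E_def)
  have ok: "cscale (x e) (v \<gamma> j) \<in> R (\<kappa> e)" if "e \<in> Z" "j < d \<gamma>" for e j
    using R_cscale[OF R_v[OF that(2)]] \<gamma>(2)[OF that(1)] by blast
  have u: "u j \<in> carrier_vec N" and Vu: "e \<in> Z \<Longrightarrow> V e (u j) = cscale (x e) (v \<gamma> j)" if "j < d \<gamma>" for j e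
    unfolding u_def using Vinv[of "\<lambda>e. cscale (x e) (v \<gamma> j)"] ok that by auto
  have Eu: "E *\<^sub>v unit_vec (d \<gamma>) j = u j" if "j < d \<gamma>" for j
    using that u[OF that] E by (intro eq_vecI) (auto simp: E_def)
  have entry: "(madj E * M * E) $$ (j, k) = vinner (u j) (M *\<^sub>v u k)"
    if "M \<in> carrier_mat N N" "j < d \<gamma>" "k < d \<gamma>" for M j k
  proof -
    have c: "madj E * M * E \<in> carrier_mat (d \<gamma>) (d \<gamma>)"
      by (rule mult_carrier_mat[OF mult_carrier_mat[OF madj_carrier[OF E] that(1)] E])
    have "(madj E * M * E) $$ (j, k) = vinner (unit_vec (d \<gamma>) j) ((madj E * M * E) *\<^sub>v unit_vec (d \<gamma>) k)"
      by (rule mat_entry_vinner[OF c that(2,3)])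
    also have "\<dots> = vinner (u j) (M *\<^sub>v u k)"
      using vinner_compress[OF that(1) E, of "unit_vec (d \<gamma>) j" "unit_vec (d \<gamma>) k"] Eu that by simp
    finally show ?thesis .
  qed
  have cT: "\<Theta> a \<in> carrier_mat N N" and cP: "\<phi> a \<in> carrier_mat N N" for a
    using cpT cp unfolding cp_map_def by auto
  have comp: "madj E * \<phi> a * E = \<psi> \<gamma> a" for a
  proof (rule eq_matI)
    fix j k assume "j < dim_row (\<psi> \<gamma> a)" "k < dim_col (\<psi> \<gamma> a)"
    then have jk: "j < d \<gamma>" "k < d \<gamma>" using stinespring \<gamma>(1) by auto
    have "(madj E * \<phi> a * E) $$ (j, k) = (\<Sum>e\<in>Z. cinner (V e (u j)) (\<pi> a (V e (u k))))"
      using entry[OF cP jk] V_dilation[OF u[OF jk(1)] u[OF jk(2)]] by simp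
    also have "\<dots> = (\<Sum>e\<in>Z. complex_of_real ((cmod (x e))\<^sup>2) * cinner (v \<gamma> j) (\<pi> a (v \<gamma> k)))"
      using jk Vu unfolding complex_norm_square
      by (intro sum.cong refl) (simp add: cinner_cscale_left cinner_cscale_right rep_cscale)
    also have "\<dots> = complex_of_real (\<Sum>e\<in>Z. (cmod (x e))\<^sup>2) * cinner (v \<gamma> j) (\<pi> a (v \<gamma> k))"
      by (simp add: sum_distrib_right)
    also have "\<dots> = \<psi> \<gamma> a $$ (j, k)" using x stinespring \<gamma>(1) jk by simp
    finally show "(madj E * \<phi> a * E) $$ (j, k) = \<psi> \<gamma> a $$ (j, k)" .
  qed (use stinespring \<gamma>(1) E in \<open>auto simp: madj_def\<close>)
  have cp1: "cp_map (d \<gamma>) (\<lambda>a. madj E * \<Theta> a * E)" by (rule cp_map_compress[OF cpT E])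
  have cp2: "cp_map (d \<gamma>) (\<psi> \<gamma>)" using pure \<gamma>(1) unfolding ucp_map_def by blast
  have "cp_map (d \<gamma>) (\<lambda>a. \<psi> \<gamma> a - madj E * \<Theta> a * E)"
  proof (rule cp_map_diffI[OF cp2 cp1])
    fix xs :: "('a \<times> complex vec) list" assume xs: "vec_list (d \<gamma>) xs"
    let ?ys = "map (apsnd ((*\<^sub>v) E)) xs"
    have "vec_list N ?ys" using xs E by auto
    from le[OF this] show "Re (cp_form (\<lambda>a. madj E * \<Theta> a * E) xs xs) \<le> Re (cp_form (\<psi> \<gamma>) xs xs)"
      using cp_form_compress[OF cp_map_linear[OF cpT] E xs xs] cp_form_compress[OF cp_map_linear[OF cp] E xs xs]
      by (simp add: comp)
  qed
  with cp1 pure \<gamma>(1) obtain t :: real where t: "(\<lambda>a. madj E * \<Theta> a * E) = (\<lambda>a. complex_of_real t \<cdot>\<^sub>m \<psi> \<gamma> a)"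
    unfolding pure_cp_def by metis
  have "vinner (u j) (\<Theta> a *\<^sub>v u k) = complex_of_real t * cinner (v \<gamma> j) (\<pi> a (v \<gamma> k))"
    if "j < d \<gamma>" "k < d \<gamma>" for a j k
    using entry[OF cT[of a] that] fun_cong[OF t, of a] stinespring \<gamma>(1) that by simp
  then show ?thesis unfolding u_def by blast
qed

text \<open>The factor for a direction \<open>x\<close> can be read off at \<open>a = 1\<close>,
  \<open>j = k = 0\<close>, where the inner product of \<open>v \<gamma> 0\<close> with itself is 1.
  Hence the difference of the two sides, as a form in \<open>x\<close>, has zero quadratic form, and
  polarization gives the entries with \<open>e \<noteq> f\<close> as well.\<close>

lemma pure_compression:
  assumes cpT: "cp_map N \<Theta>"
    and le: "\<And>xs. vec_list N xs \<Longrightarrow> Re (cp_form \<Theta> xs xs) \<le> Re (cp_form \<phi> xs xs)"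
    and \<gamma>: "\<gamma> < L" "\<And>e. e \<in> Z \<Longrightarrow> R \<gamma> \<subseteq> R (\<kappa> e)"
    and jk: "j < d \<gamma>" "k < d \<gamma>" and ef: "e \<in> Z" "f \<in> Z"
  shows "vinner (Vinv (dl e (v \<gamma> j))) (\<Theta> a *\<^sub>v Vinv (dl f (v \<gamma> k)))
     = vinner (Vinv (dl e (v \<gamma> 0))) (\<Theta> 1 *\<^sub>v Vinv (dl f (v \<gamma> 0))) * cinner (v \<gamma> j) (\<pi> a (v \<gamma> k))"
proof -
  define G where "G a j k e f = vinner (Vinv (dl e (v \<gamma> j))) (\<Theta> a *\<^sub>v Vinv (dl f (v \<gamma> k)))" for a j k e f
  have cT: "\<Theta> a \<in> carrier_mat N N" for a using cpT unfolding cp_map_def by auto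
  have vin: "v \<gamma> j \<in> \<Inter>(R ` \<kappa> ` Z)" if "j < d \<gamma>" for j
    using R_v[OF that] \<gamma>(2) by auto
  have expand: "vinner (Vinv (\<lambda>e. cscale (x e) (v \<gamma> j))) (\<Theta> a *\<^sub>v Vinv (\<lambda>e. cscale (x e) (v \<gamma> k)))
      = (\<Sum>e\<in>Z. \<Sum>f\<in>Z. cnj (x e) * x f * G a j k e f)" if "j < d \<gamma>" "k < d \<gamma>" for a j k x
    unfolding G_def by (rule vinner_Vinv_expand[OF cT vin[OF that(1)] vin[OF that(2)]])
  have d0: "0 < d \<gamma>" by (rule d_pos[OF \<gamma>(1)])
  have v00: "cinner (v \<gamma> 0) (\<pi> 1 (v \<gamma> 0)) = 1" using v_inner[OF \<gamma>(1) d0 d0] by simp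
  have "(\<Sum>e\<in>Z. \<Sum>f\<in>Z. cnj (x e) * x f * (G a j k e f - G 1 0 0 e f * cinner (v \<gamma> j) (\<pi> a (v \<gamma> k)))) = 0" for x
  proof (cases "(\<Sum>e\<in>Z. (cmod (x e))\<^sup>2) = 0")
    case True
    then have "x e = 0" if "e \<in> Z" for e
      using that fin by (subst (asm) sum_nonneg_eq_0_iff) auto
    then show ?thesis by simp
  next
    case False
    define s where "s = (\<Sum>e\<in>Z. (cmod (x e))\<^sup>2)"
    have s: "0 < s" using False unfolding s_def by (simp add: sum_nonneg order_less_le)
    define y where "y e = x e / complex_of_real (sqrt s)" for e
    have "(\<Sum>e\<in>Z. (cmod (y e))\<^sup>2) = s / s"
      unfolding y_def using s by (simp add: norm_divide power_divide sum_divide_distrib[symmetric] s_def[symmetric])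
    with s have "(\<Sum>e\<in>Z. (cmod (y e))\<^sup>2) = 1" by simp
    from pure_compression_normalized[OF cpT le \<gamma> this] obtain t where
      t0: "\<forall>a. \<forall>j<d \<gamma>. \<forall>k<d \<gamma>. vinner (Vinv (\<lambda>e. cscale (y e) (v \<gamma> j))) (\<Theta> a *\<^sub>v Vinv (\<lambda>e. cscale (y e) (v \<gamma> k)))
         = t * cinner (v \<gamma> j) (\<pi> a (v \<gamma> k))" ..
    have t: "(\<Sum>e\<in>Z. \<Sum>f\<in>Z. cnj (y e) * y f * G a j k e f) = t * cinner (v \<gamma> j) (\<pi> a (v \<gamma> k))"
      if "j < d \<gamma>" "k < d \<gamma>" for a j k
      using t0[rule_format, OF that, of a] expand[OF that, of y a] by (simp only:)
    have xy: "cnj (x e) * x f = complex_of_real s * (cnj (y e) * y f)" for e f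
    proof -
      have "complex_of_real (sqrt s) * complex_of_real (sqrt s) = complex_of_real s"
        using s by (simp flip: of_real_mult)
      moreover have "complex_of_real (sqrt s) \<noteq> 0" using s by simp
      ultimately show ?thesis unfolding y_def by (simp add: field_simps)
    qed
    have sc: "(\<Sum>e\<in>Z. \<Sum>f\<in>Z. cnj (x e) * x f * F e f) = complex_of_real s * (\<Sum>e\<in>Z. \<Sum>f\<in>Z. cnj (y e) * y f * F e f)" for F
      unfolding xy by (simp add: sum_distrib_left mult.assoc)
    have "(\<Sum>e\<in>Z. \<Sum>f\<in>Z. cnj (y e) * y f * (G a j k e f - G 1 0 0 e f * cinner (v \<gamma> j) (\<pi> a (v \<gamma> k))))
       = (\<Sum>e\<in>Z. \<Sum>f\<in>Z. cnj (y e) * y f * G a j k e f)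
         - (\<Sum>e\<in>Z. \<Sum>f\<in>Z. cnj (y e) * y f * G 1 0 0 e f) * cinner (v \<gamma> j) (\<pi> a (v \<gamma> k))"
      by (simp add: sum_distrib_right right_diff_distrib sum_subtractf mult.assoc)
    also have "\<dots> = 0" using t[OF jk] t[OF d0 d0] v00 by simp
    finally show ?thesis unfolding sc by simp
  qed
  from polarization_zero[OF fin this ef] show ?thesis unfolding G_def by simp
qed

lemma psd_Vinv:
  assumes cpT: "cp_map N \<Theta>" and z: "z \<in> \<Inter>(R ` \<kappa> ` Z)"
  shows "psd_form Z (\<lambda>e f. vinner (Vinv (dl e z)) (\<Theta> 1 *\<^sub>v Vinv (dl f z)))"
  unfolding psd_form_def
proof
  fix x
  have cT: "\<Theta> 1 \<in> carrier_mat N N" using cpT unfolding cp_map_def by auto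
  have "Vinv (\<lambda>e. cscale (x e) z) \<in> carrier_vec N" using z by (intro Vinv(1)) (auto intro: R_cscale)
  with cp_form_nonneg[OF cpT, of "[(1, Vinv (\<lambda>e. cscale (x e) z))]"] vinner_Vinv_expand[OF cT z z, of x x]
  show "Im (\<Sum>e\<in>Z. \<Sum>f\<in>Z. cnj (x e) * x f * vinner (Vinv (dl e z)) (\<Theta> 1 *\<^sub>v Vinv (dl f z))) = 0
     \<and> 0 \<le> Re (\<Sum>e\<in>Z. \<Sum>f\<in>Z. cnj (x e) * x f * vinner (Vinv (dl e z)) (\<Theta> 1 *\<^sub>v Vinv (dl f z)))"
    by (simp add: cp_form_single)
qed

text \<open>Any list is approximated in the dilation norm by lists with vectors
  \<open>Vinv (dl e (v \<gamma> j))\<close>: minimality of the single map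
  \<open>\<psi> \<gamma>\<close> is applied to each component separately, and \<open>dl\<close> puts
  the approximant back into that component. \<open>diff\<close> and \<open>bound\<close> express
  linearity and continuity without passing to a quotient or a completion.\<close>

lemma density_zero:
  assumes \<gamma>: "\<gamma> < L" "\<And>e. e \<in> Z \<Longrightarrow> R \<gamma> \<subseteq> R (\<kappa> e)"
    and diff: "\<And>xs ys. vec_list N xs \<Longrightarrow> vec_list N ys \<Longrightarrow>
        F (xs @ map (apfst (cscale (-1))) ys) = F xs - F ys"
    and bound: "\<And>xs. vec_list N xs \<Longrightarrow> cmod (F xs) \<le> C * (\<Sum>e\<in>Z. norm (VL e xs))"
    and good: "\<And>xs. \<forall>x\<in>set xs. \<exists>e\<in>Z. \<exists>j<d \<gamma>. snd x = Vinv (dl e (v \<gamma> j)) \<Longrightarrow> F xs = 0"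
    and C: "0 \<le> C" and xs: "vec_list N xs"
  shows "F xs = 0"
proof -
  have eps: "cmod (F xs) \<le> C * real (card Z) * \<epsilon>" if \<epsilon>: "0 < \<epsilon>" for \<epsilon>
  proof -
    have "\<exists>ps. (\<forall>p\<in>set ps. snd p < d \<gamma>) \<and> norm (VL e xs - (\<Sum>p\<leftarrow>ps. \<pi> (fst p) (v \<gamma> (snd p)))) < \<epsilon>" for e
      by (rule minimal_approx[OF \<gamma>(1) \<epsilon>, of "VL e xs"]) blast
    then obtain ps where ps: "\<And>e. \<forall>p\<in>set (ps e). snd p < d \<gamma>"
      "\<And>e. norm (VL e xs - (\<Sum>p\<leftarrow>ps e. \<pi> (fst p) (v \<gamma> (snd p)))) < \<epsilon>" by metis
    obtain es where es: "set es = Z" "distinct es" using finite_distinct_list[OF fin] by blast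
    define ys where "ys = concat (map (\<lambda>e. map (\<lambda>p. (fst p, Vinv (dl e (v \<gamma> (snd p))))) (ps e)) es)"
    have vR: "v \<gamma> j \<in> R (\<kappa> e)" if "j < d \<gamma>" "e \<in> Z" for j e using R_v[OF that(1)] \<gamma>(2)[OF that(2)] by blast
    have gd: "\<forall>x\<in>set ys. \<exists>e\<in>Z. \<exists>j<d \<gamma>. snd x = Vinv (dl e (v \<gamma> j))"
      unfolding ys_def using ps(1) es(1) by fastforce
    then have ys: "vec_list N ys" using Vinv_dl(1) vR by fastforce
    have VLy: "VL e ys = (\<Sum>p\<leftarrow>ps e. \<pi> (fst p) (v \<gamma> (snd p)))" if e: "e \<in> Z" for e
    proof -
      have "VL e ys = (\<Sum>f\<leftarrow>es. \<Sum>p\<leftarrow>ps f. \<pi> (fst p) (V e (Vinv (dl f (v \<gamma> (snd p))))))"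
        unfolding VL_def ys_def by (simp add: map_concat sum_list_concat o_def)
      also have "\<dots> = (\<Sum>f\<leftarrow>es. if f = e then (\<Sum>p\<leftarrow>ps f. \<pi> (fst p) (v \<gamma> (snd p))) else 0)"
      proof (intro arg_cong[of _ _ sum_list] map_cong refl)
        fix f assume "f \<in> set es"
        then have f: "f \<in> Z" using es by simp
        have "(\<Sum>p\<leftarrow>ps f. \<pi> (fst p) (V e (Vinv (dl f (v \<gamma> (snd p))))))
            = (\<Sum>p\<leftarrow>ps f. if f = e then \<pi> (fst p) (v \<gamma> (snd p)) else 0)"
          using ps(1) e f by (intro arg_cong[of _ _ sum_list] map_cong refl) (auto simp: Vinv_dl(2)[OF vR])
        then show "(\<Sum>p\<leftarrow>ps f. \<pi> (fst p) (V e (Vinv (dl f (v \<gamma> (snd p))))))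
            = (if f = e then (\<Sum>p\<leftarrow>ps f. \<pi> (fst p) (v \<gamma> (snd p))) else 0)" by simp
      qed
      also have "\<dots> = (\<Sum>f\<in>Z. if f = e then (\<Sum>p\<leftarrow>ps f. \<pi> (fst p) (v \<gamma> (snd p))) else 0)"
        unfolding es(1)[symmetric] by (rule sum_list_distinct_conv_sum_set[OF es(2)])
      finally show ?thesis using e fin by simp
    qed
    let ?zs = "xs @ map (apfst (cscale (-1))) ys"
    have "F xs = F ?zs" using diff[OF xs ys] good[OF gd] by simp
    moreover have "vec_list N ?zs" using xs ys by auto
    ultimately have "cmod (F xs) \<le> C * (\<Sum>e\<in>Z. norm (VL e ?zs))" using bound[of ?zs] by simp
    also have "\<dots> \<le> C * (\<Sum>e\<in>Z. \<epsilon>)"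
      using ps(2) VLy by (intro mult_left_mono sum_mono C) (auto simp: VL_append VL_neg less_imp_le)
    finally show ?thesis by (simp add: mult.assoc)
  qed
  have "cmod (F xs) \<le> 0"
  proof (rule field_le_epsilon)
    fix \<delta> :: real assume "0 < \<delta>"
    \<comment> \<open>The added 1 permits division also when \<open>C\<close> is zero.\<close>
    have K: "0 < C * real (card Z) + 1" using C by (simp add: add_nonneg_pos)
    have "cmod (F xs) \<le> C * real (card Z) * (\<delta> / (C * real (card Z) + 1))"
      using \<open>0 < \<delta>\<close> K by (intro eps) simp
    also have "\<dots> \<le> (C * real (card Z) + 1) * (\<delta> / (C * real (card Z) + 1))"
      using \<open>0 < \<delta>\<close> K by (intro mult_right_mono) auto
    finally show "cmod (F xs) \<le> 0 + \<delta>" using K by simp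
  qed
  then show ?thesis by simp
qed

text \<open>The form of \<open>D \<otimes> 1\<close> on the dilation space, to be identified with
  \<open>cp_form \<Theta>\<close>.\<close>

definition QD :: "('l \<Rightarrow> 'l \<Rightarrow> complex) \<Rightarrow> ('a \<times> complex vec) list \<Rightarrow> ('a \<times> complex vec) list \<Rightarrow> complex" where
  "QD D xs ys = (\<Sum>e\<in>Z. \<Sum>f\<in>Z. D e f * cinner (VL e xs) (VL f ys))"

lemma QD_lists:
  "QD D xs ys = (\<Sum>x\<leftarrow>xs. \<Sum>y\<leftarrow>ys. \<Sum>e\<in>Z. \<Sum>f\<in>Z.
      D e f * cinner (\<pi> (fst x) (V e (snd x))) (\<pi> (fst y) (V f (snd y))))"
  unfolding sum_list_sum_list_sum QD_def VL_def sum_list_cinner[symmetric]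
  by (simp add: sum_list_const_mult)

lemma QD_bound: "\<exists>C\<ge>0. \<forall>xs. cmod (QD D xs ys) \<le> C * (\<Sum>e\<in>Z. norm (VL e xs))"
proof -
  define c where "c e = (\<Sum>f\<in>Z. cmod (D e f) * norm (VL f ys))" for e
  have c0: "0 \<le> c e" for e unfolding c_def by (intro sum_nonneg) auto
  have "cmod (QD D xs ys) \<le> (\<Sum>e\<in>Z. c e) * (\<Sum>e\<in>Z. norm (VL e xs))" for xs
  proof -
    have "cmod (QD D xs ys) \<le> (\<Sum>e\<in>Z. \<Sum>f\<in>Z. cmod (D e f) * (norm (VL e xs) * norm (VL f ys)))"
      unfolding QD_def by (intro sum_norm_le) (auto simp: norm_mult intro!: mult_left_mono cinner_Cauchy_Schwarz)
    also have "\<dots> = (\<Sum>e\<in>Z. c e * norm (VL e xs))"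
      unfolding c_def by (simp add: sum_distrib_left mult_ac)
    also have "\<dots> \<le> (\<Sum>e\<in>Z. (\<Sum>e\<in>Z. c e) * norm (VL e xs))"
      using c0 fin by (intro sum_mono mult_right_mono member_le_sum) auto
    finally show ?thesis by (simp add: sum_distrib_left)
  qed
  moreover have "0 \<le> (\<Sum>e\<in>Z. c e)" using c0 by (rule sum_nonneg)
  ultimately show ?thesis by blast
qed

text \<open>Cauchy-Schwarz for \<open>\<Theta>\<close> leaves the seminorm of
  \<open>\<Theta>\<close> in the first argument. Domination by \<open>\<phi>\<close> bounds it by
  the dilation norm, the only norm in which approximation is possible.\<close>

lemma cp_form_bound:
  assumes cpT: "cp_map N \<Theta>"
    and le: "\<And>xs. vec_list N xs \<Longrightarrow> Re (cp_form \<Theta> xs xs) \<le> Re (cp_form \<phi> xs xs)"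
    and ys: "vec_list N ys"
  shows "\<exists>C\<ge>0. \<forall>xs. (vec_list N xs) \<longrightarrow> cmod (cp_form \<Theta> xs ys) \<le> C * (\<Sum>e\<in>Z. norm (VL e xs))"
proof -
  define K where "K = Re (cp_form \<Theta> ys ys)"
  have K: "0 \<le> K" unfolding K_def by (rule cp_form_nonneg[OF cpT ys])
  have "cmod (cp_form \<Theta> xs ys) \<le> sqrt K * (\<Sum>e\<in>Z. norm (VL e xs))" if xs: "vec_list N xs" for xs
  proof -
    have "(cmod (cp_form \<Theta> xs ys))\<^sup>2 \<le> Re (cp_form \<Theta> xs xs) * K"
      unfolding K_def by (rule cp_form_Cauchy_Schwarz[OF cpT xs ys])
    also have "\<dots> \<le> Re (cp_form \<phi> xs xs) * K" by (intro mult_right_mono le xs K)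
    also have "Re (cp_form \<phi> xs xs) = (\<Sum>e\<in>Z. (norm (VL e xs))\<^sup>2)"
      using cp_form_dilation[OF xs xs] by (simp add: cinner_self_norm)
    finally have "cmod (cp_form \<Theta> xs ys) \<le> sqrt ((\<Sum>e\<in>Z. (norm (VL e xs))\<^sup>2) * K)"
      by (rule real_le_rsqrt)
    also have "\<dots> = sqrt K * L2_set (\<lambda>e. norm (VL e xs)) Z" by (simp add: L2_set_def real_sqrt_mult)
    also have "\<dots> \<le> sqrt K * (\<Sum>e\<in>Z. norm (VL e xs))" using K by (intro mult_left_mono L2_set_le_sum) auto
    finally show ?thesis .
  qed
  then show ?thesis using K by (intro exI[of _ "sqrt K"]) auto
qed

text \<open>An Arveson-type Radon-Nikodym theorem. Purity determines the form on vectors with all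
  components in the smallest space of the nest, and by minimality these generate a dense subspace.\<close>
lemma radon_nikodym:
  assumes cpT: "cp_map N \<Theta>"
    and le: "\<And>xs. vec_list N xs \<Longrightarrow> Re (cp_form \<Theta> xs xs) \<le> Re (cp_form \<phi> xs xs)"
  obtains D where "psd_form Z D"
    "\<And>a h k. h \<in> carrier_vec N \<Longrightarrow> k \<in> carrier_vec N \<Longrightarrow>
      vinner h (\<Theta> a *\<^sub>v k) = (\<Sum>e\<in>Z. \<Sum>f\<in>Z. D e f * cinner (V e h) (\<pi> a (V f k)))"
proof (cases "Z = {}")
  case True
  \<comment> \<open>With no components \<open>V_inner\<close> makes every inner product
    zero.\<close>
  have "N = 0"
  proof (rule ccontr)
    assume "N \<noteq> 0"
    then have "vinner (unit_vec N 0) (unit_vec N 0) = 1" by (subst vinner_unit) auto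
    moreover have "vinner (unit_vec N 0) (unit_vec N 0) = 0" using True by (subst V_inner) auto
    ultimately show False by simp
  qed
  moreover have "dim_row (\<Theta> a) = N" for a using cpT unfolding cp_map_def by auto
  ultimately have "vinner h (\<Theta> a *\<^sub>v k) = 0" for a h k by (simp add: vinner_def)
  then show thesis using that[of "\<lambda>_ _. 0"] True by (simp add: psd_form_def)
next
  case False
  obtain \<gamma> where \<gamma>: "\<gamma> < L" "\<And>e. e \<in> Z \<Longrightarrow> R \<gamma> \<subseteq> R (\<kappa> e)" using smallest_range[OF False] by blast
  \<comment> \<open>The scalar that \<open>pure_compression\<close> extracts from the components
    \<open>e\<close> and \<open>f\<close>.\<close>
  define D where "D e f = vinner (Vinv (dl e (v \<gamma> 0))) (\<Theta> 1 *\<^sub>v Vinv (dl f (v \<gamma> 0)))" for e f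
  have vR: "v \<gamma> j \<in> R (\<kappa> e)" if "j < d \<gamma>" "e \<in> Z" for j e using R_v[OF that(1)] \<gamma>(2)[OF that(2)] by blast
  have psd: "psd_form Z D"
    unfolding D_def using vR[OF d_pos[OF \<gamma>(1)]] by (intro psd_Vinv[OF cpT]) auto
  define H where "H xs ys = cp_form \<Theta> xs ys - QD D xs ys" for xs ys
  let ?ok = "\<lambda>xs :: ('a \<times> complex vec) list. vec_list N xs"
  let ?gd = "\<lambda>xs :: ('a \<times> complex vec) list. \<forall>x\<in>set xs. \<exists>e\<in>Z. \<exists>j<d \<gamma>. snd x = Vinv (dl e (v \<gamma> j))"
  have gd_ok: "?ok xs" if "?gd xs" for xs using that Vinv_dl(1) vR by fastforce
  have H_good: "H xs ys = 0" if "?gd xs" "?gd ys" for xs ys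
  proof -
    have "vinner (snd x) (\<Theta> (cstar (fst x) * fst y) *\<^sub>v snd y)
        = (\<Sum>e\<in>Z. \<Sum>f\<in>Z. D e f * cinner (\<pi> (fst x) (V e (snd x))) (\<pi> (fst y) (V f (snd y))))"
      if xy: "x \<in> set xs" "y \<in> set ys" for x y
    proof -
      from xy \<open>?gd xs\<close> \<open>?gd ys\<close> obtain e j f k where e: "e \<in> Z" "j < d \<gamma>" "snd x = Vinv (dl e (v \<gamma> j))"
        and f: "f \<in> Z" "k < d \<gamma>" "snd y = Vinv (dl f (v \<gamma> k))" by blast
      have "(\<Sum>e'\<in>Z. \<Sum>f'\<in>Z. D e' f' * cinner (\<pi> (fst x) (V e' (snd x))) (\<pi> (fst y) (V f' (snd y))))
          = (\<Sum>e'\<in>Z. \<Sum>f'\<in>Z. if f' = f then (if e' = e then D e f * cinner (\<pi> (fst x) (v \<gamma> j)) (\<pi> (fst y) (v \<gamma> k)) else 0) else 0)"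
        unfolding e(3) f(3)
        by (intro sum.cong refl) (simp add: Vinv_dl(2)[OF vR[OF e(2,1)]] Vinv_dl(2)[OF vR[OF f(2,1)]])
      also have "\<dots> = D e f * cinner (\<pi> (fst x) (v \<gamma> j)) (\<pi> (fst y) (v \<gamma> k))"
        using fin e(1) f(1) by simp
      also have "\<dots> = vinner (snd x) (\<Theta> (cstar (fst x) * fst y) *\<^sub>v snd y)"
        using pure_compression[OF cpT le \<gamma> e(2) f(2) e(1) f(1), of "cstar (fst x) * fst y"]
        unfolding e(3) f(3) D_def by (simp add: rep_mult rep_adj')
      finally show ?thesis by simp
    qed
    then have "cp_form \<Theta> xs ys = QD D xs ys"
      unfolding cp_form_def QD_lists by (intro arg_cong[of _ _ sum_list] map_cong refl) auto
    then show ?thesis unfolding H_def by simp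
  qed
  have H_cnj: "H ys xs = cnj (H xs ys)" if "?ok xs" "?ok ys" for xs ys
  proof -
    have "QD D ys xs = (\<Sum>f\<in>Z. \<Sum>e\<in>Z. D e f * cinner (VL e ys) (VL f xs))" unfolding QD_def by (rule sum.swap)
    also have "\<dots> = (\<Sum>f\<in>Z. \<Sum>e\<in>Z. cnj (D f e * cinner (VL f xs) (VL e ys)))"
    proof (intro sum.cong refl)
      fix e f assume "e \<in> Z" "f \<in> Z"
      with psd_form_hermitian[OF fin psd, of f e] cinner_cnj[of "VL e ys" "VL f xs"]
      show "D e f * cinner (VL e ys) (VL f xs) = cnj (D f e * cinner (VL f xs) (VL e ys))" by simp
    qed
    finally have "QD D ys xs = cnj (QD D xs ys)" unfolding QD_def by simp
    with cp_form_cnj[OF cpT that] show ?thesis unfolding H_def by simp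
  qed
  have H_diff: "H (xs @ map (apfst (cscale (-1))) zs) ys = H xs ys - H zs ys" if "?ok ys" for xs zs ys
    using cp_form_scale_left[OF cp_map_linear[OF cpT] that, of "-1" zs]
    unfolding H_def QD_def VL_append VL_neg cp_form_append_left
    by (simp add: cinner_diff_left sum_subtractf right_diff_distrib)
  have H_bound: "\<exists>C\<ge>0. \<forall>xs. ?ok xs \<longrightarrow> cmod (H xs ys) \<le> C * (\<Sum>e\<in>Z. norm (VL e xs))" if ok: "?ok ys" for ys
  proof -
    obtain C1 where C1: "C1 \<ge> 0" "\<And>xs. ?ok xs \<Longrightarrow> cmod (cp_form \<Theta> xs ys) \<le> C1 * (\<Sum>e\<in>Z. norm (VL e xs))"
      using cp_form_bound[OF cpT le ok] by blast
    obtain C2 where C2: "C2 \<ge> 0" "\<And>xs. cmod (QD D xs ys) \<le> C2 * (\<Sum>e\<in>Z. norm (VL e xs))"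
      using QD_bound[of D ys] by blast
    have "cmod (H xs ys) \<le> (C1 + C2) * (\<Sum>e\<in>Z. norm (VL e xs))" if "?ok xs" for xs
      using C1(2)[OF that] C2(2)[of xs] norm_triangle_ineq4[of "cp_form \<Theta> xs ys" "QD D xs ys"]
      unfolding H_def by (simp add: distrib_right)
    with C1 C2 show ?thesis by (intro exI[of _ "C1 + C2"]) auto
  qed
  \<comment> \<open>Density is applied in one argument at a time: here the second list is still a
    test list. Hermitian symmetry \<open>H_cnj\<close> then exchanges the roles, and a second
    application frees the other argument.\<close>
  have H_left: "H xs ys = 0" if xy: "?ok xs" "?gd ys" for xs ys
  proof -
    obtain C where C: "C \<ge> 0" "\<And>xs. ?ok xs \<Longrightarrow> cmod (H xs ys) \<le> C * (\<Sum>e\<in>Z. norm (VL e xs))"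
      using H_bound[OF gd_ok[OF xy(2)]] by blast
    show ?thesis
      by (rule density_zero[OF \<gamma>, of "\<lambda>xs. H xs ys" C])
        (use C xy H_good H_diff[OF gd_ok[OF xy(2)]] in auto)
  qed
  have H_zero: "H xs ys = 0" if xy: "?ok xs" "?ok ys" for xs ys
  proof -
    obtain C where C: "C \<ge> 0" "\<And>xs. ?ok xs \<Longrightarrow> cmod (H xs ys) \<le> C * (\<Sum>e\<in>Z. norm (VL e xs))"
      using H_bound[OF xy(2)] by blast
    have gd0: "H zs ys = 0" if "?gd zs" for zs
      using H_cnj[OF \<open>?ok ys\<close> gd_ok[OF that]] H_left[OF \<open>?ok ys\<close> that] by simp
    show ?thesis
      by (rule density_zero[OF \<gamma>, of "\<lambda>xs. H xs ys" C])
        (use C xy gd0 H_diff[OF xy(2)] in auto)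
  qed
  have "vinner h (\<Theta> a *\<^sub>v k) = (\<Sum>e\<in>Z. \<Sum>f\<in>Z. D e f * cinner (V e h) (\<pi> a (V f k)))"
    if "h \<in> carrier_vec N" "k \<in> carrier_vec N" for a h k
    using H_zero[of "[(1, h)]" "[(a, k)]"] that unfolding H_def
    by (simp add: cp_form_single QD_def VL_def)
  with psd show thesis by (rule that)
qed

end

section \<open>Instruments with spectral POVM marginal\<close>

text \<open>For \<open>e\<close> in the range of \<open>p\<close>, the coordinate
  \<open>e $ j\<close> is the inner product of \<open>p u_j\<close> with \<open>e\<close>, so
  Cauchy-Schwarz bounds its square by the \<open>j\<close>-th diagonal entry times the squared norm
  of \<open>e\<close>. Summing over \<open>j\<close> gives the claim without computing a
  rank.\<close>

lemma projection_trace_ge_1: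
  assumes p: "p \<in> carrier_mat n n" "p * p = p" "madj p = p" and nz: "p \<noteq> 0\<^sub>m n n"
  shows "1 \<le> (\<Sum>j<n. Re (vinner (unit_vec n j) (p *\<^sub>v unit_vec n j)))"
proof -
  have pp: "p *\<^sub>v (p *\<^sub>v k) = p *\<^sub>v k" if "k \<in> carrier_vec n" for k
    using assoc_mult_mat_vec[OF p(1) p(1) that] p(2) by simp
  have adj: "vinner h (p *\<^sub>v k) = vinner (p *\<^sub>v h) k" if "h \<in> carrier_vec n" "k \<in> carrier_vec n" for h k
    using vinner_madj[OF p(1) that] p(3) by simp
  have "\<exists>k\<in>carrier_vec n. p *\<^sub>v k \<noteq> 0\<^sub>v n"
  proof (rule ccontr)
    assume "\<not> ?thesis"
    then have "p = 0\<^sub>m n n"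
      using p(1) by (intro mat_eq_vinnerI[of _ n]) (auto simp: vinner_def scalar_prod_def)
    with nz show False by simp
  qed
  then obtain k where k: "k \<in> carrier_vec n" "p *\<^sub>v k \<noteq> 0\<^sub>v n" by blast
  define e where "e = p *\<^sub>v k"
  have e: "e \<in> carrier_vec n" "p *\<^sub>v e = e" "e \<noteq> 0\<^sub>v n" using k p(1) pp by (auto simp: e_def)
  define s where "s = Re (vinner e e)"
  have "0 \<le> s" unfolding s_def vinner_self by (rule sum_nonneg) simp
  moreover have "s \<noteq> 0" using vinner_self_eq_zero[of e n] e vinner_self(1)[of e] by (auto simp: s_def complex_eq_iff)
  ultimately have s: "0 < s" by simp
  have "s = (\<Sum>j<n. (cmod (e $ j))\<^sup>2)" unfolding s_def vinner_self using e(1) by simp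
  also have "\<dots> \<le> (\<Sum>j<n. Re (vinner (unit_vec n j) (p *\<^sub>v unit_vec n j)) * s)"
  proof (rule sum_mono)
    fix j assume "j \<in> {..<n}"
    then have "e $ j = vinner (unit_vec n j) (p *\<^sub>v e)" using vinner_unit[OF e(1)] e(2) by simp
    also have "\<dots> = vinner (p *\<^sub>v unit_vec n j) e" using adj e(1) by simp
    finally have "(cmod (e $ j))\<^sup>2 \<le> Re (vinner (p *\<^sub>v unit_vec n j) (p *\<^sub>v unit_vec n j)) * s"
      unfolding s_def using vinner_Cauchy_Schwarz[of "p *\<^sub>v unit_vec n j" n e] p(1) e(1) by simp
    also have "vinner (p *\<^sub>v unit_vec n j) (p *\<^sub>v unit_vec n j) = vinner (unit_vec n j) (p *\<^sub>v unit_vec n j)"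
      using adj[of "unit_vec n j" "p *\<^sub>v unit_vec n j"] pp[of "unit_vec n j"] p(1) by simp
    finally show "(cmod (e $ j))\<^sup>2 \<le> Re (vinner (unit_vec n j) (p *\<^sub>v unit_vec n j)) * s" .
  qed
  finally have "s \<le> (\<Sum>j<n. Re (vinner (unit_vec n j) (p *\<^sub>v unit_vec n j))) * s" by (simp add: sum_distrib_right)
  with s show ?thesis by simp
qed

lemma cp_instrument_carrier: "cp_instrument X N I \<Longrightarrow> A \<in> sets X \<Longrightarrow> I A a \<in> carrier_mat N N"
  unfolding cp_instrument_def cp_map_def by blast

lemma cp_instrument_sums:
  assumes "cp_instrument X N I" "h \<in> carrier_vec N" "k \<in> carrier_vec N" "range F \<subseteq> sets X" "disjoint_family F"
  shows "(\<lambda>n. vinner h (I (F n) a *\<^sub>v k)) sums vinner h (I (\<Union>n. F n) a *\<^sub>v k)"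
  using assms unfolding cp_instrument_def by blast

text \<open>Countable additivity on the sequence of empty sets makes a constant series
  summable.\<close>

lemma cp_instrument_empty:
  assumes "cp_instrument X N I" "h \<in> carrier_vec N" "k \<in> carrier_vec N"
  shows "vinner h (I {} a *\<^sub>v k) = 0"
proof -
  have "summable (\<lambda>n::nat. vinner h (I {} a *\<^sub>v k))"
    using cp_instrument_sums[OF assms, of "\<lambda>_. {}" a] by (simp add: sums_iff disjoint_family_on_def)
  then show ?thesis by (simp add: summable_const_iff)
qed

lemma cp_instrument_Un:
  assumes I: "cp_instrument X N I" and hk: "h \<in> carrier_vec N" "k \<in> carrier_vec N"
    and AB: "A \<in> sets X" "B \<in> sets X" "A \<inter> B = {}"
  shows "vinner h (I (A \<union> B) a *\<^sub>v k) = vinner h (I A a *\<^sub>v k) + vinner h (I B a *\<^sub>v k)"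
proof -
  define F where "F n = (if n = 0 then A else if n = (1::nat) then B else {})" for n
  have "range F \<subseteq> sets X" "disjoint_family F" "(\<Union>n. F n) = A \<union> B"
    using AB by (auto simp: F_def disjoint_family_on_def split: if_splits)
  then have "(\<lambda>n. vinner h (I (F n) a *\<^sub>v k)) sums vinner h (I (A \<union> B) a *\<^sub>v k)"
    using cp_instrument_sums[OF I hk, of F a] by simp
  moreover have "(\<lambda>n. vinner h (I (F n) a *\<^sub>v k)) sums (\<Sum>n\<in>{0, 1}. vinner h (I (F n) a *\<^sub>v k))"
    by (rule sums_finite) (auto simp: F_def cp_instrument_empty[OF I hk])
  ultimately have "vinner h (I (A \<union> B) a *\<^sub>v k) = (\<Sum>n\<in>{0, 1}. vinner h (I (F n) a *\<^sub>v k))" by (rule sums_unique2)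
  then show ?thesis by (simp add: F_def)
qed

lemma cp_instrument_compress:
  assumes J: "cp_instrument X N J" and T: "T \<in> carrier_mat N N"
  shows "cp_instrument X N (\<lambda>A a. madj T * J A a * T)"
  unfolding cp_instrument_def
proof (intro conjI ballI allI impI)
  show "cp_map N (\<lambda>a. madj T * J A a * T)" if "A \<in> sets X" for A
    using J that T unfolding cp_instrument_def by (intro cp_map_compress) auto
  fix a and h k :: "complex vec" and F :: "nat \<Rightarrow> _ set"
  assume hk: "h \<in> carrier_vec N" "k \<in> carrier_vec N" and F: "range F \<subseteq> sets X" "disjoint_family F"
  have "(\<lambda>n. vinner (T *\<^sub>v h) (J (F n) a *\<^sub>v (T *\<^sub>v k))) sums vinner (T *\<^sub>v h) (J (\<Union>n. F n) a *\<^sub>v (T *\<^sub>v k))"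
    using T hk F by (intro cp_instrument_sums[OF J]) auto
  moreover have "vinner h ((madj T * J A a * T) *\<^sub>v k) = vinner (T *\<^sub>v h) (J A a *\<^sub>v (T *\<^sub>v k))" if "A \<in> sets X" for A
    by (rule vinner_compress[OF cp_instrument_carrier[OF J that] T hk])
  moreover have "F n \<in> sets X" "(\<Union>n. F n) \<in> sets X" for n using F by auto
  ultimately show "(\<lambda>n. vinner h ((madj T * J (F n) a * T) *\<^sub>v k)) sums vinner h ((madj T * J (\<Union>n. F n) a * T) *\<^sub>v k)"
    by simp
qed

locale spectral_instrument =
  fixes X :: "'x measure" and N :: nat and I :: "'x set \<Rightarrow> 'a::cstar_algebra \<Rightarrow> complex mat"
  assumes ucp: "ucp_instrument X N I"
    and spectral: "\<forall>A\<in>sets X. I A 1 * I A 1 = I A 1 \<and> madj (I A 1) = I A 1"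
begin

lemma instr: "cp_instrument X N I" using ucp unfolding ucp_instrument_def by blast

lemma carrier: "A \<in> sets X \<Longrightarrow> I A a \<in> carrier_mat N N"
  by (rule cp_instrument_carrier[OF instr])

abbreviation m :: "'x set \<Rightarrow> complex vec \<Rightarrow> complex vec \<Rightarrow> complex" where
  "m A h k \<equiv> vinner h (I A 1 *\<^sub>v k)"

lemma m_space: "h \<in> carrier_vec N \<Longrightarrow> k \<in> carrier_vec N \<Longrightarrow> m (space X) h k = vinner h k"
  using ucp unfolding ucp_instrument_def by simp

lemma mu_vec: "A \<in> sets X \<Longrightarrow> k \<in> carrier_vec N \<Longrightarrow> I A 1 *\<^sub>v k \<in> carrier_vec N"
  using carrier by (rule mult_mat_vec_carrier)

lemma mu_idem: "A \<in> sets X \<Longrightarrow> k \<in> carrier_vec N \<Longrightarrow> I A 1 *\<^sub>v (I A 1 *\<^sub>v k) = I A 1 *\<^sub>v k"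
  using assoc_mult_mat_vec[OF carrier carrier, of A A k 1 1] spectral by simp

lemma mu_adj: "A \<in> sets X \<Longrightarrow> h \<in> carrier_vec N \<Longrightarrow> k \<in> carrier_vec N \<Longrightarrow> vinner (I A 1 *\<^sub>v h) k = m A h k"
  using vinner_madj[OF carrier, of A h k 1] spectral by simp

lemma m_self: "A \<in> sets X \<Longrightarrow> k \<in> carrier_vec N \<Longrightarrow> m A k k = vinner (I A 1 *\<^sub>v k) (I A 1 *\<^sub>v k)"
  using mu_adj[of A k "I A 1 *\<^sub>v k"] mu_idem mu_vec by simp

lemma m_nonneg: "A \<in> sets X \<Longrightarrow> k \<in> carrier_vec N \<Longrightarrow> 0 \<le> Re (m A k k)"
  by (simp add: m_self vinner_self sum_nonneg)

lemma m_zero: "A \<in> sets X \<Longrightarrow> k \<in> carrier_vec N \<Longrightarrow> Re (m A k k) \<le> 0 \<Longrightarrow> I A 1 *\<^sub>v k = 0\<^sub>v N"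
  using m_nonneg[of A k] vinner_self(1)[of "I A 1 *\<^sub>v k"] mu_vec
  by (intro vinner_self_eq_zero) (auto simp: m_self complex_eq_iff)

lemma m_Un: "A \<in> sets X \<Longrightarrow> B \<in> sets X \<Longrightarrow> A \<inter> B = {} \<Longrightarrow> h \<in> carrier_vec N \<Longrightarrow> k \<in> carrier_vec N \<Longrightarrow>
    m (A \<union> B) h k = m A h k + m B h k"
  by (rule cp_instrument_Un[OF instr])

lemma m_compl: "A \<in> sets X \<Longrightarrow> h \<in> carrier_vec N \<Longrightarrow> k \<in> carrier_vec N \<Longrightarrow> m (space X - A) h k = vinner h k - m A h k"
  using m_Un[of A "space X - A" h k] m_space[of h k] sets.sets_into_space[of A X]
  by (simp add: Un_absorb1 sets.compl_sets)

lemma m_mono: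
  assumes "A \<in> sets X" "B \<in> sets X" "A \<subseteq> B" "k \<in> carrier_vec N"
  shows "Re (m A k k) \<le> Re (m B k k)"
proof -
  have "m (A \<union> (B - A)) k k = m A k k + m (B - A) k k" using assms by (intro m_Un) auto
  moreover have "A \<union> (B - A) = B" using assms by auto
  ultimately show ?thesis using m_nonneg[of "B - A" k] assms by simp
qed

lemma mu_split:
  assumes "A \<in> sets X" "k \<in> carrier_vec N"
  shows "I A 1 *\<^sub>v k + I (space X - A) 1 *\<^sub>v k = k"
proof (rule vec_eq_vinnerI)
  have c: "I A 1 *\<^sub>v k \<in> carrier_vec N" "I (space X - A) 1 *\<^sub>v k \<in> carrier_vec N" using mu_vec assms by auto
  then show "I A 1 *\<^sub>v k + I (space X - A) 1 *\<^sub>v k \<in> carrier_vec N" by simp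
  fix w :: "complex vec" assume w: "w \<in> carrier_vec N"
  have "vinner w (I A 1 *\<^sub>v k + I (space X - A) 1 *\<^sub>v k) = m A w k + m (space X - A) w k"
    by (rule vinner_add_right) (simp only: carrier_vecD[OF c(1)] carrier_vecD[OF c(2)])
  then show "vinner w (I A 1 *\<^sub>v k + I (space X - A) 1 *\<^sub>v k) = vinner w k"
    using m_compl[OF assms(1) w assms(2)] by simp
qed (rule assms)

text \<open>Orthogonality of the projections for disjoint sets is derived from additivity:
  \<open>B\<close> lies in the complement of \<open>A\<close>, and there the measure of a vector
  fixed by \<open>\<mu>(A)\<close> is zero.\<close>

lemma mu_disjoint:
  assumes AB: "A \<in> sets X" "B \<in> sets X" "A \<inter> B = {}" and k: "k \<in> carrier_vec N"
  shows "I B 1 *\<^sub>v (I A 1 *\<^sub>v k) = 0\<^sub>v N"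
proof (rule m_zero[OF AB(2) mu_vec[OF AB(1) k]])
  let ?k = "I A 1 *\<^sub>v k"
  have k': "?k \<in> carrier_vec N" by (rule mu_vec[OF AB(1) k])
  have "B \<subseteq> space X - A" using AB sets.sets_into_space by blast
  then have "Re (m B ?k ?k) \<le> Re (m (space X - A) ?k ?k)" using AB k' by (intro m_mono) auto
  also have "\<dots> = 0" using m_compl[OF AB(1) k' k'] mu_idem[OF AB(1) k] by simp
  finally show "Re (m B ?k ?k) \<le> 0" .
qed

text \<open>By Cauchy-Schwarz for \<open>\<Theta> B\<close>, a vector killed by
  \<open>\<mu>(B)\<close> is killed by \<open>\<Theta> B a\<close> for all \<open>a\<close>.
  Splitting \<open>k\<close> into its parts under \<open>\<mu>(A)\<close> and
  \<open>\<mu>(X - A)\<close>, and \<open>\<Theta> (space X)\<close> likewise, removes the mixed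
  terms. The statement with \<open>\<mu>(A)\<close> on the left follows by taking adjoints.\<close>

lemma instrument_absorb:
  assumes T: "cp_instrument X N \<Theta>"
    and dom: "\<And>A k. A \<in> sets X \<Longrightarrow> k \<in> carrier_vec N \<Longrightarrow> Re (vinner k (\<Theta> A 1 *\<^sub>v k)) \<le> Re (m A k k)"
    and A: "A \<in> sets X" and hk: "h \<in> carrier_vec N" "k \<in> carrier_vec N"
  shows "vinner h (\<Theta> A a *\<^sub>v k) = vinner h (\<Theta> (space X) a *\<^sub>v (I A 1 *\<^sub>v k))"
    and "vinner h (\<Theta> A a *\<^sub>v k) = vinner (I A 1 *\<^sub>v h) (\<Theta> (space X) a *\<^sub>v k)"
proof -
  have cpT: "cp_map N (\<Theta> B)" if "B \<in> sets X" for B using T that unfolding cp_instrument_def by blast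
  have cT: "\<Theta> B a \<in> carrier_mat N N" if "B \<in> sets X" for B a by (rule cp_instrument_carrier[OF T that])
  have null: "vinner h (\<Theta> B a *\<^sub>v k) = 0"
    if B: "B \<in> sets X" and hk: "h \<in> carrier_vec N" "k \<in> carrier_vec N" and z: "I B 1 *\<^sub>v k = 0\<^sub>v N" for B a h k
  proof -
    have "(cmod (cp_form (\<Theta> B) [(cstar a, h)] [(1, k)]))\<^sup>2
        \<le> Re (cp_form (\<Theta> B) [(cstar a, h)] [(cstar a, h)]) * Re (cp_form (\<Theta> B) [(1, k)] [(1, k)])"
      using hk by (intro cp_form_Cauchy_Schwarz[OF cpT[OF B]]) auto
    moreover have "Re (cp_form (\<Theta> B) [(1, k)] [(1, k)]) = 0"
      using dom[OF B hk(2)] cp_form_nonneg(2)[OF cpT[OF B], of "[(1, k)]"] hk z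
      by (simp add: cp_form_single vinner_def)
    ultimately show ?thesis by (simp add: cp_form_single cstar_cstar)
  qed
  have right: "vinner h (\<Theta> A a *\<^sub>v k) = vinner h (\<Theta> (space X) a *\<^sub>v (I A 1 *\<^sub>v k))"
    if hk: "h \<in> carrier_vec N" "k \<in> carrier_vec N" for h k a
  proof -
    let ?B = "space X - A"
    have B: "?B \<in> sets X" "A \<inter> ?B = {}" "?B \<inter> A = {}" "A \<union> ?B = space X"
      using A sets.sets_into_space by auto
    have kA: "I A 1 *\<^sub>v k \<in> carrier_vec N" "I ?B 1 *\<^sub>v k \<in> carrier_vec N" using mu_vec A B hk by auto
    have "vinner h (\<Theta> A a *\<^sub>v k) = vinner h (\<Theta> A a *\<^sub>v (I A 1 *\<^sub>v k + I ?B 1 *\<^sub>v k))"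
      by (simp only: mu_split[OF A hk(2)])
    also have "\<dots> = vinner h (\<Theta> A a *\<^sub>v (I A 1 *\<^sub>v k)) + vinner h (\<Theta> A a *\<^sub>v (I ?B 1 *\<^sub>v k))"
      using cT[OF A, of a] by (simp only: mult_add_distrib_mat_vec[OF cT[OF A] kA]) (rule vinner_add_right, simp)
    also have "vinner h (\<Theta> A a *\<^sub>v (I ?B 1 *\<^sub>v k)) = 0"
      by (rule null[OF A hk(1) kA(2) mu_disjoint[OF B(1) A B(3) hk(2)]])
    finally have 1: "vinner h (\<Theta> A a *\<^sub>v k) = vinner h (\<Theta> A a *\<^sub>v (I A 1 *\<^sub>v k))" by simp
    have "vinner h (\<Theta> (space X) a *\<^sub>v (I A 1 *\<^sub>v k))
        = vinner h (\<Theta> A a *\<^sub>v (I A 1 *\<^sub>v k)) + vinner h (\<Theta> ?B a *\<^sub>v (I A 1 *\<^sub>v k))"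
      using cp_instrument_Un[OF T hk(1) kA(1) A B(1,2), of a] B(4) by simp
    also have "vinner h (\<Theta> ?B a *\<^sub>v (I A 1 *\<^sub>v k)) = 0"
      by (rule null[OF B(1) hk(1) kA(1) mu_disjoint[OF A B(1,2) hk(2)]])
    finally show ?thesis using 1 by simp
  qed
  from hk show "vinner h (\<Theta> A a *\<^sub>v k) = vinner h (\<Theta> (space X) a *\<^sub>v (I A 1 *\<^sub>v k))" by (rule right)
  have star: "vinner h (\<Theta> B a *\<^sub>v k) = cnj (vinner k (\<Theta> B (cstar a) *\<^sub>v h))"
    if "B \<in> sets X" "h \<in> carrier_vec N" "k \<in> carrier_vec N" for B h k a
    using cp_form_cnj[OF cpT[OF that(1)], of "[(a, k)]" "[(1, h)]"] that by (simp add: cp_form_single)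
  have "vinner h (\<Theta> A a *\<^sub>v k) = cnj (vinner k (\<Theta> (space X) (cstar a) *\<^sub>v (I A 1 *\<^sub>v h)))"
    unfolding star[OF A hk] using right[OF hk(2,1)] by simp
  also have "\<dots> = vinner (I A 1 *\<^sub>v h) (\<Theta> (space X) a *\<^sub>v k)"
    using star[OF sets.top mu_vec[OF A hk(1)] hk(2)] by simp
  finally show "vinner h (\<Theta> A a *\<^sub>v k) = vinner (I A 1 *\<^sub>v h) (\<Theta> (space X) a *\<^sub>v k)" .
qed

end

section \<open>Finitely many atoms of the spectral measure\<close>

context spectral_instrument
begin

lemma m_Int_Union:
  assumes "finite \<P>" "\<P> \<subseteq> sets X" "disjoint \<P>" "B \<in> sets X" "h \<in> carrier_vec N" "k \<in> carrier_vec N"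
  shows "m (B \<inter> \<Union>\<P>) h k = (\<Sum>A\<in>\<P>. m (A \<inter> B) h k)"
  using assms(1-3)
proof (induction \<P> rule: finite_induct)
  case empty
  then show ?case using cp_instrument_empty[OF instr assms(5,6)] by simp
next
  case (insert A \<P>)
  have "B \<inter> \<Union>(insert A \<P>) = (A \<inter> B) \<union> (B \<inter> \<Union>\<P>)" by auto
  moreover have "(A \<inter> B) \<inter> (B \<inter> \<Union>\<P>) = {}"
    using insert.hyps insert.prems(2) unfolding disjoint_def by fastforce
  moreover have "A \<inter> B \<in> sets X" using insert.prems assms(4) by auto
  moreover have "B \<inter> \<Union>\<P> \<in> sets X" using insert.hyps(1) insert.prems(1) assms(4)
    by (intro sets.Int sets.finite_Union) auto
  moreover have "disjoint \<P>" using insert.prems(2) unfolding disjoint_def by auto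
  ultimately show ?case using insert m_Un[of "A \<inter> B" "B \<inter> \<Union>\<P>" h k] assms(5,6) by auto
qed

lemma m_null: "I A 1 = 0\<^sub>m N N \<Longrightarrow> k \<in> carrier_vec N \<Longrightarrow> m A h k = 0"
  by (simp add: vinner_zero_mat)

definition nonnull_family :: "'x set set \<Rightarrow> bool" where
  "nonnull_family \<P> \<longleftrightarrow> finite \<P> \<and> \<P> \<subseteq> sets X \<and> disjoint \<P> \<and> (\<forall>A\<in>\<P>. I A 1 \<noteq> 0\<^sub>m N N)"

text \<open>The projections of disjoint sets have traces adding up to at most the trace
  \<open>N\<close> of the identity, while each nonzero projection has trace at least 1.\<close>

lemma nonnull_family_card: "nonnull_family \<P> \<Longrightarrow> card \<P> \<le> N"
proof -
  assume fam: "nonnull_family \<P>"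
  then have P: "finite \<P>" "\<P> \<subseteq> sets X" "disjoint \<P>" "\<And>A. A \<in> \<P> \<Longrightarrow> I A 1 \<noteq> 0\<^sub>m N N"
    unfolding nonnull_family_def by auto
  let ?u = "unit_vec N :: nat \<Rightarrow> complex vec"
  have U: "\<Union>\<P> \<in> sets X" using P(1,2) by (rule sets.finite_Union)
  have "real (card \<P>) = (\<Sum>A\<in>\<P>. 1)" by simp
  also have "\<dots> \<le> (\<Sum>A\<in>\<P>. \<Sum>j<N. Re (m A (?u j) (?u j)))"
    using P spectral carrier by (intro sum_mono projection_trace_ge_1) auto
  also have "\<dots> = (\<Sum>j<N. Re (\<Sum>A\<in>\<P>. m A (?u j) (?u j)))" unfolding Re_sum by (rule sum.swap)
  also have "\<dots> = (\<Sum>j<N. Re (m (\<Union>\<P>) (?u j) (?u j)))"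
  proof (intro sum.cong refl arg_cong[of _ _ Re])
    fix j
    have "A \<inter> space X = A" if "A \<in> \<P>" for A using that P(2) sets.sets_into_space by blast
    moreover have "space X \<inter> \<Union>\<P> = \<Union>\<P>" using sets.sets_into_space[OF U] by blast
    ultimately show "(\<Sum>A\<in>\<P>. m A (?u j) (?u j)) = m (\<Union>\<P>) (?u j) (?u j)"
      using m_Int_Union[OF P(1-3) sets.top, of "?u j" "?u j"] by simp
  qed
  also have "\<dots> \<le> (\<Sum>j<N. Re (m (space X) (?u j) (?u j)))"
    using U sets.sets_into_space[OF U] by (intro sum_mono m_mono) auto
  also have "\<dots> = (\<Sum>j<N. 1)"
    by (intro sum.cong refl) (simp add: m_space vinner_unit)
  finally show ?thesis by simp
qed

text \<open>The bound on nonnull families replaces an arbitrary measurable space by a finite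
  partition up to null sets: a family of maximal cardinality has a null complement and consists of
  atoms.\<close>

lemma atoms:
  obtains \<P> where "finite \<P>" "\<P> \<subseteq> sets X" "disjoint \<P>"
    "\<And>B. B \<in> sets X \<Longrightarrow> \<exists>S\<subseteq>\<P>. \<forall>h\<in>carrier_vec N. \<forall>k\<in>carrier_vec N. m B h k = (\<Sum>A\<in>S. m A h k)"
    "\<And>h k. h \<in> carrier_vec N \<Longrightarrow> k \<in> carrier_vec N \<Longrightarrow> vinner h k = (\<Sum>A\<in>\<P>. m A h k)"
proof -
  have "nonnull_family {}" unfolding nonnull_family_def by auto
  moreover have "\<forall>\<P>. nonnull_family \<P> \<longrightarrow> card \<P> < Suc N" using nonnull_family_card by (auto simp: less_Suc_eq_le)
  ultimately obtain \<P> where fam: "nonnull_family \<P>" and max: "\<And>\<Q>. nonnull_family \<Q> \<Longrightarrow> card \<Q> \<le> card \<P>"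
    using ex_has_greatest_nat[of nonnull_family "{}" card "Suc N"] by blast
  from fam have P: "finite \<P>" "\<P> \<subseteq> sets X" "disjoint \<P>" "\<And>A. A \<in> \<P> \<Longrightarrow> I A 1 \<noteq> 0\<^sub>m N N"
    unfolding nonnull_family_def by auto
  have U: "\<Union>\<P> \<in> sets X" using P(1,2) by (rule sets.finite_Union)
  have nonempty: "A \<noteq> {}" if "I A 1 \<noteq> 0\<^sub>m N N" "A \<in> sets X" for A
  proof
    assume "A = {}"
    then have "I A 1 = 0\<^sub>m N N" using cp_instrument_empty[OF instr] carrier[of "{}" 1]
      by (intro mat_eq_vinnerI[of _ N]) (auto simp: vinner_zero_mat)
    with that show False by simp
  qed
  have rest: "I (space X - \<Union>\<P>) 1 = 0\<^sub>m N N"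
  proof (rule ccontr)
    let ?C = "space X - \<Union>\<P>"
    assume nz: "I ?C 1 \<noteq> 0\<^sub>m N N"
    have C: "?C \<in> sets X" using U by auto
    have "nonnull_family (insert ?C \<P>)"
      unfolding nonnull_family_def using P C nz by (auto simp: disjoint_def)
    moreover have "?C \<notin> \<P>" using nonempty[OF nz C] by blast
    ultimately show False using max[of "insert ?C \<P>"] P(1) by simp
  qed
  \<comment> \<open>If both pieces of \<open>A\<close> were nonnull, replacing \<open>A\<close> by
    them would give a larger family.\<close>
  have atom: "I (A - B) 1 = 0\<^sub>m N N" if A: "A \<in> \<P>" and B: "B \<in> sets X" and nz: "I (A \<inter> B) 1 \<noteq> 0\<^sub>m N N" for A B
  proof (rule ccontr)
    assume nz2: "I (A - B) 1 \<noteq> 0\<^sub>m N N"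
    let ?Q = "insert (A \<inter> B) (insert (A - B) (\<P> - {A}))"
    have s: "A \<inter> B \<in> sets X" "A - B \<in> sets X" using A B P(2) by auto
    have ne: "A \<inter> B \<noteq> {}" "A - B \<noteq> {}" using nonempty nz nz2 s by auto
    have dj: "A \<inter> C = {}" if "C \<in> \<P> - {A}" for C using P(3) A that unfolding disjoint_def by blast
    have sub: "A \<inter> B \<inter> C = {}" "C \<inter> (A \<inter> B) = {}" "(A - B) \<inter> C = {}" "C \<inter> (A - B) = {}"
      if "C \<in> \<P> - {A}" for C
      using dj[OF that] by blast+
    have old: "C \<inter> D = {}" if "C \<in> \<P> - {A}" "D \<in> \<P> - {A}" "C \<noteq> D" for C D
      using P(3) that unfolding disjoint_def by blast
    have "disjoint ?Q"
    proof (rule disjointI)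
      fix C D assume CD: "C \<in> ?Q" "D \<in> ?Q" "C \<noteq> D"
      from CD(1,2) consider "C = D" | "C = A \<inter> B" "D = A - B" | "C = A - B" "D = A \<inter> B"
        | "C = A \<inter> B \<or> C = A - B" "D \<in> \<P> - {A}" | "D = A \<inter> B \<or> D = A - B" "C \<in> \<P> - {A}"
        | "C \<in> \<P> - {A}" "D \<in> \<P> - {A}"
        unfolding insert_iff by argo
      then show "C \<inter> D = {}"
      proof cases
        case 4
        then show ?thesis using sub[of D] by metis
      next
        case 5
        then show ?thesis using sub[of C] by metis
      next
        case 6
        then show ?thesis using old CD(3) by blast
      qed (use CD(3) in auto)
    qed
    then have "nonnull_family ?Q" unfolding nonnull_family_def using P nz nz2 s by auto
    moreover have "A \<inter> B \<noteq> A - B" using ne(1) by blast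
    moreover have "A \<inter> B \<notin> \<P> - {A}" "A - B \<notin> \<P> - {A}"
      using dj[of "A \<inter> B"] dj[of "A - B"] ne by (auto simp: Int_absorb1 Int_absorb2)
    then have "A \<inter> B \<notin> insert (A - B) (\<P> - {A})" "A - B \<notin> \<P> - {A}"
      using \<open>A \<inter> B \<noteq> A - B\<close> by simp_all
    then have "card ?Q = Suc (Suc (card (\<P> - {A})))" using P(1) by simp
    moreover have "Suc (card (\<P> - {A})) = card \<P>" by (rule card_Suc_Diff1[OF P(1) A])
    ultimately show False using max[of ?Q] by simp
  qed
  \<comment> \<open>Up to a null set, \<open>B\<close> is the union of the atoms that it meets in a
    nonnull set.\<close>
  have main: "m B h k = (\<Sum>A\<in>{A \<in> \<P>. I (A \<inter> B) 1 \<noteq> 0\<^sub>m N N}. m A h k)"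
    if B: "B \<in> sets X" and hk: "h \<in> carrier_vec N" "k \<in> carrier_vec N" for B h k
  proof -
    have C: "B - \<Union>\<P> \<in> sets X" using B U by auto
    have "m B h k = m (B \<inter> \<Union>\<P>) h k + m (B - \<Union>\<P>) h k"
      using m_Un[of "B \<inter> \<Union>\<P>" "B - \<Union>\<P>" h k] B U hk by (simp add: Int_Diff_Un Int_Diff_disjoint)
    also have "m (B - \<Union>\<P>) h k = 0"
    proof -
      have "Re (m (B - \<Union>\<P>) k k) \<le> Re (m (space X - \<Union>\<P>) k k)"
        using B U C hk sets.sets_into_space[OF B] by (intro m_mono) auto
      also have "\<dots> = 0" using m_null[OF rest hk(2)] by simp
      finally have "I (B - \<Union>\<P>) 1 *\<^sub>v k = 0\<^sub>v N" by (rule m_zero[OF C hk(2)])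
      then show ?thesis by (simp add: vinner_def)
    qed
    also have "m (B \<inter> \<Union>\<P>) h k = (\<Sum>A\<in>\<P>. m (A \<inter> B) h k)" by (rule m_Int_Union[OF P(1-3) B hk])
    also have "\<dots> = (\<Sum>A\<in>\<P>. if I (A \<inter> B) 1 \<noteq> 0\<^sub>m N N then m A h k else 0)"
    proof (rule sum.cong[OF refl])
      fix A assume A: "A \<in> \<P>"
      have s: "A \<inter> B \<in> sets X" "A - B \<in> sets X" using A B P(2) by auto
      show "m (A \<inter> B) h k = (if I (A \<inter> B) 1 \<noteq> 0\<^sub>m N N then m A h k else 0)"
      proof (cases "I (A \<inter> B) 1 = 0\<^sub>m N N")
        case False
        have "m A h k = m (A \<inter> B) h k + m (A - B) h k"
          using m_Un[OF s Int_Diff_disjoint hk] by (simp add: Int_Diff_Un)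
        with m_null[OF atom[OF A B False] hk(2)] False show ?thesis by simp
      qed (use m_null[OF _ hk(2)] in simp)
    qed
    also have "\<dots> = (\<Sum>A\<in>{A \<in> \<P>. I (A \<inter> B) 1 \<noteq> 0\<^sub>m N N}. m A h k)"
      by (rule sum.inter_filter[symmetric, OF P(1)])
    finally show ?thesis by simp
  qed
  have "\<exists>S\<subseteq>\<P>. \<forall>h\<in>carrier_vec N. \<forall>k\<in>carrier_vec N. m B h k = (\<Sum>A\<in>S. m A h k)" if "B \<in> sets X" for B
    using main[OF that] by (intro exI[of _ "{A \<in> \<P>. I (A \<inter> B) 1 \<noteq> 0\<^sub>m N N}"]) auto
  moreover have "vinner h k = (\<Sum>A\<in>\<P>. m A h k)" if "h \<in> carrier_vec N" "k \<in> carrier_vec N" for h k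
  proof -
    have "A \<inter> space X = A" if "A \<in> \<P>" for A using that P(2) sets.sets_into_space by blast
    then have "{A \<in> \<P>. I (A \<inter> space X) 1 \<noteq> 0\<^sub>m N N} = \<P>" using P(4) by auto
    then show ?thesis using main[OF sets.top that] m_space[OF that] by simp
  qed
  ultimately show thesis using that P(1-3) by blast
qed

end

text \<open>Spectral measure and dilation of the CP marginal together. \<open>Z\<close>,
  \<open>\<kappa>\<close> and \<open>V\<close> are parameters because the same instrument is used
  with two dilations, before and after the diagonalization.\<close>

locale nest_instrument =
  spectral_instrument X N I + nest_system L d \<psi> \<pi> v N "I (space X)" Z \<kappa> V
  for X :: "'x measure" and N and I :: "'x set \<Rightarrow> 'a::cstar_algebra \<Rightarrow> complex mat"
    and L d and \<psi> :: "nat \<Rightarrow> 'a \<Rightarrow> complex mat" and \<pi> :: "'a \<Rightarrow> 'p::chilbert \<Rightarrow> 'p" and v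
    and Z :: "'l set" and \<kappa> V
begin

lemma v0: "i < L \<Longrightarrow> v i 0 \<in> R i" "i < L \<Longrightarrow> v i 0 \<noteq> 0"
  using R_v[OF d_pos] v_inner[OF _ d_pos d_pos, of i] by auto

text \<open>\<open>I A\<close> is dominated by \<open>I (space X)\<close>, so it has a Radon-Nikodym
  matrix \<open>P\<close>. Comparing this with \<open>I A a = I (space X) a \<mu>(A)\<close> shows
  that the projection \<open>\<mu>(A)\<close> acts through \<open>P\<close> on the
  components.\<close>

lemma projection_coefficients:
  assumes A: "A \<in> sets X"
  obtains P where "\<And>e f. e \<in> Z \<Longrightarrow> f \<in> Z \<Longrightarrow> P f e = cnj (P e f)"
    "\<And>e k. e \<in> Z \<Longrightarrow> k \<in> carrier_vec N \<Longrightarrow> V e (I A 1 *\<^sub>v k) = (\<Sum>f\<in>Z. cscale (P e f) (V f k))"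
proof -
  have cpA: "cp_map N (I B)" if "B \<in> sets X" for B using instr that unfolding cp_instrument_def by blast
  have "Re (cp_form (I A) xs xs) \<le> Re (cp_form (I (space X)) xs xs)"
    if xs: "vec_list N xs" for xs
  proof -
    have s: "space X - A \<in> sets X" "A \<inter> (space X - A) = {}" "A \<union> (space X - A) = space X"
      using A sets.sets_into_space by auto
    have "vinner (snd x) (I (space X) (cstar (fst x) * fst y) *\<^sub>v snd y)
        = vinner (snd x) (I A (cstar (fst x) * fst y) *\<^sub>v snd y)
          + vinner (snd x) (I (space X - A) (cstar (fst x) * fst y) *\<^sub>v snd y)"
      if "x \<in> set xs" "y \<in> set xs" for x y
      using cp_instrument_Un[OF instr, of "snd x" "snd y" A "space X - A"] xs that s A by auto
    then have "cp_form (I (space X)) xs xs = cp_form (I A) xs xs + cp_form (I (space X - A)) xs xs"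
      unfolding cp_form_def by (simp add: sum_list_addf[symmetric] cong: map_cong)
    with cp_form_nonneg(2)[OF cpA[OF s(1)] xs] show ?thesis by simp
  qed
  then obtain P where psd: "psd_form Z P" and P: "\<And>a h k. h \<in> carrier_vec N \<Longrightarrow> k \<in> carrier_vec N \<Longrightarrow>
      vinner h (I A a *\<^sub>v k) = (\<Sum>e\<in>Z. \<Sum>f\<in>Z. P e f * cinner (V e h) (\<pi> a (V f k)))"
    by (rule radon_nikodym[OF cpA[OF A]]) auto
  have "V e (I A 1 *\<^sub>v k) = (\<Sum>f\<in>Z. cscale (P e f) (V f k))" if e: "e \<in> Z" and k: "k \<in> carrier_vec N" for e k
  proof -
    have "V e (I A 1 *\<^sub>v k) - (\<Sum>f\<in>Z. cscale (P e f) (V f k)) = 0"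
    \<comment> \<open>Testing with \<open>a = 1\<close> would only compare projections onto
      \<open>R (\<kappa> e)\<close>. With all \<open>a\<close> the two vectors agree in the
      representation space, so the right-hand side must itself lie in \<open>R (\<kappa> e)\<close>;
      this is why \<open>P\<close> respects the nest.\<close>
    proof (rule minimal_zero[OF idx[OF e]])
      fix a j assume j: "j < d (\<kappa> e)"
      define h where "h = Vinv (dl e (v (\<kappa> e) j))"
      have h: "h \<in> carrier_vec N" and Vh: "\<And>f. f \<in> Z \<Longrightarrow> V f h = (if f = e then v (\<kappa> e) j else 0)"
        unfolding h_def using Vinv_dl[OF R_v[OF j]] by auto
      have "vinner h (I A (cstar a) *\<^sub>v k) = (\<Sum>f\<in>Z. \<Sum>e'\<in>Z. P e' f * cinner (V e' h) (\<pi> (cstar a) (V f k)))"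
        unfolding P[OF h k] by (rule sum.swap)
      also have "\<dots> = (\<Sum>f\<in>Z. P e f * cinner (v (\<kappa> e) j) (\<pi> (cstar a) (V f k)))"
        using e fin Vh by (intro sum.cong refl)
          (simp add: if_distrib[of "\<lambda>z. cinner z _"] if_distrib[of "\<lambda>z. _ * z"] cong: if_cong sum.cong)
      also have "\<dots> = cinner (\<pi> a (v (\<kappa> e) j)) (\<Sum>f\<in>Z. cscale (P e f) (V f k))"
        by (simp add: cinner_sum_right cinner_cscale_right rep_adj')
      finally have 1: "vinner h (I A (cstar a) *\<^sub>v k) = cinner (\<pi> a (v (\<kappa> e) j)) (\<Sum>f\<in>Z. cscale (P e f) (V f k))" .
      have "vinner h (I A (cstar a) *\<^sub>v k) = vinner h (I (space X) (cstar a) *\<^sub>v (I A 1 *\<^sub>v k))"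
        by (rule instrument_absorb(1)[OF instr _ A h k]) simp
      also have "\<dots> = (\<Sum>f\<in>Z. cinner (V f h) (\<pi> (cstar a) (V f (I A 1 *\<^sub>v k))))"
        by (rule V_dilation[OF h mu_vec[OF A k]])
      also have "\<dots> = cinner (v (\<kappa> e) j) (\<pi> (cstar a) (V e (I A 1 *\<^sub>v k)))"
        using e fin Vh by (simp add: if_distrib[of "\<lambda>z. cinner z _"] cong: if_cong sum.cong)
      also have "\<dots> = cinner (\<pi> a (v (\<kappa> e) j)) (V e (I A 1 *\<^sub>v k))" by (simp add: rep_adj')
      finally show "cinner (\<pi> a (v (\<kappa> e) j)) (V e (I A 1 *\<^sub>v k) - (\<Sum>f\<in>Z. cscale (P e f) (V f k))) = 0"
        using 1 by (simp add: cinner_diff_right)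
    qed
    then show ?thesis by simp
  qed
  with psd_form_hermitian[OF fin psd] show thesis by (rule that)
qed

end

section \<open>Diagonalizing the spectral measure on the multiplicity space\<close>

context nest_instrument
begin

text \<open>A family concentrated in component \<open>f\<close> with a nonzero entry isolates the
  coefficient at \<open>f\<close>. The next lemma isolates in the same way, with an arbitrary entry
  from \<open>R (\<kappa> f)\<close>.\<close>

lemma coefficients_unique:
  assumes eq: "\<And>k. k \<in> carrier_vec N \<Longrightarrow> (\<Sum>f\<in>Z. cscale (b f) (V f k)) = (\<Sum>f\<in>Z. cscale (c f) (V f k))"
    and f: "f \<in> Z"
  shows "b f = c f"
proof -
  define x where "x = v (\<kappa> f) 0"
  define k where "k = Vinv (dl f x)"
  have x: "x \<in> R (\<kappa> f)" "x \<noteq> 0" unfolding x_def using v0[OF idx[OF f]] by auto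
  have k: "k \<in> carrier_vec N" "\<And>g. g \<in> Z \<Longrightarrow> V g k = (if g = f then x else 0)"
    unfolding k_def using Vinv_dl[OF x(1)] by auto
  have "(\<Sum>g\<in>Z. cscale (z g) (V g k)) = cscale (z f) x" for z
    using k(2) f fin by (simp add: if_distrib[of "cscale _"] cong: sum.cong if_cong)
  with eq[OF k(1)] have "cscale (b f) x = cscale (c f) x" by simp
  then show ?thesis using x(2) by (rule cscale_cancel)
qed

lemma coefficients_range:
  assumes map: "\<And>k. k \<in> carrier_vec N \<Longrightarrow> (\<Sum>f\<in>Z. cscale (c f) (V f k)) \<in> R i"
    and f: "f \<in> Z" "c f \<noteq> 0"
  shows "R (\<kappa> f) \<subseteq> R i"
proof
  fix x assume x: "x \<in> R (\<kappa> f)"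
  have "(\<Sum>g\<in>Z. cscale (c g) (V g (Vinv (dl f x)))) = cscale (c f) x"
    using Vinv_dl(2)[OF x] f fin by (simp add: if_distrib[of "cscale _"] cong: sum.cong if_cong)
  with map[OF Vinv_dl(1)[OF x]] have "cscale (c f) x \<in> R i" by simp
  from R_cscale[OF this, of "1 / c f"] show "x \<in> R i" using f(2) by (simp add: cscale_cscale cscale_one)
qed

text \<open>The commuting projections of the POVM act on the multiplicity space and respect the nest, so
  they can be diagonalized there; this yields a dilation whose components are eigenvectors.\<close>
lemma diagonalize_projections:
  assumes P: "finite \<P>" "\<P> \<subseteq> sets X" "disjoint \<P>"
    and total: "\<And>h k. h \<in> carrier_vec N \<Longrightarrow> k \<in> carrier_vec N \<Longrightarrow> vinner h k = (\<Sum>A\<in>\<P>. m A h k)"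
  obtains Z' :: "('x set \<times> 'l) set" and \<kappa>' V' where "nest_instrument X N I L d \<psi> \<pi> v Z' \<kappa>' V'"
    "\<And>e. e \<in> Z' \<Longrightarrow> fst e \<in> \<P>"
    "\<And>e A k. e \<in> Z' \<Longrightarrow> A \<in> \<P> \<Longrightarrow> k \<in> carrier_vec N \<Longrightarrow> V' e (I A 1 *\<^sub>v k) = (if fst e = A then V' e k else 0)"
proof -
  have PX: "A \<in> sets X" if "A \<in> \<P>" for A using P(2) that by blast
  have "\<exists>Q. (\<forall>e\<in>Z. \<forall>f\<in>Z. Q f e = cnj (Q e f)) \<and>
      (\<forall>e\<in>Z. \<forall>k\<in>carrier_vec N. V e (I A 1 *\<^sub>v k) = (\<Sum>f\<in>Z. cscale (Q e f) (V f k)))" if "A \<in> \<P>" for A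
    by (rule projection_coefficients[OF PX[OF that]]) blast
  then obtain Q where herm: "\<And>A e f. A \<in> \<P> \<Longrightarrow> e \<in> Z \<Longrightarrow> f \<in> Z \<Longrightarrow> Q A f e = cnj (Q A e f)"
    and VQ: "\<And>A e k. A \<in> \<P> \<Longrightarrow> e \<in> Z \<Longrightarrow> k \<in> carrier_vec N \<Longrightarrow> V e (I A 1 *\<^sub>v k) = (\<Sum>f\<in>Z. cscale (Q A e f) (V f k))"
    by metis
  have VQQ: "V e (I A 1 *\<^sub>v (I B 1 *\<^sub>v k)) = (\<Sum>g\<in>Z. cscale (\<Sum>f\<in>Z. Q A e f * Q B f g) (V g k))"
    if "A \<in> \<P>" "B \<in> \<P>" "e \<in> Z" "k \<in> carrier_vec N" for A B e k
    using that VQ[OF that(1,3) mu_vec[OF PX[OF that(2)] that(4)]] VQ[OF that(2) _ that(4)]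
    by (simp add: sum_cscale_swap[symmetric] cong: sum.cong)
  \<comment> \<open>Uniqueness of coefficients transfers the product rules of the spectral measure
    to the matrices \<open>Q A\<close>, making them mutually orthogonal projections.\<close>
  have QQ: "(\<Sum>f\<in>Z. Q A e f * Q B f g) = (if A = B then Q A e g else 0)"
    if AB: "A \<in> \<P>" "B \<in> \<P>" and eg: "e \<in> Z" "g \<in> Z" for A B e g
  proof -
    have "(\<Sum>g\<in>Z. cscale (\<Sum>f\<in>Z. Q A e f * Q B f g) (V g k)) = (\<Sum>g\<in>Z. cscale (if A = B then Q A e g else 0) (V g k))"
      if k: "k \<in> carrier_vec N" for k
    proof (cases "A = B")
      case True
      then show ?thesis using VQQ[OF AB eg(1) k] VQ[OF AB(1) eg(1) k] mu_idem[OF PX[OF AB(1)] k] by simp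
    next
      case False
      then have "B \<inter> A = {}" using P(3) AB unfolding disjoint_def by blast
      then have "I A 1 *\<^sub>v (I B 1 *\<^sub>v k) = 0\<^sub>v N" using mu_disjoint[OF PX[OF AB(2)] PX[OF AB(1)] _ k] by simp
      moreover have "0 \<cdot>\<^sub>v k = 0\<^sub>v N" using k by (intro eq_vecI) auto
      then have "V e (0\<^sub>v N) = 0" using V_smult[OF eg(1) k, of 0] by simp
      ultimately show ?thesis using VQQ[OF AB eg(1) k] False by simp
    qed
    from coefficients_unique[OF this eg(2)] show ?thesis .
  qed
  have Qsum: "(\<Sum>A\<in>\<P>. Q A e f) = (if e = f then 1 else 0)" if ef: "e \<in> Z" "f \<in> Z" for e f
  proof -
    have "(\<Sum>f\<in>Z. cscale (\<Sum>A\<in>\<P>. Q A e f) (V f k)) = (\<Sum>f\<in>Z. cscale (if e = f then 1 else 0) (V f k))"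
      if k: "k \<in> carrier_vec N" for k
    proof -
      \<comment> \<open>\<open>total\<close> gives orthogonality of \<open>z\<close> to
        \<open>R (\<kappa> e)\<close> only; as \<open>z\<close> itself belongs to
        \<open>R (\<kappa> e)\<close>, this suffices.\<close>
      define z where "z = V e k - (\<Sum>A\<in>\<P>. V e (I A 1 *\<^sub>v k))"
      have orth: "cinner x z = 0" if x: "x \<in> R (\<kappa> e)" for x
      proof -
        let ?h = "Vinv (dl e x)"
        have h: "?h \<in> carrier_vec N" by (rule Vinv_dl(1)[OF x])
        have single: "vinner ?h w = cinner x (V e w)" if "w \<in> carrier_vec N" for w
          using V_inner[OF h that] Vinv_dl(2)[OF x] ef(1) fin
          by (simp add: if_distrib[of "\<lambda>z. cinner z _"] cong: sum.cong if_cong)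
        show ?thesis
          using total[OF h k] single[OF k] single[OF mu_vec[OF PX k]] unfolding z_def
          by (simp add: cinner_diff_right cinner_sum_right cong: sum.cong)
      qed
      have "z = V e k + cscale (-1) (\<Sum>A\<in>\<P>. V e (I A 1 *\<^sub>v k))"
        unfolding z_def using cscale_minus_left[of 1 "\<Sum>A\<in>\<P>. V e (I A 1 *\<^sub>v k)"] by (simp add: cscale_one)
      then have "z \<in> R (\<kappa> e)"
        using V_range[OF ef(1)] k mu_vec[OF PX k] by (auto intro!: R_add R_cscale R_sum)
      then have "z = 0" using orth[of z] cinner_eq_zero_iff by blast
      then have "V e k = (\<Sum>A\<in>\<P>. \<Sum>f\<in>Z. cscale (Q A e f) (V f k))"
        unfolding z_def using VQ[OF _ ef(1) k] by (simp cong: sum.cong)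
      also have "\<dots> = (\<Sum>f\<in>Z. cscale (\<Sum>A\<in>\<P>. Q A e f) (V f k))"
        unfolding cscale_sum_left by (rule sum.swap)
      finally show ?thesis
        using ef(1) fin by (simp add: if_distrib[of "\<lambda>z. cscale z _"] cscale_one cong: if_cong)
    qed
    from coefficients_unique[OF this ef(2)] show ?thesis .
  qed
  \<comment> \<open>Nonzero entries give one inclusion by \<open>coefficients_range\<close>, and
    hermitian symmetry gives the other.\<close>
  have Qrange: "R (\<kappa> e) = R (\<kappa> f)" if A: "A \<in> \<P>" and ef: "e \<in> Z" "f \<in> Z" and nz: "Q A e f \<noteq> 0" for A e f
  proof
    have sub: "R (\<kappa> f) \<subseteq> R (\<kappa> e)" if "e \<in> Z" "f \<in> Z" "Q A e f \<noteq> 0" for e f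
      by (rule coefficients_range[of "Q A e"])
        (use that VQ[OF A that(1)] V_range[OF that(1) mu_vec[OF PX[OF A]]] in auto)
    show "R (\<kappa> f) \<subseteq> R (\<kappa> e)" using sub ef nz by blast
    have "Q A f e \<noteq> 0" using herm[OF A ef] nz by simp
    then show "R (\<kappa> e) \<subseteq> R (\<kappa> f)" using sub ef by blast
  qed
  define factors where "factors A G B \<longleftrightarrow> G \<subseteq> Z \<and> (\<forall>e\<in>G. \<forall>f\<in>Z. B e f \<noteq> 0 \<longrightarrow> R (\<kappa> e) = R (\<kappa> f))
    \<and> (\<forall>f\<in>Z. \<forall>g\<in>Z. Q A f g = (\<Sum>e\<in>G. cnj (B e f) * B e g))
    \<and> (\<forall>e\<in>G. \<forall>g\<in>G. (\<Sum>f\<in>Z. B e f * cnj (B g f)) = (if e = g then 1 else 0))" for A G and B :: "'l \<Rightarrow> 'l \<Rightarrow> complex"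
  have "\<exists>G B. factors A G B" if A: "A \<in> \<P>" for A
    unfolding factors_def
    by (rule projection_factorization[OF fin herm[OF A] _ Qrange[OF A]]) (use QQ[OF A A] in auto)
  then obtain G B where GB: "\<And>A. A \<in> \<P> \<Longrightarrow> factors A (G A) (B A)" by metis
  have G: "G A \<subseteq> Z"
    and B1: "\<forall>e\<in>G A. \<forall>f\<in>Z. B A e f \<noteq> 0 \<longrightarrow> R (\<kappa> e) = R (\<kappa> f)"
    and B2: "\<forall>f\<in>Z. \<forall>g\<in>Z. Q A f g = (\<Sum>e\<in>G A. cnj (B A e f) * B A e g)"
    and B3: "\<forall>e\<in>G A. \<forall>g\<in>G A. (\<Sum>f\<in>Z. B A e f * cnj (B A g f)) = (if e = g then 1 else 0)"
    if "A \<in> \<P>" for A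
    using GB[OF that] unfolding factors_def by - (elim conjE, assumption)+
  have finG: "finite (G A)" if "A \<in> \<P>" for A using G[OF that] fin finite_subset by blast
  \<comment> \<open>Write \<open>B A\<close> as \<open>B A\<close> times \<open>Q A\<close> and use
    the products of the \<open>Q A\<close>.\<close>
  have BQ: "(\<Sum>f\<in>Z. B A e f * Q A' f h) = (if A = A' then B A e h else 0)"
    if A: "A \<in> \<P>" "A' \<in> \<P>" and e: "e \<in> G A" and h: "h \<in> Z" for A A' e h
  proof -
    note ab = factor_absorb[OF finG[OF A(1)] B2[OF A(1)] B3[OF A(1)] e]
    have "(\<Sum>f\<in>Z. B A e f * Q A' f h) = (\<Sum>f\<in>Z. \<Sum>g\<in>Z. B A e g * (Q A g f * Q A' f h))"
      by (intro sum.cong refl, subst ab[symmetric]) (auto simp: sum_distrib_right mult.assoc)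
    also have "\<dots> = (\<Sum>g\<in>Z. B A e g * (\<Sum>f\<in>Z. Q A g f * Q A' f h))"
      unfolding sum_distrib_left by (rule sum.swap)
    also have "\<dots> = (\<Sum>g\<in>Z. B A e g * (if A = A' then Q A g h else 0))"
      using QQ[OF A _ h] by (simp cong: sum.cong)
    also have "\<dots> = (if A = A' then B A e h else 0)" using ab[OF h] by auto
    finally show ?thesis .
  qed
  have BB: "(\<Sum>f\<in>Z. B A e f * cnj (B A' g f)) = (if A = A' \<and> e = g then 1 else 0)"
    if A: "A \<in> \<P>" "A' \<in> \<P>" and eg: "e \<in> G A" "g \<in> G A'" for A A' e g
  proof (cases "A = A'")
    case True
    then show ?thesis using B3[OF A(1)] eg by auto
  next
    case False
    have "cnj (B A' g f) = (\<Sum>h\<in>Z. Q A' f h * cnj (B A' g h))" if f: "f \<in> Z" for f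
    proof -
      have "cnj (B A' g f) = cnj (\<Sum>h\<in>Z. B A' g h * Q A' h f)"
        by (subst factor_absorb[OF finG[OF A(2)] B2[OF A(2)] B3[OF A(2)] eg(2) f]) simp
      also have "\<dots> = (\<Sum>h\<in>Z. Q A' f h * cnj (B A' g h))"
        unfolding cnj_sum using herm[OF A(2) _ f] by (intro sum.cong refl) (simp add: mult.commute)
      finally show ?thesis .
    qed
    then have "(\<Sum>f\<in>Z. B A e f * cnj (B A' g f)) = (\<Sum>f\<in>Z. \<Sum>h\<in>Z. (B A e f * Q A' f h) * cnj (B A' g h))"
      by (intro sum.cong refl) (simp add: sum_distrib_left mult.assoc)
    also have "\<dots> = (\<Sum>h\<in>Z. (\<Sum>f\<in>Z. B A e f * Q A' f h) * cnj (B A' g h))"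
      unfolding sum_distrib_right by (rule sum.swap)
    also have "\<dots> = 0" using BQ[OF A eg(1)] False by (intro sum.neutral) auto
    finally show ?thesis using False by simp
  qed
  \<comment> \<open>The bases of the ranges of all \<open>Q A\<close> together form a unitary change
    of coordinates. A new label records its atom and keeps, through \<open>\<kappa>'\<close>, the
    space of the old label that named it.\<close>
  define Z' where "Z' = Sigma \<P> G"
  define \<kappa>' where "\<kappa>' e = \<kappa> (snd e)" for e :: "'x set \<times> 'l"
  define V' where "V' e h = (\<Sum>f\<in>Z. cscale (B (fst e) (snd e) f) (V f h))" for e h
  have Z'D: "fst e \<in> \<P>" "snd e \<in> G (fst e)" "snd e \<in> Z" if "e \<in> Z'" for e
    using that G[THEN subsetD] by (auto simp: Z'_def)
  have fin': "finite Z'" unfolding Z'_def using P(1) finG by (rule finite_SigmaI)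
  have B_R: "cscale (B A e f) x \<in> R (\<kappa> e)" if "A \<in> \<P>" "e \<in> G A" "f \<in> Z" "x \<in> R (\<kappa> f)" for A e f x
    using B1[OF that(1)] that R_cscale[OF that(4)] R_zero by (cases "B A e f = 0") auto
  have "nest_instrument X N I L d \<psi> \<pi> v Z' \<kappa>' V'"
  proof (intro nest_instrument.intro nest_system.intro nest_system_axioms.intro spectral_instrument_axioms stinespring_nest_axioms)
    show "cp_map N (I (space X))" "I (space X) 1 = 1\<^sub>m N" by (rule cp, rule unital)
    show "finite Z'" by (rule fin')
    fix e assume e: "e \<in> Z'"
    note e' = Z'D[OF e]
    show "\<kappa>' e < L" unfolding \<kappa>'_def by (rule idx[OF e'(3)])
    fix h :: "complex vec" assume h: "h \<in> carrier_vec N"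
    show "V' e h \<in> R (\<kappa>' e)"
      unfolding V'_def \<kappa>'_def using e' V_range[OF _ h] by (intro R_sum B_R) auto
    show "V' e (c \<cdot>\<^sub>v h) = cscale c (V' e h)" for c
      unfolding V'_def cscale_sum_right cscale_cscale using V_smult[OF _ h]
      by (intro sum.cong refl) (simp add: cscale_cscale mult.commute)
    fix k :: "complex vec" assume k: "k \<in> carrier_vec N"
    show "V' e (h + k) = V' e h + V' e k"
      unfolding V'_def sum.distrib[symmetric] using V_add[OF _ h k]
      by (intro sum.cong refl) (simp add: cscale_add_right)
  next
    fix h k :: "complex vec" and a assume h: "h \<in> carrier_vec N" and k: "k \<in> carrier_vec N"
    have "(\<Sum>e\<in>Z'. cinner (V' e h) (\<pi> a (V' e k)))
       = (\<Sum>e\<in>Z'. \<Sum>f\<in>Z. \<Sum>g\<in>Z. cnj (B (fst e) (snd e) f) * B (fst e) (snd e) g * cinner (V f h) (\<pi> a (V g k)))"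
      unfolding V'_def rep_sum rep_cscale cinner_double_sum ..
    also have "\<dots> = (\<Sum>f\<in>Z. \<Sum>g\<in>Z. \<Sum>e\<in>Z'. cnj (B (fst e) (snd e) f) * B (fst e) (snd e) g * cinner (V f h) (\<pi> a (V g k)))"
      by (subst sum.swap, rule sum.cong[OF refl], rule sum.swap)
    \<comment> \<open>Summed over the new labels, the products of the rows give the sum of the
      \<open>Q A\<close>, which is the identity; so the new components dilate the same map.\<close>
    also have "\<dots> = (\<Sum>f\<in>Z. \<Sum>g\<in>Z. (if f = g then 1 else 0) * cinner (V f h) (\<pi> a (V g k)))"
    proof (intro sum.cong refl)
      fix f g assume fg: "f \<in> Z" "g \<in> Z"
      have "(\<Sum>e\<in>Z'. cnj (B (fst e) (snd e) f) * B (fst e) (snd e) g) = (\<Sum>A\<in>\<P>. \<Sum>e\<in>G A. cnj (B A e f) * B A e g)"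
        unfolding Z'_def by (subst sum.Sigma) (use P(1) finG in \<open>auto simp: case_prod_beta\<close>)
      also have "\<dots> = (\<Sum>A\<in>\<P>. Q A f g)" using B2 fg by (intro sum.cong refl) auto
      also have "\<dots> = (if f = g then 1 else 0)" by (rule Qsum[OF fg])
      finally show "(\<Sum>e\<in>Z'. cnj (B (fst e) (snd e) f) * B (fst e) (snd e) g * cinner (V f h) (\<pi> a (V g k)))
          = (if f = g then 1 else 0) * cinner (V f h) (\<pi> a (V g k))"
        by (simp only: sum_distrib_right[symmetric])
    qed
    also have "\<dots> = (\<Sum>f\<in>Z. cinner (V f h) (\<pi> a (V f k)))"
      using fin by (intro sum.cong refl) (simp add: if_distrib[of "\<lambda>z. z * _"] cong: if_cong)
    also have "\<dots> = vinner h (I (space X) a *\<^sub>v k)" by (rule V_dilation[OF h k, symmetric])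
    finally show "vinner h (I (space X) a *\<^sub>v k) = (\<Sum>e\<in>Z'. cinner (V' e h) (\<pi> a (V' e k)))" by simp
  next
    fix \<xi> assume \<xi>: "\<And>e. e \<in> Z' \<Longrightarrow> \<xi> e \<in> R (\<kappa>' e)"
    \<comment> \<open>The adjoint of the change of coordinates, applied to \<open>\<xi>\<close>. It
      yields an admissible family because nonzero entries of \<open>B\<close> join labels with equal
      spaces.\<close>
    define \<eta> where "\<eta> f = (\<Sum>e\<in>Z'. cscale (cnj (B (fst e) (snd e) f)) (\<xi> e))" for f
    have "\<eta> f \<in> R (\<kappa> f)" if f: "f \<in> Z" for f
      unfolding \<eta>_def
    proof (rule R_sum)
      fix e assume e: "e \<in> Z'"
      show "cscale (cnj (B (fst e) (snd e) f)) (\<xi> e) \<in> R (\<kappa> f)"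
      proof (cases "B (fst e) (snd e) f = 0")
        case False
        then have "R (\<kappa> f) = R (\<kappa>' e)" using B1 Z'D[OF e] f unfolding \<kappa>'_def by metis
        then show ?thesis using R_cscale[OF \<xi>[OF e]] by simp
      qed (simp add: R_zero)
    qed
    then obtain h where h: "h \<in> carrier_vec N" "\<forall>f\<in>Z. V f h = \<eta> f" using V_surj[of \<eta>] by blast
    have "V' e h = \<xi> e" if e: "e \<in> Z'" for e
    proof -
      have "V' e h = (\<Sum>f\<in>Z. cscale (B (fst e) (snd e) f) (\<Sum>e'\<in>Z'. cscale (cnj (B (fst e') (snd e') f)) (\<xi> e')))"
        unfolding V'_def using h(2) by (intro sum.cong refl) (simp add: \<eta>_def)
      also have "\<dots> = (\<Sum>e'\<in>Z'. cscale (\<Sum>f\<in>Z. B (fst e) (snd e) f * cnj (B (fst e') (snd e') f)) (\<xi> e'))"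
        by (rule sum_cscale_swap)
      also have "\<dots> = (\<Sum>e'\<in>Z'. cscale (if e = e' then 1 else 0) (\<xi> e'))"
        using BB Z'D e by (intro sum.cong refl) (simp add: prod_eq_iff)
      also have "\<dots> = \<xi> e" using e fin' by (simp add: if_distrib[of "\<lambda>z. cscale z _"] cscale_one cong: if_cong)
      finally show ?thesis .
    qed
    with h(1) show "\<exists>h\<in>carrier_vec N. \<forall>e\<in>Z'. V' e h = \<xi> e" by blast
  qed
  moreover have "V' e (I A 1 *\<^sub>v k) = (if fst e = A then V' e k else 0)"
    if e: "e \<in> Z'" and A: "A \<in> \<P>" and k: "k \<in> carrier_vec N" for e A k
  proof -
    have "V' e (I A 1 *\<^sub>v k) = (\<Sum>f\<in>Z. cscale (B (fst e) (snd e) f) (\<Sum>g\<in>Z. cscale (Q A f g) (V g k)))"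
      unfolding V'_def using VQ[OF A _ k] by (simp cong: sum.cong)
    also have "\<dots> = (\<Sum>g\<in>Z. cscale (\<Sum>f\<in>Z. B (fst e) (snd e) f * Q A f g) (V g k))" by (rule sum_cscale_swap)
    also have "\<dots> = (\<Sum>g\<in>Z. cscale (if fst e = A then B (fst e) (snd e) g else 0) (V g k))"
      using BQ[OF Z'D(1)[OF e] A Z'D(2)[OF e]] by (simp cong: sum.cong)
    also have "\<dots> = (if fst e = A then V' e k else 0)" by (simp add: V'_def)
    finally show ?thesis .
  qed
  ultimately show thesis using Z'D(1) by (intro that[of Z' \<kappa>' V']) auto
qed

end

section \<open>Extremality\<close>

text \<open>The form is written as a bare index sum with no dimension imposed on \<open>u\<close>
  and \<open>w\<close>, so that the induction hypothesis applies to the same two vectors with fewer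
  blocks.\<close>

lemma vinner_diag_block_mat:
  fixes Bs :: "nat \<Rightarrow> complex mat"
  assumes "\<And>i. i < L \<Longrightarrow> Bs i \<in> carrier_mat (D i) (D i)"
  shows "diag_block_mat (map Bs [0..<L]) \<in> carrier_mat (\<Sum>i<L. D i) (\<Sum>i<L. D i)"
    and "(\<Sum>r<(\<Sum>i<L. D i). \<Sum>c<(\<Sum>i<L. D i). cnj (u $ r) * diag_block_mat (map Bs [0..<L]) $$ (r, c) * w $ c)
      = (\<Sum>i<L. \<Sum>p<D i. \<Sum>q<D i. cnj (u $ ((\<Sum>i<i. D i) + p)) * Bs i $$ (p, q) * w $ ((\<Sum>i<i. D i) + q))"
  using assms
proof (induction L)
  case 0
  { case 1 then show ?case by simp next case 2 then show ?case by simp }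
next
  case (Suc L)
  define n where "n = (\<Sum>i<L. D i)"
  define M where "M = diag_block_mat (map Bs [0..<L])"
  have B: "Bs L \<in> carrier_mat (D L) (D L)" if "\<And>i. i < Suc L \<Longrightarrow> Bs i \<in> carrier_mat (D i) (D i)" using that by blast
  have M: "M \<in> carrier_mat n n" if "\<And>i. i < Suc L \<Longrightarrow> Bs i \<in> carrier_mat (D i) (D i)"
    unfolding M_def n_def using that by (intro Suc.IH(1)) simp
  have eq: "diag_block_mat (map Bs [0..<Suc L]) = four_block_mat M (0\<^sub>m n (D L)) (0\<^sub>m (D L) n) (Bs L)"
    if "\<And>i. i < Suc L \<Longrightarrow> Bs i \<in> carrier_mat (D i) (D i)"
    using M[OF that] B[OF that] by (simp add: diag_block_mat_last Let_def M_def[symmetric])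
  {
    case 1
    have "four_block_mat M (0\<^sub>m n (D L)) (0\<^sub>m (D L) n) (Bs L) \<in> carrier_mat (n + D L) (n + D L)"
      by (rule four_block_carrier_mat[OF M[OF 1] B[OF 1]])
    then show ?case using eq[OF 1] by (simp add: n_def del: upt_Suc)
  next
    case 2
    note M = M[OF 2] and B = B[OF 2]
    let ?F = "four_block_mat M (0\<^sub>m n (D L)) (0\<^sub>m (D L) n) (Bs L)"
    have "(\<Sum>r<n + D L. \<Sum>c<n + D L. cnj (u $ r) * ?F $$ (r, c) * w $ c)
      = (\<Sum>r<n. \<Sum>c<n. cnj (u $ r) * M $$ (r, c) * w $ c)
        + (\<Sum>p<D L. \<Sum>q<D L. cnj (u $ (n + p)) * Bs L $$ (p, q) * w $ (n + q))"
    proof -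
      have "?F $$ (r, c) = M $$ (r, c)" "?F $$ (r, n + q) = 0" "?F $$ (n + p, c) = 0" "?F $$ (n + p, n + q) = Bs L $$ (p, q)"
        if "r < n" "c < n" "p < D L" "q < D L" for r c p q
        using M B that by auto
      moreover have "?F $$ (r, c) = M $$ (r, c)" if "r < n" "c < n" for r c using M B that by auto
      moreover have "?F $$ (n + p, n + q) = Bs L $$ (p, q)" if "p < D L" "q < D L" for p q using M B that by auto
      ultimately show ?thesis unfolding sum_lessThan_add sum.distrib by simp
    qed
    moreover have "(\<Sum>i<Suc L. D i) = n + D L" by (simp add: n_def)
    ultimately show ?case
      using Suc.IH(2) 2 eq[OF 2] by (simp add: n_def[symmetric] M_def[symmetric] del: upt_Suc)
  }
qed

lemma block_vector_exists:
  fixes f :: "nat \<Rightarrow> nat \<Rightarrow> complex"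
  shows "\<exists>w\<in>carrier_vec (\<Sum>i<L. D i). \<forall>i<L. \<forall>p<D i. w $ ((\<Sum>i<i. D i) + p) = f i p"
proof (induction L)
  case 0
  show ?case by (intro bexI[of _ "0\<^sub>v 0"]) auto
next
  case (Suc L)
  then obtain w where w: "w \<in> carrier_vec (\<Sum>i<L. D i)" "\<And>i p. i < L \<Longrightarrow> p < D i \<Longrightarrow> w $ ((\<Sum>i<i. D i) + p) = f i p" by blast
  let ?w = "w @\<^sub>v vec (D L) (f L)"
  have "?w $ ((\<Sum>i<i. D i) + p) = f i p" if "i < Suc L" "p < D i" for i p
  proof (cases "i = L")
    case True
    then show ?thesis using w(1) that by simp
  next
    case False
    then have i: "i < L" using that by simp
    have "(\<Sum>i<i. D i) + D i = (\<Sum>i<Suc i. D i)" by simp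
    also have "\<dots> \<le> (\<Sum>i<L. D i)" using i by (intro sum_mono2) auto
    finally have "(\<Sum>i<i. D i) + p < (\<Sum>i<L. D i)" using that by simp
    then show ?thesis using w that i by simp
  qed
  moreover have "?w \<in> carrier_vec (\<Sum>i<Suc L. D i)" using w(1) by simp
  ultimately show ?case by blast
qed

text \<open>In the index \<open>j * m + s\<close> the multiplicity coordinate \<open>s\<close> runs
  fast. Fixing it exhibits \<open>M \<otimes> 1\<close> as \<open>m\<close> independent copies of
  \<open>M\<close>.\<close>

lemma tensor_id_sum:
  assumes "M \<in> carrier_mat d d"
  shows "(\<Sum>p<d * m. \<Sum>q<d * m. cnj (u p) * tensor_id M m $$ (p, q) * w q)
    = (\<Sum>s<m. \<Sum>j<d. \<Sum>k<d. cnj (u (j * m + s)) * M $$ (j, k) * w (k * m + s))"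
proof -
  define F where "F j s k t = cnj (u (j * m + s)) * (if s = t then M $$ (j, k) else 0) * w (k * m + t)" for j s k t
  have "(\<Sum>p<d * m. \<Sum>q<d * m. cnj (u p) * tensor_id M m $$ (p, q) * w q)
      = (\<Sum>p<d * m. \<Sum>q<d * m. F (p div m) (p mod m) (q div m) (q mod m))"
    using assms by (intro sum.cong refl) (simp add: F_def tensor_id_def)
  also have "\<dots> = (\<Sum>p<d * m. \<Sum>k<d. \<Sum>t<m. F (p div m) (p mod m) k t)"
    by (intro sum.cong refl sum_div_mod)
  also have "\<dots> = (\<Sum>j<d. \<Sum>s<m. \<Sum>k<d. \<Sum>t<m. F j s k t)" by (rule sum_div_mod)
  also have "\<dots> = (\<Sum>j<d. \<Sum>s<m. \<Sum>k<d. cnj (u (j * m + s)) * M $$ (j, k) * w (k * m + s))"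
    by (intro sum.cong refl)
      (simp add: F_def if_distrib[of "\<lambda>z. _ * z"] if_distrib[of "\<lambda>z. z * _"] cong: if_cong)
  also have "\<dots> = (\<Sum>s<m. \<Sum>j<d. \<Sum>k<d. cnj (u (j * m + s)) * M $$ (j, k) * w (k * m + s))"
    by (rule sum.swap)
  finally show ?thesis .
qed

text \<open>A label \<open>(i, s)\<close> stands for the \<open>s\<close>-th copy of
  \<open>H_i\<close>. Its map \<open>V\<close> picks the coordinates of \<open>W h\<close> that
  belong to this copy and sends them into the representation space by \<open>V_i\<close>; thus
  \<open>\<kappa>\<close> is \<open>fst\<close>, and surjectivity amounts to prescribing all
  coordinates of \<open>W h\<close>.\<close>

lemma nest_system_of_decomposition:
  fixes m :: "nat \<Rightarrow> nat"
  assumes sn: "stinespring_nest L d \<psi> \<pi> v" and cp: "cp_map N \<phi>" and unital: "\<phi> 1 = 1\<^sub>m N"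
    and dimN: "N = (\<Sum>i<L. d i * m i)" and W: "unitary_mat N W"
    and decomp: "\<forall>a. \<phi> a = madj W * diag_block_mat (map (\<lambda>i. tensor_id (\<psi> i a) (m i)) [0..<L]) * W"
  obtains Z :: "(nat \<times> nat) set" and \<kappa> V where "nest_system L d \<psi> \<pi> v N \<phi> Z \<kappa> V"
proof -
  interpret stinespring_nest L d \<psi> \<pi> v by (rule sn)
  define off where "off i = (\<Sum>i<i. d i * m i)" for i
  define Z where "Z = (SIGMA i:{..<L}. {..<m i})"
  define V where "V e h = (\<Sum>j<d (fst e). cscale ((W *\<^sub>v h) $ (off (fst e) + (j * m (fst e) + snd e))) (v (fst e) j))"
    for e h
  have Wc: "W \<in> carrier_mat N N" "W * madj W = 1\<^sub>m N" using W unfolding unitary_mat_def by auto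
  have bound: "off (fst e) + (j * m (fst e) + snd e) < N" if "e \<in> Z" "j < d (fst e)" for e j
  proof -
    have e: "fst e < L" "snd e < m (fst e)" using that by (auto simp: Z_def)
    have "j * m (fst e) + snd e < Suc j * m (fst e)" using e by simp
    also have "\<dots> \<le> d (fst e) * m (fst e)" using that(2) by (intro mult_right_mono) auto
    also have "off (fst e) + d (fst e) * m (fst e) = off (Suc (fst e))" by (simp add: off_def)
    moreover have "off (Suc (fst e)) \<le> N" unfolding off_def dimN using e by (intro sum_mono2) auto
    ultimately show ?thesis by linarith
  qed
  have "nest_system L d \<psi> \<pi> v N \<phi> Z fst V"
  proof (intro nest_system.intro nest_system_axioms.intro sn cp unital)
    show "finite Z" by (simp add: Z_def)
    fix e assume e: "e \<in> Z"
    then show "fst e < L" by (auto simp: Z_def)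
    fix h :: "complex vec" assume h: "h \<in> carrier_vec N"
    show "V e h \<in> R (fst e)" unfolding V_def by (intro R_sum R_cscale R_v) simp
    show "V e (c \<cdot>\<^sub>v h) = cscale c (V e h)" for c
    proof -
      have "(W *\<^sub>v (c \<cdot>\<^sub>v h)) $ r = c * (W *\<^sub>v h) $ r" if "r < N" for r
        using Wc(1) h that by (simp add: mult_mat_vec[OF Wc(1) h])
      then show ?thesis
        unfolding V_def cscale_sum_right cscale_cscale using bound[OF e] by (intro sum.cong refl) simp
    qed
    fix k :: "complex vec" assume k: "k \<in> carrier_vec N"
    have "(W *\<^sub>v (h + k)) $ r = (W *\<^sub>v h) $ r + (W *\<^sub>v k) $ r" if "r < N" for r
      using Wc(1) h k that by (simp add: mult_add_distrib_mat_vec[OF Wc(1) h k])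
    then show "V e (h + k) = V e h + V e k"
      unfolding V_def sum.distrib[symmetric] using bound[OF e]
      by (intro sum.cong refl) (simp add: cscale_add_left)
  next
    fix h k :: "complex vec" and a assume h: "h \<in> carrier_vec N" and k: "k \<in> carrier_vec N"
    define u w where "u = W *\<^sub>v h" and "w = W *\<^sub>v k"
    let ?B = "\<lambda>i. tensor_id (\<psi> i a) (m i)"
    have \<psi>: "\<psi> i a \<in> carrier_mat (d i) (d i)" if "i < L" for i using stinespring that by simp
    then have B: "?B i \<in> carrier_mat (d i * m i) (d i * m i)" if "i < L" for i
      using \<psi>[OF that] by (simp add: tensor_id_def)
    have D: "diag_block_mat (map ?B [0..<L]) \<in> carrier_mat N N"
      using vinner_diag_block_mat(1)[OF B] by (simp add: dimN)
    have "vinner h (\<phi> a *\<^sub>v k) = vinner u (diag_block_mat (map ?B [0..<L]) *\<^sub>v w)"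
      unfolding decomp[rule_format] u_def w_def by (rule vinner_compress[OF D Wc(1) h k])
    also have "\<dots> = (\<Sum>i<L. \<Sum>p<d i * m i. \<Sum>q<d i * m i. cnj (u $ (off i + p)) * ?B i $$ (p, q) * w $ (off i + q))"
    proof -
      have "w \<in> carrier_vec N" unfolding w_def by (rule mult_mat_vec_carrier[OF Wc(1) k])
      from vinner_mult_mat_vec[OF D this] show ?thesis
        unfolding off_def dimN by (rule trans) (rule vinner_diag_block_mat(2)[OF B])
    qed
    also have "\<dots> = (\<Sum>i<L. \<Sum>s<m i. \<Sum>j<d i. \<Sum>k<d i.
        cnj (u $ (off i + (j * m i + s))) * \<psi> i a $$ (j, k) * w $ (off i + (k * m i + s)))"
    proof (rule sum.cong[OF refl])
      fix i assume "i \<in> {..<L}"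
      then have "\<psi> i a \<in> carrier_mat (d i) (d i)" using \<psi> by simp
      from tensor_id_sum[OF this, where m = "m i" and u = "\<lambda>p. u $ (off i + p)" and w = "\<lambda>p. w $ (off i + p)"]
      show "(\<Sum>p<d i * m i. \<Sum>q<d i * m i. cnj (u $ (off i + p)) * ?B i $$ (p, q) * w $ (off i + q))
        = (\<Sum>s<m i. \<Sum>j<d i. \<Sum>k<d i.
            cnj (u $ (off i + (j * m i + s))) * \<psi> i a $$ (j, k) * w $ (off i + (k * m i + s)))" .
    qed
    also have "\<dots> = (\<Sum>i<L. \<Sum>s<m i. cinner (V (i, s) h) (\<pi> a (V (i, s) k)))"
    proof (intro sum.cong refl)
      fix i s assume "i \<in> {..<L}"
      then have "\<psi> i a $$ (j, k) = cinner (v i j) (\<pi> a (v i k))" if "j < d i" "k < d i" for j k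
        using stinespring that by simp
      then show "(\<Sum>j<d i. \<Sum>k<d i. cnj (u $ (off i + (j * m i + s))) * \<psi> i a $$ (j, k) * w $ (off i + (k * m i + s)))
          = cinner (V (i, s) h) (\<pi> a (V (i, s) k))"
        unfolding V_def rep_sum rep_cscale cinner_double_sum fst_conv snd_conv u_def[symmetric] w_def[symmetric]
        by (intro sum.cong refl) simp
    qed
    also have "\<dots> = (\<Sum>e\<in>Z. cinner (V e h) (\<pi> a (V e k)))"
      unfolding Z_def by (subst sum.Sigma) (auto simp: case_prod_beta)
    finally show "vinner h (\<phi> a *\<^sub>v k) = (\<Sum>e\<in>Z. cinner (V e h) (\<pi> a (V e k)))" .
  next
    fix \<xi> assume \<xi>: "\<And>e. e \<in> Z \<Longrightarrow> \<xi> e \<in> R (fst e)"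
    have "\<exists>c. \<xi> e = (\<Sum>j<d (fst e). cscale (c j) (v (fst e) j))" if "e \<in> Z" for e
      using cspan_image_lessThan[OF \<xi>[OF that, unfolded R_def]] by blast
    then obtain c where c: "\<And>e. e \<in> Z \<Longrightarrow> \<xi> e = (\<Sum>j<d (fst e). cscale (c e j) (v (fst e) j))" by metis
    \<comment> \<open>Inside block \<open>i\<close> the position \<open>p = j * m i + s\<close> is
      decoded as \<open>s = p mod m i\<close> and \<open>j = p div m i\<close>.\<close>
    obtain w where w: "w \<in> carrier_vec N"
      "\<And>i p. i < L \<Longrightarrow> p < d i * m i \<Longrightarrow> w $ (off i + p) = c (i, p mod m i) (p div m i)"
      using block_vector_exists[where L = L and D = "\<lambda>i. d i * m i" and f = "\<lambda>i p. c (i, p mod m i) (p div m i)"]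
      unfolding off_def dimN by blast
    define h where "h = madj W *\<^sub>v w"
    have h: "h \<in> carrier_vec N" unfolding h_def by (rule mult_mat_vec_carrier[OF madj_carrier[OF Wc(1)] w(1)])
    have Wh: "W *\<^sub>v h = w"
      unfolding h_def using assoc_mult_mat_vec[OF Wc(1) madj_carrier[OF Wc(1)] w(1)] Wc(2) w(1) by simp
    have "V e h = \<xi> e" if e: "e \<in> Z" for e
      unfolding V_def Wh c[OF e]
    proof (intro sum.cong refl)
      fix j assume j: "j \<in> {..<d (fst e)}"
      have e': "fst e < L" "snd e < m (fst e)" using e by (auto simp: Z_def)
      have "j * m (fst e) + snd e < Suc j * m (fst e)" using e' by simp
      also have "\<dots> \<le> d (fst e) * m (fst e)" using j by (intro mult_right_mono) auto
      finally show "cscale (w $ (off (fst e) + (j * m (fst e) + snd e))) (v (fst e) j) = cscale (c e j) (v (fst e) j)"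
        using w(2)[OF e'(1)] e'(2) by simp
    qed
    with h show "\<exists>h\<in>carrier_vec N. \<forall>e\<in>Z. V e h = \<xi> e" by blast
  qed
  then show thesis by (rule that)
qed

section \<open>Lifting nest algebra matrices to operators on H\<close>

context nest_system
begin

text \<open>The basis expansion is verified through inner products in \<open>H\<close>: the family
  on the right is admissible, and its lift by \<open>Vinv\<close> has the same inner products as
  \<open>h\<close>.\<close>

lemma V_unit_sum:
  assumes e: "e \<in> Z" and h: "h \<in> carrier_vec N"
  shows "V e h = (\<Sum>j<N. cscale (h $ j) (V e (unit_vec N j)))"
proof -
  define \<xi> where "\<xi> e = (\<Sum>j<N. cscale (h $ j) (V e (unit_vec N j)))" for e
  have \<xi>: "\<xi> e \<in> R (\<kappa> e)" if "e \<in> Z" for e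
    unfolding \<xi>_def using V_range[OF that] by (intro R_sum R_cscale) auto
  have "Vinv \<xi> = h"
  proof (rule vec_eq_vinnerI[OF Vinv(1)[OF \<xi>] h])
    fix w :: "complex vec" assume w: "w \<in> carrier_vec N"
    have "vinner w (Vinv \<xi>) = (\<Sum>e\<in>Z. cinner (V e w) (\<xi> e))"
      using V_inner[OF w Vinv(1)[OF \<xi>]] Vinv(2)[OF \<xi>] by (simp cong: sum.cong)
    also have "\<dots> = (\<Sum>e\<in>Z. \<Sum>j<N. h $ j * cinner (V e w) (V e (unit_vec N j)))"
      by (simp add: \<xi>_def cinner_sum_right cinner_cscale_right)
    also have "\<dots> = (\<Sum>j<N. \<Sum>e\<in>Z. h $ j * cinner (V e w) (V e (unit_vec N j)))" by (rule sum.swap)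
    also have "\<dots> = (\<Sum>j<N. h $ j * vinner w (unit_vec N j))"
      using V_inner[OF w] by (simp add: sum_distrib_left)
    also have "\<dots> = (\<Sum>j<N. h $ j * cnj (w $ j))"
      using w vinner_cnj[of w "unit_vec N _"] vinner_unit[OF w] by (intro sum.cong refl) simp
    also have "\<dots> = vinner w h" using h by (simp add: vinner_def mult.commute)
    finally show "vinner w (Vinv \<xi>) = vinner w h" .
  qed
  then have "V e h = \<xi> e" using Vinv(2)[OF \<xi>, where e = e] e by simp
  then show ?thesis by (simp only: \<xi>_def)
qed

text \<open>Condition \<open>supp\<close> says that \<open>S\<close> belongs to the nest algebra, so that it lifts to \<open>\<complex>\<^sup>N\<close>.\<close>
lemma nest_algebra_lift:
  assumes supp: "\<And>e f. e \<in> Z \<Longrightarrow> f \<in> Z \<Longrightarrow> S e f \<noteq> 0 \<Longrightarrow> R (\<kappa> f) \<subseteq> R (\<kappa> e)"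
  obtains M where "M \<in> carrier_mat N N"
    "\<And>e h. e \<in> Z \<Longrightarrow> h \<in> carrier_vec N \<Longrightarrow> V e (M *\<^sub>v h) = (\<Sum>f\<in>Z. cscale (S e f) (V f h))"
proof -
  define \<zeta> where "\<zeta> h e = (\<Sum>f\<in>Z. cscale (S e f) (V f h))" for h e
  have \<zeta>: "\<zeta> h e \<in> R (\<kappa> e)" if "h \<in> carrier_vec N" "e \<in> Z" for h e
    unfolding \<zeta>_def
  proof (rule R_sum)
    fix f assume f: "f \<in> Z"
    show "cscale (S e f) (V f h) \<in> R (\<kappa> e)"
    proof (cases "S e f = 0")
      case False
      then show ?thesis using supp[OF that(2) f] V_range[OF f that(1)] by (intro R_cscale) auto
    qed (simp add: R_zero)
  qed
  \<comment> \<open>Defined by columns: each one is the lift of the family that \<open>S\<close>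
    produces from a basis vector.\<close>
  define M where "M = mat N N (\<lambda>(r, j). Vinv (\<zeta> (unit_vec N j)) $ r)"
  have M: "M \<in> carrier_mat N N" by (simp add: M_def)
  have "V e (M *\<^sub>v h) = (\<Sum>f\<in>Z. cscale (S e f) (V f h))" if e: "e \<in> Z" and h: "h \<in> carrier_vec N" for e h
  proof -
    have \<zeta>h: "\<And>e. e \<in> Z \<Longrightarrow> \<zeta> h e \<in> R (\<kappa> e)" using \<zeta>[OF h] .
    have \<zeta>u: "\<And>e. e \<in> Z \<Longrightarrow> \<zeta> (unit_vec N j) e \<in> R (\<kappa> e)" for j using \<zeta>[of "unit_vec N j"] by simp
    have "M *\<^sub>v h = Vinv (\<zeta> h)"
    proof (rule vec_eq_vinnerI[OF mult_mat_vec_carrier[OF M h] Vinv(1)[OF \<zeta>h]])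
      fix w :: "complex vec" assume w: "w \<in> carrier_vec N"
      have col: "(\<Sum>r<N. cnj (w $ r) * M $$ (r, j)) = (\<Sum>e\<in>Z. cinner (V e w) (\<zeta> (unit_vec N j) e))" if "j < N" for j
      proof -
        have "(\<Sum>r<N. cnj (w $ r) * M $$ (r, j)) = vinner w (Vinv (\<zeta> (unit_vec N j)))"
          using Vinv(1)[OF \<zeta>u[of _ j]] that by (simp add: vinner_def M_def)
        then show ?thesis using V_inner[OF w Vinv(1)[OF \<zeta>u]] Vinv(2)[OF \<zeta>u] by (simp cong: sum.cong)
      qed
      have "vinner w (M *\<^sub>v h) = (\<Sum>j<N. (\<Sum>r<N. cnj (w $ r) * M $$ (r, j)) * h $ j)"
        unfolding vinner_mult_mat_vec[OF M h] sum_distrib_right by (rule sum.swap)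
      also have "\<dots> = (\<Sum>j<N. \<Sum>e\<in>Z. cinner (V e w) (cscale (h $ j) (\<zeta> (unit_vec N j) e)))"
        using col by (simp add: sum_distrib_right sum_distrib_left cinner_cscale_right mult.commute)
      also have "\<dots> = (\<Sum>e\<in>Z. cinner (V e w) (\<Sum>j<N. cscale (h $ j) (\<zeta> (unit_vec N j) e)))"
        unfolding cinner_sum_right by (rule sum.swap)
      also have "\<dots> = (\<Sum>e\<in>Z. cinner (V e w) (\<zeta> h e))"
      proof (intro sum.cong refl arg_cong[of _ _ "cinner _"])
        fix e
        have "(\<Sum>j<N. cscale (h $ j) (\<zeta> (unit_vec N j) e)) = (\<Sum>f\<in>Z. \<Sum>j<N. cscale (h $ j) (cscale (S e f) (V f (unit_vec N j))))"
          unfolding \<zeta>_def cscale_sum_right by (rule sum.swap)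
        also have "\<dots> = (\<Sum>f\<in>Z. cscale (S e f) (\<Sum>j<N. cscale (h $ j) (V f (unit_vec N j))))"
          by (simp add: cscale_sum_right cscale_cscale mult.commute)
        also have "\<dots> = \<zeta> h e"
          unfolding \<zeta>_def using V_unit_sum[OF _ h] by (intro sum.cong refl) simp
        finally show "(\<Sum>j<N. cscale (h $ j) (\<zeta> (unit_vec N j) e)) = \<zeta> h e" .
      qed
      also have "\<dots> = vinner w (Vinv (\<zeta> h))"
        using V_inner[OF w Vinv(1)[OF \<zeta>h]] Vinv(2)[OF \<zeta>h] by (simp cong: sum.cong)
      finally show "vinner w (M *\<^sub>v h) = vinner w (Vinv (\<zeta> h))" .
    qed
    then have "V e (M *\<^sub>v h) = \<zeta> h e" using Vinv(2)[OF \<zeta>h e] by simp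
    then show ?thesis by (simp only: \<zeta>_def)
  qed
  with M show thesis by (rule that)
qed

end

section \<open>Factorization of dominated instruments\<close>

context nest_instrument
begin

text \<open>Components that are eigenvectors for the atoms are eigenvectors for the projection of
  every measurable set, with eigenvalue 1 exactly when their atom occurs in the representation
  \<open>S\<close> of that set.\<close>

lemma mu_eigen:
  assumes eig: "\<And>e A k. e \<in> Z \<Longrightarrow> A \<in> \<P> \<Longrightarrow> k \<in> carrier_vec N \<Longrightarrow> V e (I A 1 *\<^sub>v k) = (if \<alpha> e = A then V e k else 0)"
    and P: "finite \<P>" "\<P> \<subseteq> sets X" and B: "B \<in> sets X"
    and S: "S \<subseteq> \<P>" "\<And>h k. h \<in> carrier_vec N \<Longrightarrow> k \<in> carrier_vec N \<Longrightarrow> m B h k = (\<Sum>A\<in>S. m A h k)"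
    and e: "e \<in> Z" and k: "k \<in> carrier_vec N"
  shows "V e (I B 1 *\<^sub>v k) = (if \<alpha> e \<in> S then V e k else 0)"
proof -
  define z where "z = (if \<alpha> e \<in> S then V e k else 0)"
  define y where "y = V e (I B 1 *\<^sub>v k) - z"
  have finS: "finite S" using S(1) P(1) finite_subset by blast
  have "cinner x y = 0" if x: "x \<in> R (\<kappa> e)" for x
  proof -
    let ?h = "Vinv (dl e x)"
    have h: "?h \<in> carrier_vec N" by (rule Vinv_dl(1)[OF x])
    have single: "vinner ?h w = cinner x (V e w)" if "w \<in> carrier_vec N" for w
      using V_inner[OF h that] Vinv_dl(2)[OF x] e fin
      by (simp add: if_distrib[of "\<lambda>z. cinner z _"] cong: sum.cong if_cong)
    have "cinner x (V e (I B 1 *\<^sub>v k)) = (\<Sum>A\<in>S. m A ?h k)"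
      using single[OF mu_vec[OF B k]] S(2)[OF h k] by simp
    also have "\<dots> = (\<Sum>A\<in>S. if A = \<alpha> e then cinner x (V e k) else 0)"
    proof (rule sum.cong[OF refl])
      fix A assume "A \<in> S"
      then have A: "A \<in> \<P>" "A \<in> sets X" using S(1) P(2) by auto
      show "m A ?h k = (if A = \<alpha> e then cinner x (V e k) else 0)"
        using single[OF mu_vec[OF A(2) k]] eig[OF e A(1) k] by auto
    qed
    also have "\<dots> = cinner x z" using finS by (simp add: z_def)
    finally show ?thesis by (simp add: y_def cinner_diff_right)
  qed
  moreover have "y \<in> R (\<kappa> e)"
  proof -
    have "y = V e (I B 1 *\<^sub>v k) + cscale (-1) z"
      unfolding y_def using cscale_minus_left[of 1 z] by (simp add: cscale_one)
    then show ?thesis using V_range[OF e k] V_range[OF e mu_vec[OF B k]] R_zero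
      by (auto simp: z_def intro!: R_add R_cscale)
  qed
  ultimately have "y = 0" using cinner_eq_zero_iff by blast
  then show ?thesis by (simp add: y_def z_def)
qed

text \<open>The Radon-Nikodym derivative of a dominated instrument has a Cholesky factor which lies in the
  nest algebra and commutes with the spectral measure.\<close>
lemma dominated_factorization:
  assumes P: "finite \<P>" "\<P> \<subseteq> sets X"
    and gen: "\<And>B. B \<in> sets X \<Longrightarrow> \<exists>S\<subseteq>\<P>. \<forall>h\<in>carrier_vec N. \<forall>k\<in>carrier_vec N. m B h k = (\<Sum>A\<in>S. m A h k)"
    and total: "\<And>h k. h \<in> carrier_vec N \<Longrightarrow> k \<in> carrier_vec N \<Longrightarrow> vinner h k = (\<Sum>A\<in>\<P>. m A h k)"
    and \<alpha>: "\<And>e. e \<in> Z \<Longrightarrow> \<alpha> e \<in> \<P>"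
    and eig: "\<And>e A k. e \<in> Z \<Longrightarrow> A \<in> \<P> \<Longrightarrow> k \<in> carrier_vec N \<Longrightarrow> V e (I A 1 *\<^sub>v k) = (if \<alpha> e = A then V e k else 0)"
    and T: "cp_instrument X N \<Theta>"
    and le: "\<And>A xs. A \<in> sets X \<Longrightarrow> vec_list N xs \<Longrightarrow> Re (cp_form (\<Theta> A) xs xs) \<le> Re (cp_form (I A) xs xs)"
  obtains M where "M \<in> carrier_mat N N"
    "\<And>A a h k. A \<in> sets X \<Longrightarrow> h \<in> carrier_vec N \<Longrightarrow> k \<in> carrier_vec N \<Longrightarrow>
      vinner h (\<Theta> A a *\<^sub>v k) = vinner (M *\<^sub>v h) (I A a *\<^sub>v (M *\<^sub>v k))"
proof -
  have PX: "A \<in> sets X" if "A \<in> \<P>" for A using P(2) that by blast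
  have cpT: "cp_map N (\<Theta> A)" if "A \<in> sets X" for A using T that unfolding cp_instrument_def by blast
  have dom: "Re (vinner k (\<Theta> A 1 *\<^sub>v k)) \<le> Re (m A k k)" if "A \<in> sets X" "k \<in> carrier_vec N" for A k
    using le[OF that(1), of "[(1, k)]"] that(2) by (simp add: cp_form_single)
  \<comment> \<open>Both one-sided absorptions combined through idempotency. The instrument
    \<open>\<Psi>\<close> is generic because \<open>\<Theta>\<close> and \<open>I\<close> itself are
    both substituted.\<close>
  have sandwich: "vinner h (\<Psi> A a *\<^sub>v k) = vinner (I A 1 *\<^sub>v h) (\<Psi> (space X) a *\<^sub>v (I A 1 *\<^sub>v k))"
    if \<Psi>: "cp_instrument X N \<Psi>" and dom: "\<And>A k. A \<in> sets X \<Longrightarrow> k \<in> carrier_vec N \<Longrightarrow> Re (vinner k (\<Psi> A 1 *\<^sub>v k)) \<le> Re (m A k k)"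
      and A: "A \<in> sets X" and h: "h \<in> carrier_vec N" and k: "k \<in> carrier_vec N" for \<Psi> A a h k
  proof -
    note kA = mu_vec[OF A k]
    have "vinner h (\<Psi> A a *\<^sub>v k) = vinner h (\<Psi> (space X) a *\<^sub>v (I A 1 *\<^sub>v k))"
      by (rule instrument_absorb(1)[OF \<Psi> dom A h k])
    also have "\<dots> = vinner h (\<Psi> A a *\<^sub>v (I A 1 *\<^sub>v k))"
      using instrument_absorb(1)[OF \<Psi> dom A h kA, of a] mu_idem[OF A k] by simp
    also have "\<dots> = vinner (I A 1 *\<^sub>v h) (\<Psi> (space X) a *\<^sub>v (I A 1 *\<^sub>v k))"
      by (rule instrument_absorb(2)[OF \<Psi> dom A h kA])
    finally show ?thesis .
  qed
  have sT: "vinner h (\<Theta> A a *\<^sub>v k) = vinner (I A 1 *\<^sub>v h) (\<Theta> (space X) a *\<^sub>v (I A 1 *\<^sub>v k))"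
    and sI: "vinner h (I A a *\<^sub>v k) = vinner (I A 1 *\<^sub>v h) (I (space X) a *\<^sub>v (I A 1 *\<^sub>v k))"
    if "A \<in> sets X" "h \<in> carrier_vec N" "k \<in> carrier_vec N" for A a h k
    by (rule sandwich[OF T _ that], erule (1) dom) (rule sandwich[OF instr _ that], rule order_refl)
  obtain D where psd: "psd_form Z D" and D: "\<And>a h k. h \<in> carrier_vec N \<Longrightarrow> k \<in> carrier_vec N \<Longrightarrow>
      vinner h (\<Theta> (space X) a *\<^sub>v k) = (\<Sum>e\<in>Z. \<Sum>f\<in>Z. D e f * cinner (V e h) (\<pi> a (V f k)))"
    using radon_nikodym[OF cpT[OF sets.top] le[OF sets.top]] by blast
  \<comment> \<open>Instead of showing that \<open>D\<close> commutes with the spectral measure,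
    \<open>D\<close> is replaced by its diagonal blocks. They represent the same map: inserting the
    resolution of the identity next to \<open>k\<close> and absorbing each projection on both sides
    cancels the couplings between different atoms.\<close>
  define D' where "D' e f = (if \<alpha> e = \<alpha> f then D e f else 0)" for e f
  have psd': "psd_form Z D'" unfolding D'_def by (rule psd_form_block_diagonal[OF fin psd])
  have D': "vinner h (\<Theta> (space X) a *\<^sub>v k) = (\<Sum>e\<in>Z. \<Sum>f\<in>Z. D' e f * cinner (V e h) (\<pi> a (V f k)))"
    if h: "h \<in> carrier_vec N" and k: "k \<in> carrier_vec N" for a h k
  proof -
    have cX: "\<Theta> (space X) a \<in> carrier_mat N N" by (rule cp_instrument_carrier[OF T sets.top])
    define h' where "h' = madj (\<Theta> (space X) a) *\<^sub>v h"
    have h': "h' \<in> carrier_vec N" unfolding h'_def by (rule mult_mat_vec_carrier[OF madj_carrier[OF cX] h])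
    have adj: "vinner h (\<Theta> (space X) a *\<^sub>v w) = vinner h' w" if "w \<in> carrier_vec N" for w
      unfolding h'_def using vinner_madj[OF madj_carrier[OF cX] h that] by simp
    have "vinner h (\<Theta> (space X) a *\<^sub>v k) = (\<Sum>A\<in>\<P>. vinner h (\<Theta> (space X) a *\<^sub>v (I A 1 *\<^sub>v k)))"
      using adj[OF k] adj[OF mu_vec[OF PX k]] total[OF h' k] by (simp cong: sum.cong)
    also have "\<dots> = (\<Sum>A\<in>\<P>. vinner (I A 1 *\<^sub>v h) (\<Theta> (space X) a *\<^sub>v (I A 1 *\<^sub>v k)))"
    proof (rule sum.cong[OF refl])
      fix A assume "A \<in> \<P>"
      then have A: "A \<in> sets X" by (rule PX)
      have "vinner h (\<Theta> A a *\<^sub>v k) = vinner h (\<Theta> (space X) a *\<^sub>v (I A 1 *\<^sub>v k))"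
        by (rule instrument_absorb(1)[OF T _ A h k]) (erule (1) dom)
      with sT[OF A h k] show "vinner h (\<Theta> (space X) a *\<^sub>v (I A 1 *\<^sub>v k))
          = vinner (I A 1 *\<^sub>v h) (\<Theta> (space X) a *\<^sub>v (I A 1 *\<^sub>v k))" by simp
    qed
    also have "\<dots> = (\<Sum>A\<in>\<P>. \<Sum>e\<in>Z. \<Sum>f\<in>Z. if A = \<alpha> e then D' e f * cinner (V e h) (\<pi> a (V f k)) else 0)"
    proof (rule sum.cong[OF refl])
      fix A assume A: "A \<in> \<P>"
      show "vinner (I A 1 *\<^sub>v h) (\<Theta> (space X) a *\<^sub>v (I A 1 *\<^sub>v k))
          = (\<Sum>e\<in>Z. \<Sum>f\<in>Z. if A = \<alpha> e then D' e f * cinner (V e h) (\<pi> a (V f k)) else 0)"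
        unfolding D[OF mu_vec[OF PX[OF A] h] mu_vec[OF PX[OF A] k]]
        by (intro sum.cong refl) (auto simp: eig[OF _ A h] eig[OF _ A k] D'_def)
    qed
    also have "\<dots> = (\<Sum>e\<in>Z. \<Sum>A\<in>\<P>. \<Sum>f\<in>Z. if A = \<alpha> e then D' e f * cinner (V e h) (\<pi> a (V f k)) else 0)"
      by (rule sum.swap)
    also have "\<dots> = (\<Sum>e\<in>Z. \<Sum>f\<in>Z. \<Sum>A\<in>\<P>. if A = \<alpha> e then D' e f * cinner (V e h) (\<pi> a (V f k)) else 0)"
      by (rule sum.cong[OF refl], rule sum.swap)
    also have "\<dots> = (\<Sum>e\<in>Z. \<Sum>f\<in>Z. D' e f * cinner (V e h) (\<pi> a (V f k)))"
      using \<alpha> P(1) by (intro sum.cong refl) simp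
    finally show ?thesis .
  qed
  \<comment> \<open>The order is inclusion of the spaces \<open>R (\<kappa> e)\<close>, and the
    blocks are the atoms.\<close>
  have "\<exists>S. (\<forall>e\<in>Z. \<forall>f\<in>Z. S e f \<noteq> 0 \<longrightarrow> R (\<kappa> f) \<subseteq> R (\<kappa> e) \<and> \<alpha> e = \<alpha> f)
      \<and> (\<forall>f\<in>Z. \<forall>g\<in>Z. D' f g = (\<Sum>e\<in>Z. cnj (S e f) * S e g))"
    by (rule cholesky[OF fin psd']) (use R_linear idx in \<open>auto simp: D'_def split: if_splits\<close>)
  then obtain S where S1: "\<forall>e\<in>Z. \<forall>f\<in>Z. S e f \<noteq> 0 \<longrightarrow> R (\<kappa> f) \<subseteq> R (\<kappa> e) \<and> \<alpha> e = \<alpha> f"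
    and S2: "\<forall>f\<in>Z. \<forall>g\<in>Z. D' f g = (\<Sum>e\<in>Z. cnj (S e f) * S e g)" by (elim exE conjE) (rule that)
  obtain M where M: "M \<in> carrier_mat N N"
    and VM: "\<And>e h. e \<in> Z \<Longrightarrow> h \<in> carrier_vec N \<Longrightarrow> V e (M *\<^sub>v h) = (\<Sum>f\<in>Z. cscale (S e f) (V f h))"
    using nest_algebra_lift[of S] S1 by blast
  have Mv: "M *\<^sub>v h \<in> carrier_vec N" if "h \<in> carrier_vec N" for h by (rule mult_mat_vec_carrier[OF M that])
  have factor: "vinner h (\<Theta> (space X) a *\<^sub>v k) = vinner (M *\<^sub>v h) (I (space X) a *\<^sub>v (M *\<^sub>v k))"
    if h: "h \<in> carrier_vec N" and k: "k \<in> carrier_vec N" for a h k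
  proof -
    have "vinner (M *\<^sub>v h) (I (space X) a *\<^sub>v (M *\<^sub>v k))
        = (\<Sum>e\<in>Z. \<Sum>f\<in>Z. \<Sum>g\<in>Z. cnj (S e f) * S e g * cinner (V f h) (\<pi> a (V g k)))"
      unfolding V_dilation[OF Mv[OF h] Mv[OF k]]
      by (intro sum.cong refl) (simp add: VM[OF _ h] VM[OF _ k] rep_sum rep_cscale cinner_double_sum)
    also have "\<dots> = (\<Sum>f\<in>Z. \<Sum>g\<in>Z. \<Sum>e\<in>Z. cnj (S e f) * S e g * cinner (V f h) (\<pi> a (V g k)))"
      by (subst sum.swap, rule sum.cong[OF refl], rule sum.swap)
    also have "\<dots> = (\<Sum>f\<in>Z. \<Sum>g\<in>Z. D' f g * cinner (V f h) (\<pi> a (V g k)))"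
      using S2 by (intro sum.cong refl) (simp add: sum_distrib_right)
    finally show ?thesis using D'[OF h k] by simp
  qed
  \<comment> \<open>\<open>S\<close> joins only labels with the same atom, and on these a given
    projection has the same eigenvalue.\<close>
  have commute: "M *\<^sub>v (I A 1 *\<^sub>v k) = I A 1 *\<^sub>v (M *\<^sub>v k)" if A: "A \<in> sets X" and k: "k \<in> carrier_vec N" for A k
  proof -
    obtain Q where "Q \<subseteq> \<P>" "\<forall>h\<in>carrier_vec N. \<forall>k\<in>carrier_vec N. m A h k = (\<Sum>B\<in>Q. m B h k)"
      using gen[OF A] by blast
    then have mu: "V e (I A 1 *\<^sub>v k) = (if \<alpha> e \<in> Q then V e k else 0)" if "e \<in> Z" "k \<in> carrier_vec N" for e k
      using mu_eigen[OF eig P A _ _ that] by blast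
    show ?thesis
    proof (rule V_inj)
      fix e assume e: "e \<in> Z"
      have "V e (M *\<^sub>v (I A 1 *\<^sub>v k)) = (\<Sum>f\<in>Z. cscale (S e f) (if \<alpha> f \<in> Q then V f k else 0))"
        using VM[OF e mu_vec[OF A k]] mu[OF _ k] by (simp cong: sum.cong)
      also have "\<dots> = (\<Sum>f\<in>Z. if \<alpha> e \<in> Q then cscale (S e f) (V f k) else 0)"
      proof (rule sum.cong[OF refl])
        fix f assume f: "f \<in> Z"
        show "cscale (S e f) (if \<alpha> f \<in> Q then V f k else 0) = (if \<alpha> e \<in> Q then cscale (S e f) (V f k) else 0)"
          using S1[rule_format, OF e f] by (cases "S e f = 0") auto
      qed
      also have "\<dots> = V e (I A 1 *\<^sub>v (M *\<^sub>v k))" using mu[OF e Mv[OF k]] VM[OF e k] by simp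
      finally show "V e (M *\<^sub>v (I A 1 *\<^sub>v k)) = V e (I A 1 *\<^sub>v (M *\<^sub>v k))" .
    qed (use Mv mu_vec A k in auto)
  qed
  have "vinner h (\<Theta> A a *\<^sub>v k) = vinner (M *\<^sub>v h) (I A a *\<^sub>v (M *\<^sub>v k))"
    if A: "A \<in> sets X" and h: "h \<in> carrier_vec N" and k: "k \<in> carrier_vec N" for A a h k
    using sT[OF A h k, of a] factor[OF mu_vec[OF A h] mu_vec[OF A k], of a]
      commute[OF A h] commute[OF A k] sI[OF A Mv[OF h] Mv[OF k], of a] by simp
  with M show thesis by (rule that)
qed

end

text \<open>Substituting the inverse \<open>T'\<close> of \<open>T\<close> into the hypothesis gives
  \<open>J A a = U^* (I A a) U\<close> for \<open>U = M T'\<close>. At the whole space and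
  \<open>a = 1\<close> both instruments are the identity, so \<open>U\<close> is an isometry, and a
  square isometry is unitary.\<close>

lemma unitary_of_dominated:
  assumes J: "ucp_instrument X N J" and I: "ucp_instrument X N I"
    and T: "T \<in> carrier_mat N N" "invertible_mat T" and M: "M \<in> carrier_mat N N"
    and eq: "\<And>A a h k. A \<in> sets X \<Longrightarrow> h \<in> carrier_vec N \<Longrightarrow> k \<in> carrier_vec N \<Longrightarrow>
      vinner h ((madj T * J A a * T) *\<^sub>v k) = vinner (M *\<^sub>v h) (I A a *\<^sub>v (M *\<^sub>v k))"
  shows "\<exists>U. unitary_mat N U \<and> (\<forall>A\<in>sets X. \<forall>a. J A a = madj U * I A a * U)"
proof -
  have cJ: "J A a \<in> carrier_mat N N" and cI: "I A a \<in> carrier_mat N N" if "A \<in> sets X" for A a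
    using J I that cp_instrument_carrier unfolding ucp_instrument_def by blast+
  from T obtain T' where T': "T * T' = 1\<^sub>m N" "T' * T = 1\<^sub>m (dim_row T')"
    unfolding invertible_mat_def inverts_mat_def by auto
  have T'c: "T' \<in> carrier_mat N N"
  proof
    show "dim_col T' = N" using arg_cong[OF T'(1), of dim_col] by simp
    show "dim_row T' = N" using arg_cong[OF T'(2), of dim_col] T(1) by simp
  qed
  define U where "U = M * T'"
  have U: "U \<in> carrier_mat N N" unfolding U_def using M T'c by simp
  have JU: "vinner h (J A a *\<^sub>v k) = vinner (U *\<^sub>v h) (I A a *\<^sub>v (U *\<^sub>v k))"
    if A: "A \<in> sets X" and h: "h \<in> carrier_vec N" and k: "k \<in> carrier_vec N" for A a h k
  proof -
    have v: "T' *\<^sub>v w \<in> carrier_vec N" "T *\<^sub>v (T' *\<^sub>v w) = w" "U *\<^sub>v w = M *\<^sub>v (T' *\<^sub>v w)" if "w \<in> carrier_vec N" for w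
      using that T'c T(1) M assoc_mult_mat_vec[OF T(1) T'c that] assoc_mult_mat_vec[OF M T'c that]
      by (auto simp: T'(1) U_def)
    have "vinner h (J A a *\<^sub>v k) = vinner (T *\<^sub>v (T' *\<^sub>v h)) (J A a *\<^sub>v (T *\<^sub>v (T' *\<^sub>v k)))" using v h k by simp
    also have "\<dots> = vinner (T' *\<^sub>v h) ((madj T * J A a * T) *\<^sub>v (T' *\<^sub>v k))"
      by (rule vinner_compress[symmetric, OF cJ[OF A] T(1) v(1)[OF h] v(1)[OF k]])
    also have "\<dots> = vinner (U *\<^sub>v h) (I A a *\<^sub>v (U *\<^sub>v k))" using eq[OF A v(1)[OF h] v(1)[OF k]] v(3) h k by simp
    finally show ?thesis .
  qed
  have Jc: "J A a = madj U * I A a * U" if A: "A \<in> sets X" for A a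
    by (rule mat_eq_vinnerI[OF cJ[OF A] mult_carrier_mat[OF mult_carrier_mat[OF madj_carrier[OF U] cI[OF A]] U]])
      (simp add: JU[OF A] vinner_compress[OF cI[OF A] U])
  have "1\<^sub>m N = madj U * 1\<^sub>m N * U"
    using Jc[OF sets.top, of 1] I J unfolding ucp_instrument_def by simp
  then have "madj U * U = 1\<^sub>m N" using madj_carrier[OF U] by simp
  moreover from this have "U * madj U = 1\<^sub>m N" by (rule mat_mult_left_right_inverse[OF madj_carrier[OF U] U])
  ultimately have "unitary_mat N U" unfolding unitary_mat_def using U by blast
  with Jc show ?thesis by blast
qed

theorem theorem4p10:
  fixes X :: "'x measure" and N :: nat
    and I :: "'x set \<Rightarrow> 'a::cstar_algebra \<Rightarrow> complex mat"
    and L :: nat and d m :: "nat \<Rightarrow> nat"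
    and \<psi> :: "nat \<Rightarrow> 'a \<Rightarrow> complex mat"
    and W :: "complex mat"
    and \<pi> :: "'a \<Rightarrow> 'p::chilbert \<Rightarrow> 'p"
    and v :: "nat \<Rightarrow> nat \<Rightarrow> 'p"
  assumes ucp: "ucp_instrument X N I"
    and spectral: "\<forall>A\<in>sets X. I A 1 * I A 1 = I A 1 \<and> madj (I A 1) = I A 1"
    and dimN: "N = (\<Sum>i<L. d i * m i)"
    and W: "unitary_mat N W"
    and decomp: "\<forall>a. I (space X) a = madj W * diag_block_mat (map (\<lambda>i. tensor_id (\<psi> i a) (m i)) [0..<L]) * W"
    and pure: "\<forall>i<L. ucp_map (d i) (\<psi> i) \<and> pure_cp (d i) (\<psi> i)"
    and irr: "irreducible_rep \<pi>"
    and stinespring: "\<forall>i<L. \<forall>a. \<psi> i a = mat (d i) (d i) (\<lambda>(j, k). cinner (v i j) (\<pi> a (v i k)))"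
    and minimal: "\<forall>i<L. closure (cspan {\<pi> a (v i k) | a k. k < d i}) = UNIV"
    and nest: "\<forall>i<L. \<forall>j<L. cspan (v i ` {..<d i}) \<subseteq> cspan (v j ` {..<d j})
                              \<or> cspan (v j ` {..<d j}) \<subseteq> cspan (v i ` {..<d i})"
  shows "cstar_extreme X N I"
  unfolding cstar_extreme_def
proof (intro conjI allI impI)
  show "ucp_instrument X N I" by (rule ucp)
  fix n :: nat and T :: "nat \<Rightarrow> complex mat" and J :: "nat \<Rightarrow> 'x set \<Rightarrow> 'a \<Rightarrow> complex mat"
  assume asm: "(\<forall>i<n. ucp_instrument X N (J i) \<and> T i \<in> carrier_mat N N \<and> invertible_mat (T i))
        \<and> msum N (\<lambda>i. madj (T i) * T i) {..<n} = 1\<^sub>m N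
        \<and> (\<forall>A\<in>sets X. \<forall>a. I A a = msum N (\<lambda>i. madj (T i) * J i A a * T i) {..<n})"
  have sn: "stinespring_nest L d \<psi> \<pi> v"
    by (rule stinespring_nest.intro[OF pure irr stinespring minimal nest])
  have cpI: "cp_map N (I (space X))" "I (space X) 1 = 1\<^sub>m N"
    using ucp unfolding ucp_instrument_def cp_instrument_def by auto
  obtain Z0 :: "(nat \<times> nat) set" and \<kappa>0 V0 where "nest_system L d \<psi> \<pi> v N (I (space X)) Z0 \<kappa>0 V0"
    by (rule nest_system_of_decomposition[OF sn cpI dimN W decomp])
  then interpret ni0: nest_instrument X N I L d \<psi> \<pi> v Z0 \<kappa>0 V0
    by (intro nest_instrument.intro spectral_instrument.intro ucp spectral)
  obtain \<P> where P: "finite \<P>" "\<P> \<subseteq> sets X" "disjoint \<P>"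
    and gen: "\<And>B. B \<in> sets X \<Longrightarrow> \<exists>S\<subseteq>\<P>. \<forall>h\<in>carrier_vec N. \<forall>k\<in>carrier_vec N.
        vinner h (I B 1 *\<^sub>v k) = (\<Sum>A\<in>S. vinner h (I A 1 *\<^sub>v k))"
    and total: "\<And>h k. h \<in> carrier_vec N \<Longrightarrow> k \<in> carrier_vec N \<Longrightarrow> vinner h k = (\<Sum>A\<in>\<P>. vinner h (I A 1 *\<^sub>v k))"
    by (rule ni0.atoms) (rule that)
  obtain Z :: "('x set \<times> nat \<times> nat) set" and \<kappa> V where ni: "nest_instrument X N I L d \<psi> \<pi> v Z \<kappa> V"
    and at: "\<And>e. e \<in> Z \<Longrightarrow> fst e \<in> \<P>"
    and eig: "\<And>e A k. e \<in> Z \<Longrightarrow> A \<in> \<P> \<Longrightarrow> k \<in> carrier_vec N \<Longrightarrow> V e (I A 1 *\<^sub>v k) = (if fst e = A then V e k else 0)"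
    by (rule ni0.diagonalize_projections[OF P total]) (assumption | rule that)+
  interpret nest_instrument X N I L d \<psi> \<pi> v Z \<kappa> V by (rule ni)
  have "\<exists>U. unitary_mat N U \<and> (\<forall>A\<in>sets X. \<forall>a. J i A a = madj U * I A a * U)" if i: "i < n" for i
  proof -
    define \<Theta> where "\<Theta> j A a = madj (T j) * J j A a * T j" for j A a
    have J: "ucp_instrument X N (J j)" and Tc: "T j \<in> carrier_mat N N" "invertible_mat (T j)" if "j < n" for j
      using asm that by auto
    have T: "cp_instrument X N (\<Theta> j)" if "j < n" for j
      unfolding \<Theta>_def using J[OF that] Tc[OF that] unfolding ucp_instrument_def by (intro cp_instrument_compress) auto
    \<comment> \<open>All summands of the decomposition of \<open>I A\<close> are completely
      positive, so each one is dominated by the sum.\<close>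
    have le: "Re (cp_form (\<Theta> i A) xs xs) \<le> Re (cp_form (I A) xs xs)"
      if A: "A \<in> sets X" and xs: "vec_list N xs" for A xs
    proof -
      have "vinner (snd x) (I A b *\<^sub>v snd y) = (\<Sum>j<n. vinner (snd x) (\<Theta> j A b *\<^sub>v snd y))"
        if "x \<in> set xs" "y \<in> set xs" for x y b
      proof -
        have "I A b = msum N (\<lambda>j. \<Theta> j A b) {..<n}" using asm A unfolding \<Theta>_def by blast
        moreover have "\<Theta> j A b \<in> carrier_mat N N" if "j \<in> {..<n}" for j
          using that by (intro cp_instrument_carrier[OF T A]) simp
        ultimately show ?thesis
          using that xs vinner_msum[of "{..<n}" "\<lambda>j. \<Theta> j A b" N "snd x" "snd y"] by auto
      qed
      then have "cp_form (I A) xs xs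
          = (\<Sum>x\<leftarrow>xs. \<Sum>y\<leftarrow>xs. \<Sum>j<n. vinner (snd x) (\<Theta> j A (cstar (fst x) * fst y) *\<^sub>v snd y))"
        unfolding cp_form_def by (simp cong: map_cong)
      also have "\<dots> = (\<Sum>j<n. cp_form (\<Theta> j A) xs xs)"
        unfolding sum_list_sum_list_sum cp_form_def ..
      finally have "Re (cp_form (I A) xs xs) = (\<Sum>j<n. Re (cp_form (\<Theta> j A) xs xs))" by simp
      moreover have "0 \<le> Re (cp_form (\<Theta> j A) xs xs)" if "j < n" for j
        using T[OF that] A xs unfolding cp_instrument_def by (intro cp_form_nonneg) auto
      then have "Re (cp_form (\<Theta> i A) xs xs) \<le> (\<Sum>j<n. Re (cp_form (\<Theta> j A) xs xs))"
        using i by (intro member_le_sum) auto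
      ultimately show ?thesis by simp
    qed
    obtain M where M: "M \<in> carrier_mat N N"
      and eq: "\<And>A a h k. A \<in> sets X \<Longrightarrow> h \<in> carrier_vec N \<Longrightarrow> k \<in> carrier_vec N \<Longrightarrow>
        vinner h (\<Theta> i A a *\<^sub>v k) = vinner (M *\<^sub>v h) (I A a *\<^sub>v (M *\<^sub>v k))"
      by (rule dominated_factorization[OF P(1,2) gen total at eig T[OF i] le]) (assumption | rule that)+
    show ?thesis
      by (rule unitary_of_dominated[OF J[OF i] ucp Tc[OF i] M eq[unfolded \<Theta>_def]])
  qed
  then show "\<exists>U. \<forall>i<n. unitary_mat N (U i) \<and> (\<forall>A\<in>sets X. \<forall>a. J i A a = madj (U i) * I A a * U i)"
    by metis
qed

end
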